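(* Let $(H,\|\cdot\|)$ be a Hilbert space and $E$ a linear operator in $H$. The following are equivalent. (i) $E$ generates a $C_0$-semigroup $\mathcal T$ similar to a semigroup of isometries (i.e. $(RT(t)R^{-1})_{t\ge0}$ consists of isometries for some invertible $R\in\mathcal L(H)$). (ii) $E$ generates a $C_0$-semigroup $\mathcal T=(T(t))_{t\ge0}$, and there exist a Hilbert space $(K,\|\cdot\|_K)$ and a densely defined linear operator $C:\operatorname{dom}(C)\subseteq H\to K$ with $T(t)(\operatorname{dom}(C))\subseteq\operatorname{dom}(C)$ for all $t\ge0$, with $t\mapsto CT(t)h$ Bochner measurable on $[0,\infty)$ for every $h\in\operatorname{dom}(C)$, and constants $\alpha,\beta>0$ such that either $$\alpha\|h\|^2\le\limsup_{t\to\infty}\frac1t\int_0^t\|CT(s)h\|_K^2\,ds\le\beta\|h\|^2\quad\text{for all }h\in\operatorname{dom}(C),$$ or the same holds with $\liminf$ in place of $\limsup$. (iii) $\sigma(E)\subseteq\{z\in\mathbb C:\operatorname{Re}z\le0\}$ and there exist a Hilbert space $K$ and a densely defined linear operator $C:\operatorname{dom}(C)\subseteq H\to K$ such that (a) $\operatorname{dom}(E)\subseteq\operatorname{dom}(C)$; (b) for each $\varepsilon>0$ and $h\in H$ the map $\mathbb R\ni\xi\mapsto C(\varepsilon+i\xi-E)^{-1}h$ is Bochner measurable; (c) there exist $\alpha,\beta>0$ with $$\limsup_{\varepsilon\to0^+}\varepsilon\int_{-\infty}^\infty\|C(\varepsilon+i\xi-E)^{-1}h\|_K^2\,d\xi\le\beta\|h\|^2,\qquad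 \liminf_{\varepsilon\to0^+}\varepsilon\int_{-\infty}^\infty\|C(\varepsilon+i\xi-E)^{-1}h\|_K^2\,d\xi\ge\alpha\|h\|^2$$ for all $h\in H$.
   Context: $E$ is not assumed a priori to be densely defined; its resolvent set $\rho(E)$ is the set of $\lambda\in\mathbb C$ for which $(\lambda-E)^{-1}$ exists and is bounded on $H$, and $\sigma(E)=\mathbb C\setminus\rho(E)$. *)

theory Defs
  imports "HOL-Analysis.Analysis"
begin

text \<open>A complex Hilbert space is modelled as a real Hilbert space (type class
  real_inner + complete_space) together with an orthogonal complex structure J
  (multiplication by the imaginary unit).\<close>

definition cstruct :: "('h::real_inner \<Rightarrow> 'h) \<Rightarrow> bool" where
  "cstruct J \<longleftrightarrow> linear J \<and> (\<forall>x. J (J x) = - x) \<and> (\<forall>x y. inner (J x) (J y) = inner x y)"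

definition cscale :: "('h::real_vector \<Rightarrow> 'h) \<Rightarrow> complex \<Rightarrow> 'h \<Rightarrow> 'h" where
  "cscale J c x = Re c *\<^sub>R x + Im c *\<^sub>R J x"

definition csubspace :: "('h::real_vector \<Rightarrow> 'h) \<Rightarrow> 'h set \<Rightarrow> bool" where
  "csubspace J D \<longleftrightarrow> subspace D \<and> (\<forall>x\<in>D. J x \<in> D)"

definition lin_op :: "('h::real_vector \<Rightarrow> 'h) \<Rightarrow> ('k::real_vector \<Rightarrow> 'k) \<Rightarrow> 'h set \<Rightarrow> ('h \<Rightarrow> 'k) \<Rightarrow> bool" where
  "lin_op J JK D A \<longleftrightarrow> csubspace J D \<and>
     (\<forall>x\<in>D. \<forall>y\<in>D. A (x + y) = A x + A y) \<and>
     (\<forall>x\<in>D. \<forall>c::real. A (c *\<^sub>R x) = c *\<^sub>R A x) \<and>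
     (\<forall>x\<in>D. A (J x) = JK (A x))"

definition bounded_clinear_op :: "('h::real_normed_vector \<Rightarrow> 'h) \<Rightarrow> ('k::real_normed_vector \<Rightarrow> 'k) \<Rightarrow> ('h \<Rightarrow> 'k) \<Rightarrow> bool" where
  "bounded_clinear_op J JK A \<longleftrightarrow> bounded_linear A \<and> (\<forall>x. A (J x) = JK (A x))"

definition c0_semigroup :: "('h::real_normed_vector \<Rightarrow> 'h) \<Rightarrow> (real \<Rightarrow> 'h \<Rightarrow> 'h) \<Rightarrow> bool" where
  "c0_semigroup J T \<longleftrightarrow>
     (\<forall>t\<ge>0. bounded_clinear_op J J (T t)) \<and>
     T 0 = id \<and>
     (\<forall>s\<ge>0. \<forall>t\<ge>0. T (s + t) = T s \<circ> T t) \<and>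
     (\<forall>x. ((\<lambda>t. T t x) \<longlongrightarrow> x) (at_right 0))"

definition generates :: "('h::real_normed_vector \<Rightarrow> 'h) \<Rightarrow> 'h set \<Rightarrow> ('h \<Rightarrow> 'h) \<Rightarrow> (real \<Rightarrow> 'h \<Rightarrow> 'h) \<Rightarrow> bool" where
  "generates J D E T \<longleftrightarrow> c0_semigroup J T \<and>
     (\<forall>x. x \<in> D \<longleftrightarrow> (\<exists>y. ((\<lambda>t. (1 / t) *\<^sub>R (T t x - x)) \<longlongrightarrow> y) (at_right 0))) \<and>
     (\<forall>x\<in>D. ((\<lambda>t. (1 / t) *\<^sub>R (T t x - x)) \<longlongrightarrow> E x) (at_right 0))"

definition resolvent_set :: "('h::real_normed_vector \<Rightarrow> 'h) \<Rightarrow> 'h set \<Rightarrow> ('h \<Rightarrow> 'h) \<Rightarrow> complex set" where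
  "resolvent_set J D E = {lam. \<exists>R. bounded_linear R \<and>
      (\<forall>x\<in>D. R (cscale J lam x - E x) = x) \<and>
      (\<forall>y. R y \<in> D \<and> cscale J lam (R y) - E (R y) = y)}"

definition spectrum :: "('h::real_normed_vector \<Rightarrow> 'h) \<Rightarrow> 'h set \<Rightarrow> ('h \<Rightarrow> 'h) \<Rightarrow> complex set" where
  "spectrum J D E = - resolvent_set J D E"

definition resolvent :: "('h::real_normed_vector \<Rightarrow> 'h) \<Rightarrow> 'h set \<Rightarrow> ('h \<Rightarrow> 'h) \<Rightarrow> complex \<Rightarrow> 'h \<Rightarrow> 'h" where
  "resolvent J D E lam y = (THE x. x \<in> D \<and> cscale J lam x - E x = y)"

definition bochner_measurable :: "'a measure \<Rightarrow> ('a \<Rightarrow> 'b::real_normed_vector) \<Rightarrow> bool" where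
  "bochner_measurable M f \<longleftrightarrow>
     (\<exists>s. (\<forall>i::nat. simple_function M (s i)) \<and> (AE x in M. (\<lambda>i. s i x) \<longlonglongrightarrow> f x))"

definition cond_i :: "('h::{real_inner,complete_space} \<Rightarrow> 'h) \<Rightarrow> 'h set \<Rightarrow> ('h \<Rightarrow> 'h) \<Rightarrow> bool" where
  "cond_i J D E \<longleftrightarrow> (\<exists>T. generates J D E T \<and>
     (\<exists>R S. bounded_clinear_op J J R \<and> bounded_clinear_op J J S \<and>
        R \<circ> S = id \<and> S \<circ> R = id \<and>
        (\<forall>t\<ge>0. \<forall>x. norm (R (T t (S x))) = norm x)))"

text \<open>(ii), with the auxiliary Hilbert space K given by the type 'k and complex structure JK\<close>
definition cond_ii :: "('h::{real_inner,complete_space} \<Rightarrow> 'h) \<Rightarrow> ('k::{real_inner,complete_space} \<Rightarrow> 'k)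
     \<Rightarrow> 'h set \<Rightarrow> ('h \<Rightarrow> 'h) \<Rightarrow> bool" where
  "cond_ii J JK D E \<longleftrightarrow> cstruct JK \<and> (\<exists>T. generates J D E T \<and>
     (\<exists>DC (C::'h \<Rightarrow> 'k). lin_op J JK DC C \<and> closure DC = UNIV \<and>
        (\<forall>t\<ge>0. T t ` DC \<subseteq> DC) \<and>
        (\<forall>h\<in>DC. bochner_measurable (lebesgue_on {0..}) (\<lambda>t. C (T t h))) \<and>
        (\<exists>\<alpha> \<beta>::real. \<alpha> > 0 \<and> \<beta> > 0 \<and>
          ((\<forall>h\<in>DC.
              ennreal (\<alpha> * (norm h)\<^sup>2) \<le> Limsup at_top (\<lambda>t. ennreal (1 / t) *
                  set_nn_integral lebesgue {0..t} (\<lambda>s. ennreal ((norm (C (T s h)))\<^sup>2))) \<and>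
              Limsup at_top (\<lambda>t. ennreal (1 / t) *
                  set_nn_integral lebesgue {0..t} (\<lambda>s. ennreal ((norm (C (T s h)))\<^sup>2)))
                \<le> ennreal (\<beta> * (norm h)\<^sup>2))
           \<or>
           (\<forall>h\<in>DC.
              ennreal (\<alpha> * (norm h)\<^sup>2) \<le> Liminf at_top (\<lambda>t. ennreal (1 / t) *
                  set_nn_integral lebesgue {0..t} (\<lambda>s. ennreal ((norm (C (T s h)))\<^sup>2))) \<and>
              Liminf at_top (\<lambda>t. ennreal (1 / t) *
                  set_nn_integral lebesgue {0..t} (\<lambda>s. ennreal ((norm (C (T s h)))\<^sup>2)))
                \<le> ennreal (\<beta> * (norm h)\<^sup>2))))))"

definition cond_iii :: "('h::{real_inner,complete_space} \<Rightarrow> 'h) \<Rightarrow> ('k::{real_inner,complete_space} \<Rightarrow> 'k)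
     \<Rightarrow> 'h set \<Rightarrow> ('h \<Rightarrow> 'h) \<Rightarrow> bool" where
  "cond_iii J JK D E \<longleftrightarrow> cstruct JK \<and>
     spectrum J D E \<subseteq> {z. Re z \<le> 0} \<and>
     (\<exists>DC (C::'h \<Rightarrow> 'k). lin_op J JK DC C \<and> closure DC = UNIV \<and>
        D \<subseteq> DC \<and>
        (\<forall>\<epsilon>>0. \<forall>h. bochner_measurable lebesgue
            (\<lambda>\<xi>. C (resolvent J D E (Complex \<epsilon> \<xi>) h))) \<and>
        (\<exists>\<alpha> \<beta>::real. \<alpha> > 0 \<and> \<beta> > 0 \<and>
          (\<forall>h. Limsup (at_right 0) (\<lambda>\<epsilon>. ennreal \<epsilon> *
                 (\<integral>\<^sup>+ \<xi>. ennreal ((norm (C (resolvent J D E (Complex \<epsilon> \<xi>) h)))\<^sup>2) \<partial>lebesgue))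
                 \<le> ennreal (\<beta> * (norm h)\<^sup>2) \<and>
               ennreal (\<alpha> * (norm h)\<^sup>2) \<le> Liminf (at_right 0) (\<lambda>\<epsilon>. ennreal \<epsilon> *
                 (\<integral>\<^sup>+ \<xi>. ennreal ((norm (C (resolvent J D E (Complex \<epsilon> \<xi>) h)))\<^sup>2) \<partial>lebesgue)))))"

end

theory Submission
  imports Defs
begin

text \<open>(ii) and (iii) both yield approximate inner products \<open>B\<^sub>i\<close>, namely
  \<open>1/t \<integral>\<^sub>0\<^sup>t \<langle>T(s)x, T(s)y\<rangle> ds\<close> and \<open>\<epsilon> \<integral> \<langle>C(\<epsilon> + i\<xi> - E)\<^sup>-\<^sup>1x, C(\<epsilon> + i\<xi> - E)\<^sup>-\<^sup>1y\<rangle> d\<xi>\<close>, which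
  are asymptotically equivalent to the original one. A limit along a finer filter, found by
  Tychonoff's theorem, is an equivalent inner product \<open>\<langle>Rx, Ry\<rangle>\<close> with \<open>R\<close> a square root. For the
  averages it is invariant under \<open>T\<close>; for the resolvents \<open>E\<close> is skew-symmetric with respect to it,
  so that \<open>R E R\<^sup>-\<^sup>1\<close> generates isometries, constructed as the limit of implicit Euler steps of
  dyadic size.

  For (i) \<open>\<Longrightarrow>\<close> (iii) take \<open>C = R\<close>. If \<open>A\<close> generates isometries \<open>U\<close>, then
  \<open>\<epsilon> \<parallel>(\<epsilon> + i\<xi> - A)\<^sup>-\<^sup>1y\<parallel>\<^sup>2 = Re \<langle>(\<epsilon> + i\<xi> - A)\<^sup>-\<^sup>1y, y\<rangle>\<close> is nonnegative and the Fourier transform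
  of \<open>e\<^sup>-\<^sup>\<epsilon>\<^sup>t \<langle>U(t)y, y\<rangle>\<close>, so Fejer means bound its integral from above and below.\<close>

section \<open>Orthogonality and limits along filters\<close>

text \<open>The bounds in (ii) and (iii) hold vector by vector and only as limes superior or
  inferior, which are not additive. Hence one filter has to serve all pairs of vectors at once; only
  then do bilinearity and invariance survive the limit. \<open>C\<close> may be unbounded without
  being closable, so it is never moved through a limit. In (ii) it only compares the growth of
  \<open>h\<close> and \<open>T(u)h\<close>; this bounds \<open>T(u)\<close> from both sides on the
  domain of \<open>C\<close>, then everywhere by density, and \<open>C\<close> is gone before any
  average is formed. In (iii) it enters through the algebraic identity \<open>C(\<lambda> -
  E)\<^sup>-\<^sup>1 E h = \<lambda> C(\<lambda> - E)\<^sup>-\<^sup>1 h - C h\<close>. Its real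
  inner product with \<open>C(\<lambda> - E)\<^sup>-\<^sup>1 h\<close> leaves a term that is of
  order \<epsilon> after scaling and integration, and a cross term with \<open>C h\<close> of order
  \<open>sqrt \<epsilon>\<close>. In (iii) there is no resolvent estimate to start from:
  skew-symmetry in the new inner product supplies contractivity and, with the range condition, the
  density of the domain. In (i) \<Longrightarrow> (iii) the Laplace transform is cut off at a finite
  time and the Fejer weight has compact support, so integrals are interchanged on compact rectangles
  only.\<close>

lemma exists_minimizing_representer:
  fixes D :: "'h::{real_inner,complete_space} set"
  assumes D: "subspace D" and f: "bounded_linear f"
  shows "\<exists>z\<in>closure D. \<forall>x\<in>D. f x = inner z x"
proof -
  interpret f: bounded_linear f by fact
  \<comment> \<open>Minimizing this functional covers two classical cases: \<open>D = UNIV\<close>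
    is the Riesz representation, and \<open>f = inner w\<close> is the projection of
    \<open>w\<close> onto \<open>closure D\<close>. As \<open>D\<close> need not be closed, the
    minimizer is only found in the closure.\<close>
  define \<Phi> where "\<Phi> x = (norm x)\<^sup>2 - 2 * f x" for x :: 'h
  obtain K where K: "\<And>x. norm (f x) \<le> norm x * K" using f.bounded by blast
  have low: "- K\<^sup>2 \<le> \<Phi> x" for x
  proof -
    have "f x \<le> norm x * K" using K[of x] by simp
    moreover have "0 \<le> (norm x - K)\<^sup>2" by simp
    ultimately show ?thesis unfolding \<Phi>_def by (simp add: power2_eq_square algebra_simps)
  qed
  define m where "m = Inf (\<Phi> ` D)"
  have D0: "0 \<in> D" using D subspace_0 by blast
  have bdd: "bdd_below (\<Phi> ` D)" using low by (auto simp: bdd_below_def)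
  have mle: "m \<le> \<Phi> x" if "x \<in> D" for x
    unfolding m_def using bdd that by (simp add: cInf_lower)
  have "\<exists>x\<in>D. \<Phi> x < m + inverse (real (Suc n))" for n
  proof -
    have "Inf (\<Phi> ` D) < m + inverse (real (Suc n))" by (simp add: m_def)
    then show ?thesis using cInf_lessD[of "\<Phi> ` D"] D0 by blast
  qed
  then obtain X where XD: "\<And>n. X n \<in> D" and X: "\<And>n. \<Phi> (X n) < m + inverse (real (Suc n))" by metis
  define r where "r n = inverse (real (Suc n))" for n
  have Xr: "\<Phi> (X n) < m + r n" for n using X unfolding r_def .
  \<comment> \<open>Parallelogram law: the midpoint of \<open>x\<close> and \<open>y\<close> cannot
    go below the infimum, so two near-minimizers are close to each other.\<close>
  have par: "(norm (x - y))\<^sup>2 \<le> 2 * (\<Phi> x - m) + 2 * (\<Phi> y - m)" if "x \<in> D" "y \<in> D" for x y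
  proof -
    have "(1/2) *\<^sub>R (x + y) \<in> D" using D that by (simp add: subspace_add subspace_scale)
    then have "m \<le> \<Phi> ((1/2) *\<^sub>R (x + y))" by (rule mle)
    also have "\<dots> = \<Phi> x / 2 + \<Phi> y / 2 - (norm (x - y))\<^sup>2 / 4"
      unfolding \<Phi>_def power2_norm_eq_inner
      by (simp add: f.scaleR f.add inner_add_left inner_add_right inner_diff_left inner_diff_right
          inner_commute field_simps)
    finally show ?thesis by simp
  qed
  have "Cauchy X"
  proof (rule CauchyI)
    fix e :: real assume e: "0 < e"
    obtain N where N: "inverse (real (Suc N)) < e\<^sup>2 / 4"
      using e reals_Archimedean[of "e\<^sup>2/4"] by auto
    have "norm (X i - X j) < e" if "i \<ge> N" "j \<ge> N" for i j
    proof -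
      have "r i \<le> r N" "r j \<le> r N"
        using that by (auto simp: field_simps r_def)
      have "\<Phi> (X i) - m < r N" "\<Phi> (X j) - m < r N" using Xr[of i] Xr[of j] \<open>r i \<le> r N\<close> \<open>r j \<le> r N\<close> by linarith+
      then have "2 * (\<Phi> (X i) - m) + 2 * (\<Phi> (X j) - m) < e\<^sup>2" using N[folded r_def] by argo
      with par[OF XD XD] have "(norm (X i - X j))\<^sup>2 < e\<^sup>2" by (rule le_less_trans)
      then show ?thesis using e by (simp add: power2_less_imp_less)
    qed
    then show "\<exists>M. \<forall>m\<ge>M. \<forall>n\<ge>M. norm (X m - X n) < e" by blast
  qed
  then obtain z where z: "X \<longlonglongrightarrow> z" using Cauchy_convergent convergent_def by blast
  have zc: "z \<in> closure D" using z XD closure_sequential by blast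
  have "(\<lambda>n. \<Phi> (X n)) \<longlonglongrightarrow> \<Phi> z"
    unfolding \<Phi>_def by (intro tendsto_intros z f.tendsto)
  moreover have "(\<lambda>n. m + inverse (real (Suc n))) \<longlonglongrightarrow> m + 0"
    by (intro tendsto_intros LIMSEQ_inverse_real_of_nat)
  ultimately have zm: "\<Phi> z \<le> m" using X by (intro LIMSEQ_le[of "\<lambda>n. \<Phi> (X n)" _ "\<lambda>n. m + inverse (real (Suc n))"]) (auto intro: less_imp_le)
  have mcl: "m \<le> \<Phi> (z + x)" if "x \<in> D" for x
  proof -
    have "(\<lambda>n. \<Phi> (X n + x)) \<longlonglongrightarrow> \<Phi> (z + x)"
      unfolding \<Phi>_def by (intro tendsto_intros z f.tendsto)
    moreover have "m \<le> \<Phi> (X n + x)" for n using D XD that by (intro mle) (simp add: subspace_add)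
    ultimately show ?thesis by (simp add: LIMSEQ_le_const)
  qed
  have "f x = inner z x" if x: "x \<in> D" for x
  proof -
    define c where "c = inner z x - f x"
    have q: "0 \<le> t\<^sup>2 * (norm x)\<^sup>2 + 2 * t * c" for t
    proof -
      have "\<Phi> z \<le> \<Phi> (z + t *\<^sub>R x)" using mcl[of "t *\<^sub>R x"] zm D x by (simp add: subspace_scale)
      then show ?thesis
        unfolding \<Phi>_def c_def power2_norm_eq_inner
        by (simp add: f.add f.scaleR inner_add_left inner_add_right inner_commute algebra_simps power2_eq_square)
    qed
    have "c = 0"
    proof (rule ccontr)
      assume c: "c \<noteq> 0"
      \<comment> \<open>The parabola in \<open>t\<close> would be tested at
        \<open>- c / (norm x)\<^sup>2\<close>; adding 1 keeps the denominator positive when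
        \<open>x = 0\<close>.\<close>
      define n where "n = (norm x)\<^sup>2 + 1"
      have n: "n > 0" unfolding n_def by (simp add: add_nonneg_pos)
      have "0 \<le> (- c / n)\<^sup>2 * (norm x)\<^sup>2 + 2 * (- c / n) * c" by (rule q)
      also have "\<dots> \<le> (- c / n)\<^sup>2 * n + 2 * (- c / n) * c"
        by (intro add_right_mono mult_left_mono) (auto simp: n_def)
      also have "\<dots> = - (c\<^sup>2 / n)" using n by (simp add: field_simps power2_eq_square)
      also have "\<dots> < 0" using n c by simp
      finally show False by simp
    qed
    then show ?thesis by (simp add: c_def)
  qed
  then show ?thesis using zc by blast
qed

lemma riesz_representation:
  fixes f :: "'h::{real_inner,complete_space} \<Rightarrow> real"
  assumes "bounded_linear f"
  shows "\<exists>z. \<forall>x. f x = inner z x"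
  using exists_minimizing_representer[OF subspace_UNIV assms] by auto

text \<open>The representer of \<open>inner w\<close> is the projection \<open>z\<close> of
  \<open>w\<close> onto \<open>closure D\<close>, and \<open>w - z\<close> is orthogonal to
  \<open>D\<close>.\<close>

lemma dense_if_orthogonal_trivial:
  fixes D :: "'h::{real_inner,complete_space} set"
  assumes "subspace D" and "\<And>y. (\<forall>x\<in>D. inner y x = 0) \<Longrightarrow> y = 0"
  shows "closure D = UNIV"
proof -
  have "w \<in> closure D" for w
  proof -
    obtain z where z: "z \<in> closure D" "\<forall>x\<in>D. inner w x = inner z x"
      using exists_minimizing_representer[OF assms(1) bounded_linear_inner_right[of w]] by blast
    then have "w - z = 0" by (intro assms(2)) (simp add: inner_diff_left)
    then show ?thesis using z by simp
  qed
  then show ?thesis by blast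
qed

text \<open>Tychonoff: the functions \<open>f i\<close> lie in a product of compact intervals, where
  they have a cluster point along \<open>F\<close>; the finer filter follows \<open>f\<close>
  towards it. A single \<open>G\<close> works for all \<open>h\<close>, which separate subsequences
  would not achieve.\<close>

lemma cluster_filter:
  fixes f :: "'i \<Rightarrow> 'a \<Rightarrow> real"
  assumes F: "F \<noteq> bot" and b: "\<And>h. eventually (\<lambda>i. \<bar>f i h\<bar> \<le> b h) F"
  shows "\<exists>G\<le>F. G \<noteq> bot \<and> (\<forall>h. \<exists>l. ((\<lambda>i. f i h) \<longlongrightarrow> l) G)"
proof -
  \<comment> \<open>The bound at \<open>h\<close> holds from some index on that depends on
    \<open>h\<close>, so no \<open>f i\<close> need lie in the whole product. Resetting out-of-range
    values to 0 forces every \<open>g i\<close> into it, and each coordinate changes only on a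
    negligible set of indices.\<close>
  define g where "g i h = (if \<bar>f i h\<bar> \<le> b h then f i h else 0)" for i h
  define U where "U = PiE UNIV (\<lambda>h. {- \<bar>b h\<bar>..\<bar>b h\<bar>})"
  have "compactin (product_topology (\<lambda>_. euclidean) UNIV) U"
    unfolding U_def by (subst compactin_PiE) auto
  then have U: "compact U" by (simp add: euclidean_product_topology flip: compactin_euclidean_iff)
  have "g i \<in> U" for i unfolding U_def g_def by (auto simp: PiE_def)
  then have "\<exists>x\<in>U. inf (nhds x) (filtermap g F) \<noteq> bot"
  proof -
    have "filtermap g F \<noteq> bot" using F by (simp add: filtermap_bot_iff)
    moreover have "eventually (\<lambda>x. x \<in> U) (filtermap g F)"
      using \<open>\<And>i. g i \<in> U\<close> by (simp add: eventually_filtermap)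
    ultimately show ?thesis using U unfolding compact_filter by blast
  qed
  then obtain x where x: "inf (nhds x) (filtermap g F) \<noteq> bot" by blast
  \<comment> \<open>Indices far along \<open>F\<close> whose \<open>g i\<close> is near
    \<open>x\<close>. This filter is nontrivial exactly because \<open>x\<close> is a cluster
    point.\<close>
  define G where "G = inf (filtercomap g (nhds x)) F"
  have G: "G \<noteq> bot"
  proof
    assume "G = bot"
    then have "eventually (\<lambda>_. False) G" by simp
    then obtain P Q where P: "eventually P (filtercomap g (nhds x))" and Q: "eventually Q F"
      and PQ: "\<And>i. P i \<Longrightarrow> Q i \<Longrightarrow> False"
      unfolding G_def eventually_inf by blast
    obtain P' where P': "eventually P' (nhds x)" "\<And>i. P' (g i) \<Longrightarrow> P i"
      using P unfolding eventually_filtercomap by blast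
    have "eventually (\<lambda>y. \<not> P' y) (filtermap g F)"
      unfolding eventually_filtermap using Q by eventually_elim (use P' PQ in blast)
    then have "eventually (\<lambda>_. False) (inf (nhds x) (filtermap g F))"
      unfolding eventually_inf using P'(1) by blast
    then show False using x by (simp add: eventually_False)
  qed
  have "((\<lambda>i. f i h) \<longlongrightarrow> x h) G" for h
  proof -
    have "filterlim g (nhds x) (filtercomap g (nhds x))" by (rule filterlim_filtercomap)
    then have "filterlim g (nhds x) G" unfolding G_def filterlim_def
      by (rule order_trans[OF filtermap_mono[OF inf_le1]])
    moreover have "((\<lambda>y. y h) \<longlongrightarrow> x h) (at x)"
      using continuous_on_product_coordinates[of h] by (auto simp: continuous_on_def)
    then have "((\<lambda>y. y h) \<longlongrightarrow> x h) (nhds x)"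
      by (rule tendsto_at_iff_tendsto_nhds[THEN iffD1])
    ultimately have "((\<lambda>i. g i h) \<longlongrightarrow> x h) G" by (rule filterlim_compose[rotated])
    moreover have "eventually (\<lambda>i. g i h = f i h) G"
      unfolding G_def using b[of h] by (intro filter_leD[OF inf_le2]) (auto simp: g_def elim: eventually_mono)
    ultimately show ?thesis by (rule Lim_transform_eventually)
  qed
  then show ?thesis using G by (intro exI[of _ G]) (auto simp: G_def)
qed

section \<open>A copy of the Hilbert space in the class of Banach spaces\<close>

text \<open>The sort of \<open>'h\<close> is not a subsort of \<^class>\<open>banach\<close>, although both have the same axioms.
  The type copy makes the library results on Banach spaces available.\<close>

typedef (overloaded) 'a hil = "UNIV :: 'a::{real_inner,complete_space} set"
  morphisms of_hil to_hil by simp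

setup_lifting type_definition_hil

instantiation hil :: ("{real_inner,complete_space}") real_inner
begin
lift_definition zero_hil :: "'a hil" is 0 .
lift_definition plus_hil :: "'a hil \<Rightarrow> 'a hil \<Rightarrow> 'a hil" is "(+)" .
lift_definition minus_hil :: "'a hil \<Rightarrow> 'a hil \<Rightarrow> 'a hil" is "(-)" .
lift_definition uminus_hil :: "'a hil \<Rightarrow> 'a hil" is uminus .
lift_definition scaleR_hil :: "real \<Rightarrow> 'a hil \<Rightarrow> 'a hil" is scaleR .
lift_definition inner_hil :: "'a hil \<Rightarrow> 'a hil \<Rightarrow> real" is inner .
definition "norm (x :: 'a hil) = sqrt (inner x x)"
definition "sgn (x :: 'a hil) = inverse (norm x) *\<^sub>R x"
definition "dist (x :: 'a hil) y = norm (x - y)"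
definition "(uniformity :: ('a hil \<times> 'a hil) filter) = (INF e\<in>{0 <..}. principal {(x, y). dist x y < e})"
definition "open (U :: 'a hil set) = (\<forall>x\<in>U. eventually (\<lambda>(x', y). x' = x \<longrightarrow> y \<in> U) uniformity)"
instance
proof
  fix x y z :: "'a hil" and a b :: real and U :: "'a hil set"
  show "x + y + z = x + (y + z)" by transfer (rule add.assoc)
  show "x + y = y + x" by transfer (rule add.commute)
  show "0 + x = x" by transfer (rule add_0)
  show "- x + x = 0" by transfer (rule left_minus)
  show "x - y = x + - y" by transfer (rule diff_conv_add_uminus)
  show "a *\<^sub>R (x + y) = a *\<^sub>R x + a *\<^sub>R y" by transfer (rule scaleR_add_right)
  show "(a + b) *\<^sub>R x = a *\<^sub>R x + b *\<^sub>R x" by transfer (rule scaleR_add_left)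
  show "a *\<^sub>R b *\<^sub>R x = (a * b) *\<^sub>R x" by transfer (rule scaleR_scaleR)
  show "1 *\<^sub>R x = x" by transfer (rule scaleR_one)
  show "inner x y = inner y x" by transfer (rule inner_commute)
  show "inner (x + y) z = inner x z + inner y z" by transfer (rule inner_add_left)
  show "inner (a *\<^sub>R x) y = a * inner x y" by transfer (rule inner_scaleR_left)
  show "0 \<le> inner x x" by transfer (rule inner_ge_zero)
  show "inner x x = 0 \<longleftrightarrow> x = 0" by transfer (rule inner_eq_zero_iff)
qed (rule norm_hil_def sgn_hil_def dist_hil_def uniformity_hil_def open_hil_def)+
end

lemma norm_of_hil: "norm (of_hil x) = norm x"
  unfolding norm_hil_def norm_eq_sqrt_inner by transfer simp

lemma dist_of_hil: "dist (of_hil x) (of_hil y) = dist x y"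
  unfolding dist_norm minus_hil.rep_eq[symmetric] norm_of_hil ..

lemma of_to_hil [simp]: "of_hil (to_hil x) = x"
  by (simp add: to_hil_inverse)

lemma to_of_hil [simp]: "to_hil (of_hil x) = x"
  by (rule of_hil_inverse)

instance hil :: ("{real_inner,complete_space}") banach
proof
  fix X :: "nat \<Rightarrow> 'a hil" assume "Cauchy X"
  then have "Cauchy (\<lambda>n. of_hil (X n))" unfolding Cauchy_def dist_of_hil .
  then obtain l where "(\<lambda>n. of_hil (X n)) \<longlonglongrightarrow> l" using Cauchy_convergent convergent_def by blast
  then have "(\<lambda>n. of_hil (X n)) \<longlonglongrightarrow> of_hil (to_hil l)" by simp
  then have "X \<longlonglongrightarrow> to_hil l" unfolding tendsto_iff dist_of_hil .
  then show "convergent X" unfolding convergent_def by blast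
qed

lemma bounded_linear_of_hil: "bounded_linear of_hil"
  by (rule bounded_linear_intro[where K=1])
     (simp_all add: plus_hil.rep_eq scaleR_hil.rep_eq norm_of_hil)

lemma bounded_linear_to_hil: "bounded_linear to_hil"
proof (rule bounded_linear_intro[where K=1])
  show "norm (to_hil x) \<le> norm x * 1" for x :: 'a
    using norm_of_hil[of "to_hil x"] by simp
qed (simp_all add: plus_hil.abs_eq scaleR_hil.abs_eq)

lemma inner_of_hil: "inner (of_hil x) (of_hil y) = inner x y"
  by (simp add: inner_hil.rep_eq)

lemma integrable_continuous_hilbert:
  fixes f :: "real \<Rightarrow> 'h::{real_inner,complete_space}"
  assumes "continuous_on {a..b} f"
  shows "f integrable_on {a..b}"
proof -
  have "continuous_on {a..b} (to_hil \<circ> f)"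
    by (intro continuous_on_compose assms continuous_on_subset[OF linear_continuous_on[OF bounded_linear_to_hil] subset_UNIV])
  then have "(of_hil \<circ> (to_hil \<circ> f)) integrable_on {a..b}"
    by (intro integrable_linear bounded_linear_of_hil integrable_continuous_interval)
  then show ?thesis by (simp add: o_def)
qed

lemma has_integral_combine_hilbert:
  fixes f :: "real \<Rightarrow> 'h::{real_inner,complete_space}"
  assumes "a \<le> c" "c \<le> b" "(f has_integral i) {a..c}" "(f has_integral j) {c..b}"
  shows "(f has_integral (i + j)) {a..b}"
proof -
  have "((to_hil \<circ> f) has_integral (to_hil i + to_hil j)) {a..b}"
    using assms by (intro has_integral_combine[of a c b] has_integral_linear bounded_linear_to_hil)
  then have "((of_hil \<circ> (to_hil \<circ> f)) has_integral of_hil (to_hil i + to_hil j)) {a..b}"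
    by (rule has_integral_linear[OF _ bounded_linear_of_hil])
  then show ?thesis by (simp add: o_def plus_hil.rep_eq)
qed

section \<open>Equivalent inner products\<close>

text \<open>The fixed-point equation \<open>Y = (Z + Y\<^sup>2) / 2\<close> says
  \<open>(1 - Y)\<^sup>2 = 1 - Z\<close>. On the ball of radius \<open>norm Z < 1\<close> its
  right-hand side is a contraction with that same constant.\<close>

lemma sqrt_contraction_banach:
  fixes Z :: "'h::{real_inner,banach} \<Rightarrow>\<^sub>L 'h"
  assumes q: "norm Z < 1" and sym: "\<And>x y. inner (blinfun_apply Z x) y = inner x (blinfun_apply Z y)" and ZJ: "\<And>x. blinfun_apply Z (J x) = J (blinfun_apply Z x)"
    and J: "bounded_linear J"
  shows "\<exists>Y :: 'h \<Rightarrow>\<^sub>L 'h. norm Y < 1 \<and> (\<forall>x y. inner (blinfun_apply Y x) y = inner x (blinfun_apply Y y)) \<and> (\<forall>x. blinfun_apply Y (J x) = J (blinfun_apply Y x)) \<and>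
     (\<forall>x. 2 *\<^sub>R Y x = blinfun_apply Z x + blinfun_apply Y (blinfun_apply Y x))"
proof -
  define q where "q = norm Z"
  have q01: "0 \<le> q" "q < 1" using q by (auto simp: q_def)
  define f where "f Y = (1/2) *\<^sub>R (Z + (Y o\<^sub>L Y))" for Y :: "'h \<Rightarrow>\<^sub>L 'h"
  \<comment> \<open>Symmetry and commutation with \<open>J\<close> are closed conditions preserved
    by \<open>f\<close>. Building them into the complete set lets the fixed point inherit
    them.\<close>
  define S where "S = {Y :: 'h \<Rightarrow>\<^sub>L 'h. norm Y \<le> q \<and> (\<forall>x y. inner (blinfun_apply Y x) y = inner x (blinfun_apply Y y)) \<and> (\<forall>x. blinfun_apply Y (J x) = J (blinfun_apply Y x))}"
  interpret J: bounded_linear J by (rule J)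
  have "closed S"
  proof -
    have [continuous_intros]: "continuous_on UNIV (\<lambda>Y :: 'h \<Rightarrow>\<^sub>L 'h. blinfun_apply Y x)" for x
      by (rule linear_continuous_on[OF blinfun.bounded_linear_left])
    show ?thesis unfolding S_def
      by (intro closed_Collect_conj closed_Collect_all closed_Collect_le closed_Collect_eq
        continuous_on_inner continuous_on_const continuous_on_norm continuous_on_id J.continuous_on)
        (auto intro: continuous_intros)
  qed
  then have compl: "complete S" by (simp add: complete_eq_closed)
  have zero: "0 \<in> S" using q01 by (simp add: S_def J.zero)
  have fS: "f Y \<in> S" if Y: "Y \<in> S" for Y
  proof -
    have "norm (f Y) \<le> (1/2) * (norm Z + norm Y * norm Y)"
      unfolding f_def using norm_triangle_ineq[of Z "Y o\<^sub>L Y"] norm_blinfun_compose[of Y Y] by simp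
    also have "\<dots> \<le> (1/2) * (q + q * q)"
      using Y q01 unfolding S_def by (intro mult_left_mono add_mono mult_mono) (auto simp: q_def)
    also have "\<dots> \<le> q" using q01 mult_left_le[of q q] by simp
    finally have "norm (f Y) \<le> q" .
    moreover have "blinfun_apply (f Y) x = (1/2) *\<^sub>R (Z x + Y (Y x))" for x
      by (simp add: f_def blinfun.add_left blinfun.scaleR_left)
    moreover have "inner x (Y (Y y)) = inner (Y (Y x)) y" for x y using Y unfolding S_def by simp
    moreover have "Y (Y (J x)) = J (Y (Y x))" for x using Y unfolding S_def by simp
    ultimately show "f Y \<in> S"
      by (simp add: S_def inner_add_left inner_add_right J.add J.scaleR sym ZJ)
  qed
  have lip: "\<forall>x\<in>S. \<forall>y\<in>S. dist (f x) (f y) \<le> q * dist x y"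
  proof (intro ballI)
    fix X Y assume XY: "X \<in> S" "Y \<in> S"
    \<comment> \<open>\<open>X\<^sup>2 - Y\<^sup>2\<close> is split as
      \<open>X (X - Y) + (X - Y) Y\<close>, which is valid for operators that do not
      commute.\<close>
    have "f X - f Y = (1/2) *\<^sub>R ((X o\<^sub>L (X - Y)) + ((X - Y) o\<^sub>L Y))"
      unfolding f_def
      by (rule blinfun_eqI) (simp add: blinfun.add_left blinfun.diff_left blinfun.diff_right blinfun.scaleR_left algebra_simps)
    also have "norm \<dots> \<le> (1/2) * (norm X * norm (X - Y) + norm (X - Y) * norm Y)"
      using norm_triangle_ineq[of "X o\<^sub>L (X - Y)" "(X - Y) o\<^sub>L Y"]
        norm_blinfun_compose[of X "X - Y"] norm_blinfun_compose[of "X - Y" Y] by simp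
    also have "\<dots> \<le> (1/2) * (q * norm (X - Y) + norm (X - Y) * q)"
      using XY q01 unfolding S_def by (intro mult_left_mono add_mono mult_mono) auto
    finally show "dist (f X) (f Y) \<le> q * dist X Y" by (simp add: dist_norm)
  qed
  have "f ` S \<subseteq> S" using fS by blast
  then have "\<exists>!Y. Y \<in> S \<and> f Y = Y" using compl zero lip q01
    by (intro Banach_fix[of S q f]) blast+
  then obtain Y where Y: "Y \<in> S" "f Y = Y" by blast
  have "2 *\<^sub>R Y x = blinfun_apply Z x + blinfun_apply Y (blinfun_apply Y x)" for x
  proof -
    have "2 *\<^sub>R Y x = 2 *\<^sub>R blinfun_apply (f Y) x" by (simp add: Y)
    also have "\<dots> = blinfun_apply Z x + blinfun_apply Y (blinfun_apply Y x)" by (simp add: f_def blinfun.add_left blinfun.scaleR_left)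
    finally show ?thesis .
  qed
  then show ?thesis using Y q01 unfolding S_def by (intro exI[of _ Y]) auto
qed


lemma bounded_linear_inv_if_bounded_below:
  fixes R :: "'a::real_normed_vector \<Rightarrow> 'b::real_normed_vector"
  assumes R: "bounded_linear R" and "surj R" and low: "\<And>x. norm x \<le> c * norm (R x)"
  shows "bounded_linear (inv R)" "\<And>x. inv R (R x) = x" "\<And>x. R (inv R x) = x"
proof -
  interpret bounded_linear R by (rule R)
  have "inj R"
  proof (rule injI)
    fix x y assume "R x = R y"
    then show "x = y" using low[of "x - y"] by (simp add: diff)
  qed
  then show 1: "inv R (R x) = x" for x by simp
  show 2: "R (inv R x) = x" for x using \<open>surj R\<close> by (rule surj_f_inv_f)
  show "bounded_linear (inv R)"
  proof (rule bounded_linear_intro)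
    show "inv R (x + y) = inv R x + inv R y" for x y by (metis 1 2 add)
    show "inv R (r *\<^sub>R x) = r *\<^sub>R inv R x" for r x by (metis 1 2 scaleR)
    show "norm (inv R x) \<le> norm x * c" for x using low[of "inv R x"] by (simp add: 2 mult.commute)
  qed
qed

text \<open>With \<open>Z = 1 - t B\<close> and \<open>Y\<close> the fixed point of \<open>sqrt_contraction_banach\<close>, \<open>(1 - Y)\<^sup>2 = t B\<close>.\<close>

lemma form_sqrt_banach:
  fixes B :: "'h::{real_inner,banach} \<Rightarrow> 'h" and J :: "'h \<Rightarrow> 'h"
  assumes J: "bounded_linear J" and B: "bounded_linear B" and sym: "\<And>x y. inner (B x) y = inner x (B y)"
    and BJ: "\<And>x. B (J x) = J (B x)"
    and a: "0 < a" and lo: "\<And>x. a * (norm x)\<^sup>2 \<le> inner (B x) x"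
  shows "\<exists>R S. bounded_linear R \<and> bounded_linear S \<and> (\<forall>x. R (J x) = J (R x)) \<and>
    (\<forall>x. R (S x) = x) \<and> (\<forall>x. S (R x) = x) \<and> (\<forall>x y. inner (R x) (R y) = inner (B x) y)"
proof -
  interpret J: bounded_linear J by (rule J)
  interpret B: bounded_linear B by (rule B)
  obtain K0 where K0: "\<And>x. norm (B x) \<le> norm x * K0" using B.bounded by blast
  define K where "K = max K0 a"
  have K: "norm (B x) \<le> norm x * K" for x
    unfolding K_def by (rule order_trans[OF K0]) (simp add: mult_left_mono)
  have aK: "a \<le> K" "0 < K" using a by (auto simp: K_def)
  \<comment> \<open>This \<open>t\<close> minimizes \<open>1 - 2 t a + t\<^sup>2 K\<^sup>2\<close>,
    an upper bound for the squared norm of \<open>1 - t B\<close>, and \<open>q\<close> is the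
    minimum. Taking \<open>K\<close> at least \<open>a\<close> keeps \<open>q\<close>
    nonnegative.\<close>
  define t where "t = a / K\<^sup>2"
  define q where "q = 1 - a\<^sup>2 / K\<^sup>2"
  have t: "0 < t" using a aK by (simp add: t_def)
  have q: "0 \<le> q" "q < 1" using a aK by (auto simp: q_def power_mono)
  have ZB: "bounded_linear (\<lambda>x. x - t *\<^sub>R B x)"
    by (intro bounded_linear_sub bounded_linear_ident bounded_linear_const_scaleR B)
  define Z where "Z = Blinfun (\<lambda>x. x - t *\<^sub>R B x)"
  have Z: "blinfun_apply Z x = x - t *\<^sub>R B x" for x
    unfolding Z_def using ZB by (simp add: bounded_linear_Blinfun_apply)
  have "norm (blinfun_apply Z x) \<le> sqrt q * norm x" for x
  proof -
    have "(norm (blinfun_apply Z x))\<^sup>2 = (norm x)\<^sup>2 - 2 * t * inner (B x) x + t\<^sup>2 * (norm (B x))\<^sup>2"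
      unfolding Z power2_norm_eq_inner
      by (simp add: inner_diff_left inner_diff_right inner_commute algebra_simps power2_eq_square)
    also have "\<dots> \<le> (norm x)\<^sup>2 - 2 * t * (a * (norm x)\<^sup>2) + t\<^sup>2 * (norm x * K)\<^sup>2"
      using t by (intro add_mono diff_mono mult_left_mono lo power_mono K) auto
    also have "\<dots> = q * (norm x)\<^sup>2"
      using aK by (simp add: q_def t_def field_simps power2_eq_square)
    finally have "sqrt ((norm (blinfun_apply Z x))\<^sup>2) \<le> sqrt (q * (norm x)\<^sup>2)" by (rule real_sqrt_le_mono)
    then show ?thesis by (simp add: real_sqrt_mult)
  qed
  then have "norm Z \<le> sqrt q" using q by (intro norm_blinfun_bound) auto
  also have "sqrt q < 1" using q by simp
  finally have nZ: "norm Z < 1" .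
  have "\<exists>Y :: 'h \<Rightarrow>\<^sub>L 'h. norm Y < 1 \<and> (\<forall>x y. inner (blinfun_apply Y x) y = inner x (blinfun_apply Y y)) \<and>
     (\<forall>x. blinfun_apply Y (J x) = J (blinfun_apply Y x)) \<and>
     (\<forall>x. 2 *\<^sub>R blinfun_apply Y x = blinfun_apply Z x + blinfun_apply Y (blinfun_apply Y x))"
    by (intro sqrt_contraction_banach nZ J)
       (simp_all add: Z inner_diff_left inner_diff_right sym BJ J.diff J.scaleR)
  then obtain Y :: "'h \<Rightarrow>\<^sub>L 'h" where nY: "norm Y < 1"
    and Ysym: "\<And>x y. inner (blinfun_apply Y x) y = inner x (blinfun_apply Y y)"
    and YJ: "\<And>x. blinfun_apply Y (J x) = J (blinfun_apply Y x)"
    and YY: "\<And>x. 2 *\<^sub>R blinfun_apply Y x = blinfun_apply Z x + blinfun_apply Y (blinfun_apply Y x)"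
    by blast
  define R where "R x = (1 / sqrt t) *\<^sub>R (x - blinfun_apply Y x)" for x
  have R: "bounded_linear R" unfolding R_def
    by (intro bounded_linear_const_scaleR bounded_linear_sub bounded_linear_ident blinfun.bounded_linear_right)
  have RJ: "R (J x) = J (R x)" for x by (simp add: R_def YJ J.diff J.scaleR)
  have RR: "inner (R x) (R y) = inner (B x) y" for x y
  proof -
    have "blinfun_apply Y (blinfun_apply Y x) = 2 *\<^sub>R blinfun_apply Y x - blinfun_apply Z x"
      using YY[of x] by simp
    then have YYx: "inner (blinfun_apply Y x) (blinfun_apply Y y) = 2 * inner (blinfun_apply Y x) y - inner (blinfun_apply Z x) y"
      by (simp add: Ysym[symmetric, of "blinfun_apply Y x"] inner_diff_left)
    have "inner (R x) (R y) = (1/t) * (inner x y - 2 * inner (blinfun_apply Y x) y + inner (blinfun_apply Y x) (blinfun_apply Y y))"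
      using t by (simp add: R_def inner_diff_left inner_diff_right Ysym field_simps)
    also have "\<dots> = (1/t) * (t * inner (B x) y)"
      unfolding YYx by (simp add: Z inner_diff_left)
    also have "\<dots> = inner (B x) y" using t by simp
    finally show ?thesis .
  qed
  have "\<exists>x. R x = y" for y
  proof -
    have "\<exists>!x. sqrt t *\<^sub>R y + blinfun_apply Y x = x"
    proof (rule banach_fix_type[of "norm Y"])
      show "\<forall>x x'. dist (sqrt t *\<^sub>R y + blinfun_apply Y x) (sqrt t *\<^sub>R y + blinfun_apply Y x') \<le> norm Y * dist x x'"
        by (simp add: dist_norm norm_blinfun flip: blinfun.diff_right)
    qed (use nY in auto)
    then obtain x where "sqrt t *\<^sub>R y + blinfun_apply Y x = x" by blast
    then have "x - blinfun_apply Y x = sqrt t *\<^sub>R y" by (metis add_diff_cancel_right')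
    then have "R x = y" using t by (simp add: R_def)
    then show ?thesis ..
  qed
  then have "surj R" unfolding surj_def by metis
  moreover have "norm x \<le> (1 / sqrt a) * norm (R x)" for x
  proof -
    have "a * (norm x)\<^sup>2 \<le> (norm (R x))\<^sup>2" using lo[of x] by (simp add: power2_norm_eq_inner RR)
    then have "sqrt (a * (norm x)\<^sup>2) \<le> sqrt ((norm (R x))\<^sup>2)" by (rule real_sqrt_le_mono)
    then show ?thesis using a by (simp add: real_sqrt_mult field_simps)
  qed
  ultimately show ?thesis
    using bounded_linear_inv_if_bounded_below[OF R] R RJ RR by blast
qed

lemma cstruct_bounded_linear:
  assumes "cstruct J" shows "bounded_linear J"
proof (rule bounded_linear_intro[where K=1])
  show "norm (J x) \<le> norm x * 1" for x
    using assms unfolding cstruct_def norm_eq_sqrt_inner by simp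
qed (use assms in \<open>auto simp: cstruct_def linear_add linear_scale\<close>)

text \<open>By Riesz the form is \<open>inner (A x) y\<close> with \<open>A\<close> bounded,
  symmetric, coercive and commuting with \<open>J\<close>. The square root of \<open>A\<close> turns
  the form into \<open>inner (R x) (R y)\<close>; it is taken in the type copy and transported
  back.\<close>

lemma form_similarity:
  fixes B :: "'h::{real_inner,complete_space} \<Rightarrow> 'h \<Rightarrow> real" and J :: "'h \<Rightarrow> 'h"
  assumes J: "cstruct J"
    and sym: "\<And>x y. B x y = B y x" and add: "\<And>x y z. B (x + y) z = B x z + B y z"
    and scale: "\<And>r x y. B (r *\<^sub>R x) y = r * B x y"
    and BJ: "\<And>x y. B (J x) (J y) = B x y"
    and a: "0 < a" and lo: "\<And>x. a * (norm x)\<^sup>2 \<le> B x x"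
    and up: "\<And>x y. \<bar>B x y\<bar> \<le> b * norm x * norm y"
  shows "\<exists>R S. bounded_clinear_op J J R \<and> bounded_clinear_op J J S \<and> R \<circ> S = id \<and> S \<circ> R = id \<and>
    (\<forall>x y. inner (R x) (R y) = B x y)"
proof -
  interpret J: bounded_linear J using J by (rule cstruct_bounded_linear)
  have JJ: "J (J x) = - x" and Jin: "inner (J x) (J y) = inner x y" for x y
    using J by (auto simp: cstruct_def)
  have "\<exists>z. \<forall>y. B x y = inner z y" for x
  proof (rule riesz_representation)
    show "bounded_linear (B x)"
    proof (rule bounded_linear_intro)
      show "B x (y + z) = B x y + B x z" for y z by (simp add: sym[of x] add)
      show "B x (r *\<^sub>R y) = r *\<^sub>R B x y" for r y by (simp add: sym[of x] scale)
      show "norm (B x y) \<le> norm y * (b * norm x)" for y using up[of x y] by (simp add: mult_ac)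
    qed
  qed
  then obtain A where A: "\<And>x y. inner (A x) y = B x y" by metis
  have Aeq: "A x = z" if "\<And>y. B x y = inner z y" for x z
  proof -
    have "inner (A x - z) (A x - z) = 0" by (simp add: inner_diff_left[of "A x" z] A that)
    then show ?thesis by simp
  qed
  have Abl: "bounded_linear A"
  proof (rule bounded_linear_intro)
    show "A (x + y) = A x + A y" for x y by (rule Aeq) (simp add: inner_add_left A add)
    show "A (r *\<^sub>R x) = r *\<^sub>R A x" for r x by (rule Aeq) (simp add: A scale)
    show "norm (A x) \<le> norm x * b" for x
    proof (cases "A x = 0")
      case True
      have "0 \<le> norm x * b"
      proof (cases "x = 0")
        case False
        then have "0 \<le> (b * norm x) * norm x" using up[of x x] by linarith
        then show ?thesis using False by (simp add: zero_le_mult_iff)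
      qed simp
      then show ?thesis using True by simp
    next
      case False
      have "(norm (A x))\<^sup>2 \<le> (norm x * b) * norm (A x)"
        using up[of x "A x"] by (simp add: power2_norm_eq_inner A mult_ac)
      then show ?thesis using False by (simp add: power2_eq_square)
    qed
  qed
  interpret A: bounded_linear A by (rule Abl)
  have AJ: "A (J x) = J (A x)" for x
  proof (rule Aeq)
    fix y
    have "B (J x) y = B (J (J x)) (J y)" by (simp only: BJ)
    also have "\<dots> = inner (A (J (J x))) (J y)" by (simp add: A)
    also have "\<dots> = inner (J (J (A x))) (J y)" by (simp add: JJ A.neg)
    also have "\<dots> = inner (J (A x)) y" by (rule Jin)
    finally show "B (J x) y = inner (J (A x)) y" .
  qed
  define J' A' where "J' = to_hil \<circ> J \<circ> of_hil" and "A' = to_hil \<circ> A \<circ> of_hil"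
  have "\<exists>R S. bounded_linear R \<and> bounded_linear S \<and> (\<forall>x. R (J' x) = J' (R x)) \<and>
    (\<forall>x. R (S x) = x) \<and> (\<forall>x. S (R x) = x) \<and> (\<forall>x y. inner (R x) (R y) = inner (A' x) y)"
  proof (rule form_sqrt_banach[OF _ _ _ _ a])
    show "bounded_linear J'" unfolding J'_def o_def
      by (intro bounded_linear_compose[OF bounded_linear_to_hil] bounded_linear_compose[OF J.bounded_linear_axioms] bounded_linear_of_hil)
    show "bounded_linear A'" unfolding A'_def o_def
      by (intro bounded_linear_compose[OF bounded_linear_to_hil] bounded_linear_compose[OF Abl] bounded_linear_of_hil)
    show "inner (A' x) y = inner x (A' y)" for x y
      by (simp add: A'_def A flip: inner_of_hil) (simp add: inner_commute[of _ "A _"] A sym)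
    show "A' (J' x) = J' (A' x)" for x by (simp add: A'_def J'_def AJ)
    show "a * (norm x)\<^sup>2 \<le> inner (A' x) x" for x
      using lo[of "of_hil x"] by (simp add: A'_def A norm_of_hil flip: inner_of_hil)
  qed
  then obtain R S where RS: "bounded_linear R" "bounded_linear S" "\<And>x. R (J' x) = J' (R x)"
    "\<And>x. R (S x) = x" "\<And>x. S (R x) = x" "\<And>x y. inner (R x) (R y) = inner (A' x) y" by blast
  define R' S' where "R' = of_hil \<circ> R \<circ> to_hil" and "S' = of_hil \<circ> S \<circ> to_hil"
  have R'J: "R' (J x) = J (R' x)" for x
    using RS(3)[of "to_hil x"] by (simp add: R'_def J'_def)
  have "bounded_linear R'" "bounded_linear S'" unfolding R'_def S'_def o_def
    by (intro bounded_linear_compose[OF bounded_linear_of_hil] bounded_linear_compose[OF RS(1)]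
        bounded_linear_compose[OF RS(2)] bounded_linear_to_hil)+
  moreover have id: "R' \<circ> S' = id" "S' \<circ> R' = id" by (auto simp: R'_def S'_def RS fun_eq_iff)
  moreover have "S' (J x) = J (S' x)" for x
    using R'J id by (metis comp_apply id_apply)
  moreover have "inner (R' x) (R' y) = B x y" for x y
    by (simp add: R'_def inner_of_hil RS(6)) (simp add: A'_def A flip: inner_of_hil)
  ultimately show ?thesis unfolding bounded_clinear_op_def using R'J by blast
qed

section \<open>Isometric semigroups from skew-symmetric operators\<close>

lemma Cauchy_geometric:
  fixes X :: "nat \<Rightarrow> 'b::real_normed_vector"
  assumes X: "\<And>n. norm (X n - X (Suc n)) \<le> c * (1/2) ^ n"
  shows "Cauchy X"
proof (rule metric_CauchyI)
  fix e :: real assume e: "0 < e"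
  have c: "0 \<le> c" using order_trans[OF norm_ge_zero X[of 0]] by simp
  \<comment> \<open>The factor \<open>1 - (1/2) ^ m\<close> strengthens the claim so that the
    induction on \<open>m\<close> closes.\<close>
  have tail: "norm (X n - X (n + m)) \<le> 2 * c * (1/2) ^ n * (1 - (1/2) ^ m)" for n m
  proof (induction m)
    case (Suc m)
    have "norm (X n - X (n + Suc m)) \<le> norm (X n - X (n + m)) + norm (X (n + m) - X (Suc (n + m)))"
      using norm_triangle_ineq[of "X n - X (n + m)" "X (n + m) - X (Suc (n + m))"] by simp
    also have "\<dots> \<le> 2 * c * (1/2) ^ n * (1 - (1/2) ^ m) + c * (1/2) ^ (n + m)"
      by (intro add_mono Suc X)
    also have "\<dots> = 2 * c * (1/2) ^ n * (1 - (1/2) ^ Suc m)" by (simp add: power_add algebra_simps)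
    finally show ?case .
  qed simp
  have tail': "dist (X n) (X (n + m)) \<le> 2 * c * (1/2) ^ n" for n m
    using order_trans[OF tail mult_left_le] c by (simp add: dist_norm)
  have "(\<lambda>n. 2 * c * (1/2) ^ n) \<longlonglongrightarrow> 2 * c * 0" by (intro tendsto_intros LIMSEQ_power_zero) simp
  then have "eventually (\<lambda>n. 2 * c * (1/2) ^ n < e / 2) sequentially" using e by (intro order_tendstoD(2)) auto
  then obtain M where M: "2 * c * (1/2) ^ M < e/2" by (auto simp: eventually_sequentially)
  have "dist (X m) (X n) < e" if "m \<ge> M" "n \<ge> M" for m n
    using tail'[of M "m - M"] tail'[of M "n - M"] M that dist_triangle[of "X m" "X n" "X M"]
    by (simp add: dist_commute)
  then show "\<exists>M. \<forall>m\<ge>M. \<forall>n\<ge>M. dist (X m) (X n) < e" by blast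
qed

text \<open>\<open>inner\<close> is the real part of the complex inner product, so the third
  assumption is skew-symmetry of the complex-linear \<open>A\<close> by polarization. With the range
  condition these are hypotheses of Lumer-Phillips type; the density of \<open>D\<close> is derived
  in \<open>dense_D\<close>.\<close>

locale skew_generator =
  fixes J :: "'h::{real_inner,complete_space} \<Rightarrow> 'h" and D :: "'h set" and A :: "'h \<Rightarrow> 'h"
  assumes J: "cstruct J" and A: "lin_op J J D A"
    and skew: "\<And>x. x \<in> D \<Longrightarrow> inner (A x) x = 0"
    and onto: "\<And>r y. r > 0 \<Longrightarrow> \<exists>x\<in>D. r *\<^sub>R x - A x = y"
begin

lemma subspace_D: "subspace D" and J_D: "x \<in> D \<Longrightarrow> J x \<in> D"
  and A_add: "x \<in> D \<Longrightarrow> y \<in> D \<Longrightarrow> A (x + y) = A x + A y"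
  and A_scale: "x \<in> D \<Longrightarrow> A (c *\<^sub>R x) = c *\<^sub>R A x"
  and A_J: "x \<in> D \<Longrightarrow> A (J x) = J (A x)"
  using A by (auto simp: lin_op_def csubspace_def)

lemma A_diff: "x \<in> D \<Longrightarrow> y \<in> D \<Longrightarrow> A (x - y) = A x - A y"
  using A_add[of x "(-1) *\<^sub>R y"] A_scale[of y "-1"] subspace_D by (simp add: subspace_neg)

text \<open>The implicit Euler step \<open>(1 - l A)\<^sup>-\<^sup>1\<close>.\<close>

definition step :: "real \<Rightarrow> 'h \<Rightarrow> 'h" where
  "step l y = (THE x. x \<in> D \<and> x - l *\<^sub>R A x = y)"

text \<open>Pythagoras, since \<open>x\<close> and \<open>A x\<close> are orthogonal. This one
  identity yields injectivity of \<open>1 - l A\<close>, contractivity of the step, and the exact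
  amount of norm that a step loses.\<close>

lemma norm_minus_scaled:
  assumes "x \<in> D" shows "(norm (x - l *\<^sub>R A x))\<^sup>2 = (norm x)\<^sup>2 + l\<^sup>2 * (norm (A x))\<^sup>2"
  unfolding power2_norm_eq_inner
  by (simp add: inner_diff_left inner_diff_right skew[OF assms] inner_commute[of x "A x"] power2_eq_square)

lemma step_ex1:
  assumes "l > 0" shows "\<exists>!x. x \<in> D \<and> x - l *\<^sub>R A x = y"
proof -
  obtain x where x: "x \<in> D" "(1/l) *\<^sub>R x - A x = (1/l) *\<^sub>R y" using onto[of "1/l"] assms by auto
  have "x - l *\<^sub>R A x = l *\<^sub>R ((1/l) *\<^sub>R x - A x)" using assms by (simp add: scaleR_diff_right)
  also have "\<dots> = y" using x assms by simp
  finally have ex: "x - l *\<^sub>R A x = y" .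
  have "x' = x" if "x' \<in> D" "x' - l *\<^sub>R A x' = y" for x'
  proof -
    have "x' - x \<in> D" using x that subspace_D by (simp add: subspace_diff)
    moreover have "(x' - x) - l *\<^sub>R A (x' - x) = 0"
    proof -
      have "(x' - x) - l *\<^sub>R A (x' - x) = (x' - l *\<^sub>R A x') - (x - l *\<^sub>R A x)"
        using that x by (simp add: A_diff scaleR_diff_right)
      then show ?thesis using ex that by simp
    qed
    ultimately have "0 = (norm (x' - x))\<^sup>2 + l\<^sup>2 * (norm (A (x' - x)))\<^sup>2"
      using norm_minus_scaled[of "x' - x" l] by simp
    then have "(norm (x' - x))\<^sup>2 = 0" by (smt (verit) zero_le_power2 mult_nonneg_nonneg)
    then show ?thesis by simp
  qed
  then show ?thesis using x(1) ex by blast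
qed

lemma step_D: "l > 0 \<Longrightarrow> step l y \<in> D" and step_eq: "l > 0 \<Longrightarrow> step l y - l *\<^sub>R A (step l y) = y"
  using theI'[OF step_ex1[of l y]] by (auto simp: step_def)

lemma A_step_eq: assumes "l > 0" shows "l *\<^sub>R A (step l x) = step l x - x"
proof -
  have "a - b = c \<Longrightarrow> b = a - c" for a b c :: 'h by auto
  then show ?thesis using step_eq[OF assms, of x] by blast
qed

lemma step_unique: "l > 0 \<Longrightarrow> x \<in> D \<Longrightarrow> x - l *\<^sub>R A x = y \<Longrightarrow> step l y = x"
  unfolding step_def by (rule the1_equality[OF step_ex1]) auto

lemma norm_step: "l > 0 \<Longrightarrow> (norm y)\<^sup>2 = (norm (step l y))\<^sup>2 + l\<^sup>2 * (norm (A (step l y)))\<^sup>2"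
  using norm_minus_scaled[OF step_D, of l y l] step_eq[of l y] by simp

lemma norm_step_le: "l > 0 \<Longrightarrow> norm (step l y) \<le> norm y"
  by (rule power2_le_imp_le) (simp_all add: norm_step[of l y])

lemma step_linear:
  assumes "l > 0" shows "bounded_linear (step l)"
proof (rule bounded_linear_intro)
  show "step l (x + y) = step l x + step l y" for x y
  proof (rule step_unique[OF assms])
    show "step l x + step l y \<in> D" using step_D assms subspace_D by (simp add: subspace_add)
    have "step l x + step l y - l *\<^sub>R A (step l x + step l y) =
      (step l x - l *\<^sub>R A (step l x)) + (step l y - l *\<^sub>R A (step l y))"
      using step_D[OF assms] by (simp add: A_add scaleR_add_right)
    then show "step l x + step l y - l *\<^sub>R A (step l x + step l y) = x + y" using step_eq[OF assms] by simp
  qed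
  show "step l (c *\<^sub>R x) = c *\<^sub>R step l x" for c x
  proof (rule step_unique[OF assms])
    show "c *\<^sub>R step l x \<in> D" using step_D assms subspace_D by (simp add: subspace_scale)
    have "c *\<^sub>R step l x - l *\<^sub>R A (c *\<^sub>R step l x) = c *\<^sub>R (step l x - l *\<^sub>R A (step l x))"
      using step_D[OF assms] by (simp add: A_scale scaleR_diff_right)
    then show "c *\<^sub>R step l x - l *\<^sub>R A (c *\<^sub>R step l x) = c *\<^sub>R x" using step_eq[OF assms] by simp
  qed
  show "norm (step l x) \<le> norm x * 1" for x using norm_step_le[OF assms] by simp
qed

lemma step_J: "l > 0 \<Longrightarrow> step l (J x) = J (step l x)"
proof (rule step_unique)
  assume l: "l > 0"
  interpret J: bounded_linear J using J by (rule cstruct_bounded_linear)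
  show "J (step l x) - l *\<^sub>R A (J (step l x)) = J x"
  proof -
    have "J (step l x) - l *\<^sub>R A (J (step l x)) = J (step l x - l *\<^sub>R A (step l x))"
      by (simp add: A_J step_D[OF l] J.scaleR J.diff)
    then show ?thesis by (simp only: step_eq[OF l])
  qed
qed (auto intro: J_D step_D)

text \<open>\<open>A (step l x)\<close> is a combination of \<open>step l x\<close> and
  \<open>x\<close>, so a step gains one degree of regularity.\<close>

lemma A_step:
  assumes "l > 0" "x \<in> D" shows "A (step l x) \<in> D" "A (step l x) = step l (A x)"
proof -
  have "A (step l x) = (1/l) *\<^sub>R (l *\<^sub>R A (step l x))" using assms by simp
  also have "\<dots> = (1/l) *\<^sub>R (step l x - x)" by (simp only: A_step_eq[OF assms(1)])
  finally have e: "A (step l x) = (1/l) *\<^sub>R (step l x - x)" .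
  show 1: "A (step l x) \<in> D"
    unfolding e using assms step_D subspace_D by (simp add: subspace_diff subspace_scale)
  have "A (step l x) - l *\<^sub>R A (A (step l x)) = A (step l x - l *\<^sub>R A (step l x))"
    using step_D[OF assms(1)] 1 subspace_D by (simp add: A_diff A_scale subspace_scale)
  also have "\<dots> = A x" by (simp add: step_eq assms)
  finally have "A (step l x) - l *\<^sub>R A (A (step l x)) = A x" .
  from step_unique[OF assms(1) 1 this] show "A (step l x) = step l (A x)" ..
qed

lemma step_commute:
  assumes "l > 0" "m > 0" shows "step l (step m x) = step m (step l x)"
proof (rule step_unique[OF assms(1) step_D[OF assms(2)]])
  have "step m (step l x) - l *\<^sub>R A (step m (step l x)) = step m (step l x - l *\<^sub>R A (step l x))"
    using A_step(2)[OF assms(2) step_D[OF assms(1)]] step_linear[OF assms(2)]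
    by (simp add: linear_simps)
  then show "step m (step l x) - l *\<^sub>R A (step m (step l x)) = step m x" by (simp add: step_eq assms)
qed

lemma step_minus_id:
  assumes "l > 0" "x \<in> D" shows "norm (step l x - x) \<le> l * norm (A x)"
proof -
  have "norm (step l x - x) = l * norm (step l (A x))"
    using assms by (simp flip: A_step_eq A_step(2))
  then show ?thesis using norm_step_le[OF assms(1), of "A x"] assms by (simp add: mult_left_mono)
qed

text \<open>One step of size \<open>l\<close> against two steps of size \<open>l/2\<close>: multiplying out,
  \<open>(1 - l/2 A)\<^sup>2 - (1 - l A) = l\<^sup>2/4 A\<^sup>2\<close>.\<close>

lemma step_halve:
  assumes l: "l > 0" and x: "x \<in> D" "A x \<in> D"
  shows "norm (step l x - step (l/2) (step (l/2) x)) \<le> l\<^sup>2 / 4 * norm (A (A x))"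
proof -
  have h: "l / 2 > 0" using l by simp
  \<comment> \<open>\<open>w\<close> is \<open>(1 - l/2 A)\<^sup>2 x\<close>, so two half steps lead
    from \<open>w\<close> through \<open>y\<close> back to \<open>x\<close>. Both sides of the
    comparison then become \<open>?S\<close> of explicit vectors, and only \<open>?S\<close> of
    their difference has to be estimated.\<close>
  define y where "y = x - (l/2) *\<^sub>R A x"
  define w where "w = y - (l/2) *\<^sub>R A y"
  have yD: "y \<in> D" using x subspace_D by (simp add: y_def subspace_diff subspace_scale)
  have w: "w = (x - l *\<^sub>R A x) + (l\<^sup>2/4) *\<^sub>R A (A x)"
    using x subspace_D unfolding w_def y_def
    by (simp add: A_diff A_scale subspace_scale algebra_simps power2_eq_square)
       (simp flip: scaleR_add_left)
  let ?S = "\<lambda>u. step l (step (l/2) (step (l/2) u))"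
  have 1: "step (l/2) (step (l/2) w) = x"
    using step_unique[OF h yD, of w] step_unique[OF h x(1), of y] by (simp add: w_def y_def)
  have 2: "step l (x - l *\<^sub>R A x) = x" by (rule step_unique[OF l x(1)]) simp
  have "?S (x - l *\<^sub>R A x) = step (l/2) (step (l/2) (step l (x - l *\<^sub>R A x)))"
    by (simp only: step_commute[OF l h])
  then have 3: "?S (x - l *\<^sub>R A x) = step (l/2) (step (l/2) x)" by (simp only: 2)
  have "?S (w - (x - l *\<^sub>R A x)) = ?S w - ?S (x - l *\<^sub>R A x)"
    using step_linear[OF h] step_linear[OF l] by (simp add: linear_simps)
  also have "?S w = step l x" by (simp only: 1)
  finally have "step l x - step (l/2) (step (l/2) x) = ?S ((l\<^sup>2/4) *\<^sub>R A (A x))"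
    unfolding 3 by (simp add: w)
  then have "norm (step l x - step (l/2) (step (l/2) x)) \<le> norm ((l\<^sup>2/4) *\<^sub>R A (A x))"
    by (simp only:) (rule order_trans[OF norm_step_le[OF l] order_trans[OF norm_step_le[OF h] norm_step_le[OF h]]])
  then show ?thesis by simp
qed

text \<open>If \<open>y\<close> is orthogonal to \<open>D\<close>, pairing
  \<open>y = step 1 y - A (step 1 y)\<close> with \<open>step 1 y\<close> leaves
  \<open>(norm (step 1 y))\<^sup>2 = 0\<close> by skewness.\<close>

lemma dense_D: "closure D = UNIV"
proof (rule dense_if_orthogonal_trivial[OF subspace_D])
  fix y assume y: "\<forall>x\<in>D. inner y x = 0"
  have "inner y (step 1 y) = 0" using y step_D by simp
  then have "inner (step 1 y) (step 1 y) = 0"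
    using step_eq[of 1 y] skew[OF step_D[of 1 y]] by (metis diff_zero inner_diff_left scaleR_one zero_less_one)
  then have "step 1 y = 0" by simp
  moreover have "A 0 = 0" using A_scale[of 0 0] subspace_D by (simp add: subspace_0)
  ultimately show "y = 0" using step_eq[of 1 y] by simp
qed

lemma dense_approx:
  assumes "e > 0" obtains z where "z \<in> D" "norm (x - z) < e"
  using dense_D assms closure_approachable[of x D] by (metis UNIV_I dist_commute dist_norm)

text \<open>A small step moves a vector of \<open>D\<close> into the domain of the square of
  \<open>A\<close> and displaces it by at most \<open>l * norm (A u)\<close>. Vectors of this kind
  are what \<open>step_halve\<close> requires.\<close>

lemma dense_D2:
  assumes "e > 0" obtains z where "z \<in> D" "A z \<in> D" "norm (x - z) < e"
proof -
  obtain u where u: "u \<in> D" "norm (x - u) < e/2" using dense_approx[of "e/2"] assms by auto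
  define l where "l = e / (2 * (norm (A u) + 1))"
  have n: "norm (A u) + 1 > 0" by (simp add: add_nonneg_pos)
  have l: "l > 0" using assms n by (simp add: l_def)
  have "norm (step l u - u) \<le> l * norm (A u)" by (rule step_minus_id[OF l u(1)])
  also have "\<dots> \<le> e / 2" using n assms by (simp add: l_def field_simps)
  finally have "norm (x - step l u) < e" using u(2) norm_triangle_ineq[of "x - u" "u - step l u"]
    by (simp add: norm_minus_commute)
  then show ?thesis using that step_D[OF l] A_step(1)[OF l u(1)] by blast
qed

section \<open>The dyadic implicit Euler scheme and its limit\<close>

definition mesh :: "nat \<Rightarrow> real" where "mesh n = (1/2) ^ n"
text \<open>Because of the rounding, the step counts of consecutive meshes, and those of
  \<open>s\<close>, \<open>t\<close> and \<open>s + t\<close>, match only up to one extra step; see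
  \<open>steps_Suc\<close> and \<open>steps_add\<close>.\<close>

definition steps :: "real \<Rightarrow> nat \<Rightarrow> nat" where "steps t n = nat \<lfloor>t * 2 ^ n\<rfloor>"
definition euler :: "nat \<Rightarrow> nat \<Rightarrow> 'h \<Rightarrow> 'h" where "euler n j = (step (mesh n) ^^ j)"
definition U :: "real \<Rightarrow> 'h \<Rightarrow> 'h" where "U t x = lim (\<lambda>n. euler n (steps t n) x)"

lemma mesh_pos [simp]: "mesh n > 0" by (simp add: mesh_def)

lemma mesh_tendsto: "mesh \<longlonglongrightarrow> 0" unfolding mesh_def by (rule LIMSEQ_power_zero) simp

lemma euler_0 [simp]: "euler n 0 x = x" and euler_Suc: "euler n (Suc j) x = step (mesh n) (euler n j x)"
  and euler_Suc2: "euler n (Suc j) x = euler n j (step (mesh n) x)"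
  and euler_add: "euler n (i + j) x = euler n i (euler n j x)"
  by (simp_all add: euler_def funpow_swap1 funpow_add)

lemma euler_linear: "bounded_linear (euler n j)"
proof (induction j)
  case 0
  have "euler n 0 = (\<lambda>x. x)" by auto
  then show ?case by (simp add: bounded_linear_ident)
next
  case (Suc j)
  have "euler n (Suc j) = (\<lambda>x. step (mesh n) (euler n j x))" by (auto simp: euler_Suc)
  then show ?case using bounded_linear_compose[OF step_linear Suc] by simp
qed

lemma norm_euler_le: "norm (euler n j x) \<le> norm x"
  by (induction j) (auto simp: euler_Suc intro: order_trans[OF norm_step_le])

lemma euler_J: "euler n j (J x) = J (euler n j x)"
  by (induction j) (auto simp: euler_Suc step_J)

lemma euler_step: "l > 0 \<Longrightarrow> step l (euler n j x) = euler n j (step l x)"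
  by (induction j) (auto simp: euler_Suc step_commute[of l "mesh n"])

lemma A_euler: "x \<in> D \<Longrightarrow> A (euler n j x) = euler n j (A x)"
proof -
  assume "x \<in> D"
  then have "euler n j x \<in> D \<and> A (euler n j x) = euler n j (A x)"
    by (induction j) (auto simp: euler_Suc step_D A_step)
  then show ?thesis ..
qed

lemma euler_minus_id:
  assumes "x \<in> D" shows "norm (euler n j x - x) \<le> real j * mesh n * norm (A x)"
proof (induction j)
  case (Suc j)
  have "euler n (Suc j) x - x = euler n j (step (mesh n) x - x) + (euler n j x - x)"
    using euler_linear[of n j] by (simp add: euler_Suc2 linear_simps)
  also have "norm \<dots> \<le> mesh n * norm (A x) + real j * mesh n * norm (A x)"
    by (intro norm_triangle_mono Suc order_trans[OF norm_euler_le] step_minus_id assms) simp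
  also have "\<dots> = real (Suc j) * mesh n * norm (A x)" by (simp add: algebra_simps)
  finally show ?case .
qed simp

text \<open>Each coarse step contributes a local error of order \<open>(mesh n)\<^sup>2\<close>,
  which the remaining contractions do not enlarge. Over \<open>j\<close> steps this is of order
  \<open>mesh n\<close> when \<open>j * mesh n\<close> stays bounded.\<close>

lemma euler_halve:
  assumes "x \<in> D" "A x \<in> D"
  shows "norm (euler n j x - euler (Suc n) (2 * j) x) \<le> real j * (mesh n)\<^sup>2 / 4 * norm (A (A x))"
proof (induction j)
  case (Suc j)
  have hS: "mesh (Suc n) = mesh n / 2" by (simp add: mesh_def)
  let ?d = "step (mesh n) x - step (mesh n / 2) (step (mesh n / 2) x)"
  have "euler n (Suc j) x = euler n j (step (mesh n) x)" by (rule euler_Suc2)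
  moreover have "euler (Suc n) (2 * Suc j) x = step (mesh n / 2) (step (mesh n / 2) (euler (Suc n) (2 * j) x))"
    by (simp add: euler_Suc hS)
  ultimately have "euler n (Suc j) x - euler (Suc n) (2 * Suc j) x =
      euler n j ?d + step (mesh n / 2) (step (mesh n / 2) (euler n j x - euler (Suc n) (2 * j) x))"
    using euler_linear[of n j] step_linear[of "mesh n / 2"] by (simp add: linear_simps euler_step)
  also have "norm \<dots> \<le> (mesh n)\<^sup>2 / 4 * norm (A (A x)) + real j * (mesh n)\<^sup>2 / 4 * norm (A (A x))"
    by (intro norm_triangle_mono order_trans[OF norm_euler_le] step_halve assms
        order_trans[OF norm_step_le] Suc) auto
  also have "\<dots> = real (Suc j) * (mesh n)\<^sup>2 / 4 * norm (A (A x))" by (simp add: algebra_simps)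
  finally show ?case .
qed simp

lemma steps_le: "t \<ge> 0 \<Longrightarrow> real (steps t n) * mesh n \<le> t"
proof -
  assume "t \<ge> 0"
  then have "real (steps t n) \<le> t * 2 ^ n" by (simp add: steps_def)
  then have "real (steps t n) * mesh n \<le> t * 2 ^ n * mesh n" by (simp add: mult_right_mono less_imp_le)
  also have "\<dots> = t" by (simp add: mesh_def power_one_over)
  finally show ?thesis .
qed

lemma steps_ge: "t \<ge> 0 \<Longrightarrow> t - mesh n \<le> real (steps t n) * mesh n"
proof -
  assume "t \<ge> 0"
  then have "0 \<le> t * 2 ^ n" by simp
  then have "t * 2 ^ n - 1 \<le> real (steps t n)" unfolding steps_def by linarith
  then have "(t * 2 ^ n - 1) * mesh n \<le> real (steps t n) * mesh n" by (simp add: mult_right_mono less_imp_le)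
  moreover have "(t * 2 ^ n - 1) * mesh n = t - mesh n" by (simp add: mesh_def power_one_over field_simps)
  ultimately show ?thesis by simp
qed

lemma steps_tendsto: "t \<ge> 0 \<Longrightarrow> (\<lambda>n. real (steps t n) * mesh n) \<longlonglongrightarrow> t"
proof (rule tendsto_sandwich)
  have "(\<lambda>n. t - mesh n) \<longlonglongrightarrow> t - 0" by (intro tendsto_intros mesh_tendsto)
  then show "(\<lambda>n. t - mesh n) \<longlonglongrightarrow> t" by simp
qed (auto simp: steps_le steps_ge)

lemma steps_Suc:
  assumes "t \<ge> 0" shows "steps t (Suc n) = 2 * steps t n \<or> steps t (Suc n) = Suc (2 * steps t n)"
proof -
  have "0 \<le> t * 2 ^ n" using assms by simp
  moreover have "t * 2 ^ Suc n = 2 * (t * 2 ^ n)" by simp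
  ultimately show ?thesis unfolding steps_def by linarith
qed

lemma steps_add:
  assumes "s \<ge> 0" "t \<ge> 0" shows "steps (s + t) n = steps s n + steps t n \<or> steps (s + t) n = Suc (steps s n + steps t n)"
proof -
  have "0 \<le> s * 2 ^ n" "0 \<le> t * 2 ^ n" using assms by auto
  moreover have "(s + t) * 2 ^ n = s * 2 ^ n + t * 2 ^ n" by (simp add: algebra_simps)
  ultimately show ?thesis unfolding steps_def by linarith
qed

text \<open>Halving the mesh costs \<open>t * norm (A (A x)) * mesh n\<close>, and the possible
  extra step costs \<open>norm (A x) * mesh n\<close>. Both are summable because the meshes are
  geometric.\<close>

lemma Cauchy_euler_D2:
  assumes t: "t \<ge> 0" and x: "x \<in> D" "A x \<in> D"
  shows "Cauchy (\<lambda>n. euler n (steps t n) x)"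
proof (rule Cauchy_geometric)
  fix n
  have hS: "mesh (Suc n) \<le> mesh n" by (simp add: mesh_def)
  have 1: "norm (euler n (steps t n) x - euler (Suc n) (2 * steps t n) x) \<le> t * norm (A (A x)) * mesh n"
  proof -
    have "norm (euler n (steps t n) x - euler (Suc n) (2 * steps t n) x) \<le> (real (steps t n) * mesh n) * (mesh n / 4) * norm (A (A x))"
      using euler_halve[OF x, of n "steps t n"] by (simp add: power2_eq_square mult_ac)
    also have "\<dots> \<le> t * mesh n * norm (A (A x))"
      using steps_le[OF t] t by (intro mult_right_mono mult_mono) (auto simp: less_imp_le)
    finally show ?thesis by (simp add: mult_ac)
  qed
  have 2: "norm (euler (Suc n) (2 * steps t n) x - euler (Suc n) (steps t (Suc n)) x) \<le> norm (A x) * mesh n"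
    using steps_Suc[OF t, of n]
  proof
    assume e: "steps t (Suc n) = Suc (2 * steps t n)"
    have "euler (Suc n) (2 * steps t n) x - euler (Suc n) (steps t (Suc n)) x = - euler (Suc n) (2 * steps t n) (step (mesh (Suc n)) x - x)"
      using euler_linear[of "Suc n" "2 * steps t n"] by (simp add: e euler_Suc2 linear_simps)
    then have "norm (euler (Suc n) (2 * steps t n) x - euler (Suc n) (steps t (Suc n)) x) \<le> norm (step (mesh (Suc n)) x - x)"
      by (simp only: norm_minus_cancel norm_euler_le)
    also have "\<dots> \<le> mesh (Suc n) * norm (A x)" by (rule step_minus_id[OF mesh_pos x(1)])
    also have "\<dots> \<le> mesh n * norm (A x)" using hS by (rule mult_right_mono) simp
    finally show ?thesis by (simp add: mult_ac)
  qed (simp add: less_imp_le)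
  have "norm (euler n (steps t n) x - euler (Suc n) (steps t (Suc n)) x) \<le> t * norm (A (A x)) * mesh n + norm (A x) * mesh n"
    using norm_triangle_mono[OF 1 2] by simp
  then show "norm (euler n (steps t n) x - euler (Suc n) (steps t (Suc n)) x) \<le> (t * norm (A (A x)) + norm (A x)) * (1/2) ^ n"
    by (simp add: algebra_simps mesh_def)
qed

text \<open>Convergence passes from the dense domain of the square of \<open>A\<close> to all
  vectors because the approximations are contractions.\<close>

lemma euler_tendsto:
  assumes t: "t \<ge> 0" shows "(\<lambda>n. euler n (steps t n) x) \<longlonglongrightarrow> U t x"
proof -
  have "Cauchy (\<lambda>n. euler n (steps t n) x)"
  proof (rule metric_CauchyI)
    fix e :: real assume e: "0 < e"
    then obtain z where z: "z \<in> D" "A z \<in> D" "norm (x - z) < e/3" using dense_D2[of "e/3"] by auto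
    obtain M where M: "\<And>m n. m \<ge> M \<Longrightarrow> n \<ge> M \<Longrightarrow> dist (euler m (steps t m) z) (euler n (steps t n) z) < e/3"
      using metric_CauchyD[OF Cauchy_euler_D2[OF t z(1,2)], of "e/3"] e by auto
    have d: "dist (euler n (steps t n) x) (euler n (steps t n) z) < e/3" for n
      using norm_euler_le[of n "steps t n" "x - z"] z(3) euler_linear[of n "steps t n"] by (simp add: dist_norm linear_simps)
    have "dist (euler m (steps t m) x) (euler n (steps t n) x) < e" if "m \<ge> M" "n \<ge> M" for m n
      using d[of m] d[of n] M[OF that] dist_triangle[of "euler m (steps t m) x" "euler n (steps t n) x" "euler m (steps t m) z"]
        dist_triangle[of "euler m (steps t m) z" "euler n (steps t n) x" "euler n (steps t n) z"]
      by (simp add: dist_commute)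
    then show "\<exists>M. \<forall>m\<ge>M. \<forall>n\<ge>M. dist (euler m (steps t m) x) (euler n (steps t n) x) < e" by blast
  qed
  then show ?thesis unfolding U_def
    by (meson Cauchy_convergent convergent_LIMSEQ_iff)
qed

lemma norm_U_le: "t \<ge> 0 \<Longrightarrow> norm (U t x) \<le> norm x"
  using tendsto_norm[OF euler_tendsto, of t x] by (rule LIMSEQ_le_const2) (use norm_euler_le in auto)

lemma U_linear:
  assumes t: "t \<ge> 0" shows "bounded_linear (U t)"
proof (rule bounded_linear_intro)
  have "(\<lambda>n. euler n (steps t n) (x + y)) \<longlonglongrightarrow> U t x + U t y" for x y
    using tendsto_add[OF euler_tendsto[OF t, of x] euler_tendsto[OF t, of y]] euler_linear by (simp add: linear_simps)
  then show "U t (x + y) = U t x + U t y" for x y using LIMSEQ_unique[OF euler_tendsto[OF t]] by blast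
  have "(\<lambda>n. euler n (steps t n) (r *\<^sub>R x)) \<longlonglongrightarrow> r *\<^sub>R U t x" for r x
    using tendsto_scaleR[OF tendsto_const euler_tendsto[OF t, of x], of r] euler_linear by (simp add: linear_simps)
  then show "U t (r *\<^sub>R x) = r *\<^sub>R U t x" for r x using LIMSEQ_unique[OF euler_tendsto[OF t]] by blast
  show "norm (U t x) \<le> norm x * 1" for x using norm_U_le[OF t] by simp
qed

lemma U_J:
  assumes t: "t \<ge> 0" shows "U t (J x) = J (U t x)"
proof (rule LIMSEQ_unique[OF euler_tendsto[OF t]])
  show "(\<lambda>n. euler n (steps t n) (J x)) \<longlonglongrightarrow> J (U t x)"
    unfolding euler_J by (rule bounded_linear.tendsto[OF cstruct_bounded_linear[OF J] euler_tendsto[OF t]])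
qed

lemma U_0: "U 0 = id"
  using euler_tendsto[of 0] by (auto simp: steps_def fun_eq_iff LIMSEQ_const_iff)

text \<open>For \<open>y\<close> outside \<open>D\<close> there is no Lipschitz bound in time;
  comparison with a nearby \<open>z\<close> in \<open>D\<close> replaces it, at the price of twice
  the distance.\<close>

lemma euler_minus_id_approx:
  assumes "z \<in> D" shows "norm (euler n j y - y) \<le> 2 * norm (y - z) + real j * mesh n * norm (A z)"
proof -
  have "euler n j y - y = euler n j (y - z) + ((euler n j z - z) - (y - z))"
    using euler_linear[of n j] by (simp add: linear_simps)
  also have "norm \<dots> \<le> norm (y - z) + norm ((euler n j z - z) - (y - z))"
    by (rule norm_triangle_mono[OF norm_euler_le order_refl])
  also have "norm ((euler n j z - z) - (y - z)) \<le> norm (euler n j z - z) + norm (y - z)" by (rule norm_triangle_ineq4)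
  also have "norm (euler n j z - z) \<le> real j * mesh n * norm (A z)" by (rule euler_minus_id[OF assms])
  finally show ?thesis by simp
qed

lemma step_tendsto: "(\<lambda>n. step (mesh n) x) \<longlonglongrightarrow> x"
proof (rule LIMSEQ_I)
  fix e :: real assume e: "0 < e"
  obtain z where z: "z \<in> D" "norm (x - z) < e/4" using dense_approx[of "e/4"] e by auto
  have "(\<lambda>n. mesh n * norm (A z)) \<longlonglongrightarrow> 0 * norm (A z)" by (intro tendsto_intros mesh_tendsto)
  then have "eventually (\<lambda>n. mesh n * norm (A z) < e/2) sequentially" using e by (intro order_tendstoD(2)) auto
  then have "eventually (\<lambda>n. norm (step (mesh n) x - x) < e) sequentially"
  proof eventually_elim
    case (elim n)
    then show ?case using euler_minus_id_approx[OF z(1), of n "Suc 0" x] z(2) by (simp add: euler_Suc)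
  qed
  then show "\<exists>no. \<forall>n\<ge>no. norm (step (mesh n) x - x) < e" by (simp add: eventually_sequentially)
qed

text \<open>Up to one extra step, which tends to the identity by \<open>step_tendsto\<close>, the
  scheme for \<open>s + t\<close> is the composition of the schemes for \<open>s\<close> and
  \<open>t\<close>.\<close>

lemma U_add:
  assumes s: "s \<ge> 0" and t: "t \<ge> 0" shows "U (s + t) x = U s (U t x)"
proof -
  let ?F = "\<lambda>n. euler n (steps s n) (euler n (steps t n) x)"
  have "(\<lambda>n. euler n (steps (s + t) n) x - ?F n) \<longlonglongrightarrow> 0"
  proof (rule Lim_null_comparison)
    show "(\<lambda>n. norm (step (mesh n) x - x)) \<longlonglongrightarrow> 0"
      by (intro tendsto_norm_zero LIM_zero step_tendsto)
    have "norm (euler n (steps (s + t) n) x - ?F n) \<le> norm (step (mesh n) x - x)" for n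
      using steps_add[OF s t, of n]
    proof
      assume e: "steps (s + t) n = Suc (steps s n + steps t n)"
      have "euler n (steps (s + t) n) x - ?F n = euler n (steps s n + steps t n) (step (mesh n) x - x)"
        using euler_linear[of n "steps s n + steps t n"] by (simp add: e euler_Suc2 linear_simps flip: euler_add)
      then show ?thesis by (simp only: norm_euler_le)
    qed (simp add: euler_add)
    then show "eventually (\<lambda>n. norm (euler n (steps (s + t) n) x - ?F n) \<le> norm (step (mesh n) x - x)) sequentially" by simp
  qed
  then have 1: "(\<lambda>n. euler n (steps (s + t) n) x - (euler n (steps (s + t) n) x - ?F n)) \<longlonglongrightarrow> U (s + t) x - 0"
    using s t by (intro tendsto_diff euler_tendsto) auto
  have "(\<lambda>n. ?F n - euler n (steps s n) (U t x)) \<longlonglongrightarrow> 0"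
  proof (rule Lim_null_comparison)
    show "(\<lambda>n. norm (euler n (steps t n) x - U t x)) \<longlonglongrightarrow> 0"
      by (intro tendsto_norm_zero LIM_zero euler_tendsto t)
    have "norm (?F n - euler n (steps s n) (U t x)) \<le> norm (euler n (steps t n) x - U t x)" for n
      using norm_euler_le[of n "steps s n" "euler n (steps t n) x - U t x"] euler_linear[of n "steps s n"] by (simp add: linear_simps)
    then show "eventually (\<lambda>n. norm (?F n - euler n (steps s n) (U t x)) \<le> norm (euler n (steps t n) x - U t x)) sequentially" by simp
  qed
  then have "(\<lambda>n. ?F n - euler n (steps s n) (U t x) + euler n (steps s n) (U t x)) \<longlonglongrightarrow> 0 + U s (U t x)"
    by (intro tendsto_add euler_tendsto s)
  with 1 show ?thesis using LIMSEQ_unique[of ?F] by simp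
qed

section \<open>Generator of the limit semigroup and preservation of the norm\<close>

lemma U_minus_id:
  assumes t: "t \<ge> 0" and x: "x \<in> D" shows "norm (U t x - x) \<le> t * norm (A x)"
proof (rule LIMSEQ_le_const2)
  show "(\<lambda>n. norm (euler n (steps t n) x - x)) \<longlonglongrightarrow> norm (U t x - x)" by (intro tendsto_intros euler_tendsto t)
  have "norm (euler n (steps t n) x - x) \<le> t * norm (A x)" for n
    by (rule order_trans[OF euler_minus_id[OF x] mult_right_mono[OF steps_le[OF t]]]) simp
  then show "\<exists>N. \<forall>n\<ge>N. norm (euler n (steps t n) x - x) \<le> t * norm (A x)" by blast
qed

lemma U_continuous_0: "((\<lambda>t. U t x) \<longlongrightarrow> x) (at_right 0)"
proof (rule tendstoI)
  fix e :: real assume e: "0 < e"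
  obtain z where z: "z \<in> D" "norm (x - z) < e/4" using dense_approx[of "e/4"] e by auto
  have "((\<lambda>t. t * norm (A z)) \<longlongrightarrow> 0 * norm (A z)) (at_right 0)" by (intro tendsto_intros)
  then have "eventually (\<lambda>t. t * norm (A z) < e/2) (at_right 0)" using e by (intro order_tendstoD(2)) auto
  moreover have "eventually (\<lambda>t::real. t > 0) (at_right 0)" by (simp add: eventually_at_right_less)
  ultimately show "eventually (\<lambda>t. dist (U t x) x < e) (at_right 0)"
  proof eventually_elim
    case (elim t)
    have "U t x - x = U t (x - z) + ((U t z - z) - (x - z))"
      using U_linear[of t] elim by (simp add: linear_simps)
    also have "norm \<dots> \<le> norm (x - z) + norm ((U t z - z) - (x - z))"
      using elim by (intro norm_triangle_mono norm_U_le) auto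
    also have "norm ((U t z - z) - (x - z)) \<le> norm (U t z - z) + norm (x - z)" by (rule norm_triangle_ineq4)
    also have "norm (U t z - z) \<le> t * norm (A z)" using elim by (intro U_minus_id z) auto
    finally show ?case using elim z(2) by (simp add: dist_norm)
  qed
qed

text \<open>The increment of step \<open>j\<close> is \<open>mesh n\<close> times
  \<open>euler n (Suc j) (A x)\<close>, which is compared with \<open>A x\<close>. As
  \<open>A x\<close> may lie outside \<open>D\<close>, the comparison runs through \<open>z\<close>.
  The bound \<open>N\<close> stays fixed during the induction, so that all increments share the same
  error term.\<close>

lemma euler_derivative:
  assumes x: "x \<in> D" and z: "z \<in> D"
  shows "j \<le> N \<Longrightarrow> norm (euler n j x - x - (real j * mesh n) *\<^sub>R A x) \<le>
    (real j * mesh n) * (2 * norm (A x - z) + real N * mesh n * norm (A z))"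
proof (induction j)
  case (Suc j)
  let ?M = "2 * norm (A x - z) + real N * mesh n * norm (A z)"
  have "euler n (Suc j) x - euler n j x = euler n j (step (mesh n) x - x)"
    using euler_linear[of n j] by (simp add: euler_Suc2 linear_simps)
  also have "\<dots> = euler n j (mesh n *\<^sub>R step (mesh n) (A x))" by (simp add: x flip: A_step_eq A_step(2))
  also have "\<dots> = mesh n *\<^sub>R euler n (Suc j) (A x)"
    using euler_linear[of n j] by (simp add: euler_Suc2 linear_simps)
  finally have 1: "euler n (Suc j) x - x - (real (Suc j) * mesh n) *\<^sub>R A x =
     (euler n j x - x - (real j * mesh n) *\<^sub>R A x) + mesh n *\<^sub>R (euler n (Suc j) (A x) - A x)"
    by (simp add: algebra_simps)
  have "norm (euler n (Suc j) (A x) - A x) \<le> 2 * norm (A x - z) + real (Suc j) * mesh n * norm (A z)"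
    by (rule euler_minus_id_approx[OF z])
  also have "\<dots> \<le> ?M" using Suc.prems by (intro add_mono mult_right_mono) (auto simp: less_imp_le)
  finally have 2: "norm (mesh n *\<^sub>R (euler n (Suc j) (A x) - A x)) \<le> mesh n * ?M" by (simp add: less_imp_le)
  have "norm (euler n (Suc j) x - x - (real (Suc j) * mesh n) *\<^sub>R A x) \<le> real j * mesh n * ?M + mesh n * ?M"
    unfolding 1 by (intro norm_triangle_mono 2 Suc) (use Suc.prems in auto)
  then show ?case by (simp add: algebra_simps)
qed simp

lemma U_derivative:
  assumes t: "t \<ge> 0" and x: "x \<in> D" and z: "z \<in> D"
  shows "norm (U t x - x - t *\<^sub>R A x) \<le> t * (2 * norm (A x - z) + t * norm (A z))"
proof (rule LIMSEQ_le)
  show "(\<lambda>n. norm (euler n (steps t n) x - x - (real (steps t n) * mesh n) *\<^sub>R A x)) \<longlonglongrightarrow> norm (U t x - x - t *\<^sub>R A x)"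
    by (intro tendsto_intros euler_tendsto steps_tendsto t)
  show "(\<lambda>n. (real (steps t n) * mesh n) * (2 * norm (A x - z) + real (steps t n) * mesh n * norm (A z)))
      \<longlonglongrightarrow> t * (2 * norm (A x - z) + t * norm (A z))"
    by (intro tendsto_intros steps_tendsto t)
qed (use euler_derivative[OF x z order_refl] in blast)

lemma U_differentiable:
  assumes x: "x \<in> D" shows "((\<lambda>t. (1 / t) *\<^sub>R (U t x - x)) \<longlongrightarrow> A x) (at_right 0)"
proof (rule tendstoI)
  fix e :: real assume e: "0 < e"
  obtain z where z: "z \<in> D" "norm (A x - z) < e/4" using dense_approx[of "e/4"] e by auto
  have "((\<lambda>t. t * norm (A z)) \<longlongrightarrow> 0 * norm (A z)) (at_right 0)" by (intro tendsto_intros)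
  then have "eventually (\<lambda>t. t * norm (A z) < e/2) (at_right 0)" using e by (intro order_tendstoD(2)) auto
  moreover have "eventually (\<lambda>t::real. t > 0) (at_right 0)" by (simp add: eventually_at_right_less)
  ultimately show "eventually (\<lambda>t. dist ((1 / t) *\<^sub>R (U t x - x)) (A x) < e) (at_right 0)"
  proof eventually_elim
    case (elim t)
    have "(1 / t) *\<^sub>R (U t x - x) - A x = (1/t) *\<^sub>R (U t x - x - t *\<^sub>R A x)"
      using elim by (simp add: scaleR_diff_right)
    then have "norm ((1 / t) *\<^sub>R (U t x - x) - A x) = (1/t) * norm (U t x - x - t *\<^sub>R A x)"
      using elim by simp
    also have "\<dots> \<le> (1/t) * (t * (2 * norm (A x - z) + t * norm (A z)))"
      using elim by (intro mult_left_mono U_derivative x z) auto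
    also have "\<dots> < e" using elim z(2) by simp
    finally show ?case by (simp add: dist_norm)
  qed
qed

text \<open>The generator cannot properly extend \<open>A\<close>, because \<open>1 - A\<close> is
  already onto: with \<open>x0\<close> solving \<open>x0 - A x0 = x - y\<close>, the difference
  \<open>w = x - x0\<close> has right derivative \<open>w\<close> at 0, and contractivity then
  forces \<open>inner w w \<le> 0\<close>.\<close>

lemma U_domain:
  assumes y: "((\<lambda>t. (1 / t) *\<^sub>R (U t x - x)) \<longlongrightarrow> y) (at_right 0)" shows "x \<in> D"
proof -
  define x0 where "x0 = step 1 (x - y)"
  have x0: "x0 \<in> D" "x0 - A x0 = x - y" using step_D[of 1] step_eq[of 1 "x - y"] by (auto simp: x0_def)
  define w where "w = x - x0"
  have pos: "eventually (\<lambda>t::real. t > 0) (at_right 0)" by (simp add: eventually_at_right_less)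
  have "y - A x0 = w" using x0(2) by (simp add: w_def algebra_simps)
  then have 1: "((\<lambda>t. (1 / t) *\<^sub>R (U t x - x) - (1 / t) *\<^sub>R (U t x0 - x0)) \<longlongrightarrow> w) (at_right 0)"
    using tendsto_diff[OF y U_differentiable[OF x0(1)]] by simp
  have 2: "eventually (\<lambda>t. (1 / t) *\<^sub>R (U t x - x) - (1 / t) *\<^sub>R (U t x0 - x0) = (1 / t) *\<^sub>R (U t w - w)) (at_right 0)"
    using pos
  proof eventually_elim
    case (elim t)
    then show ?case using U_linear[of t] by (simp add: w_def linear_simps scaleR_diff_right)
  qed
  have "((\<lambda>t. (1 / t) *\<^sub>R (U t w - w)) \<longlongrightarrow> w) (at_right 0)"
    by (rule Lim_transform_eventually[OF 1 2])
  then have "((\<lambda>t. inner ((1 / t) *\<^sub>R (U t w - w)) w) \<longlongrightarrow> inner w w) (at_right 0)"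
    by (intro tendsto_intros)
  moreover have "eventually (\<lambda>t. inner ((1 / t) *\<^sub>R (U t w - w)) w \<le> 0) (at_right 0)"
    using pos
  proof eventually_elim
    case (elim t)
    have "inner (U t w) w \<le> norm (U t w) * norm w" by (rule norm_cauchy_schwarz)
    also have "\<dots> \<le> norm w * norm w" using elim by (intro mult_right_mono norm_U_le) auto
    also have "\<dots> = inner w w" by (simp add: dot_square_norm power2_eq_square)
    finally show ?case using elim by (simp add: inner_diff_left divide_nonpos_pos)
  qed
  ultimately have "inner w w \<le> 0" by (rule tendsto_upperbound) simp
  then have "w = 0" by (metis inner_ge_zero inner_eq_zero_iff order_antisym)
  then show ?thesis using x0 by (simp add: w_def)
qed

text \<open>A step loses exactly \<open>(mesh n)\<^sup>2\<close> times the squared norm of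
  \<open>A\<close> at the new point, and that norm never exceeds \<open>norm (A x)\<close> along the
  scheme. The total loss up to time \<open>t\<close> is of order \<open>mesh n\<close> and
  disappears in the limit, which makes \<open>U\<close> isometric.\<close>

lemma norm_euler_ge:
  assumes x: "x \<in> D" shows "(norm x)\<^sup>2 - real j * (mesh n)\<^sup>2 * (norm (A x))\<^sup>2 \<le> (norm (euler n j x))\<^sup>2"
proof (induction j)
  case (Suc j)
  have "(norm (euler n j x))\<^sup>2 = (norm (euler n (Suc j) x))\<^sup>2 + (mesh n)\<^sup>2 * (norm (A (euler n (Suc j) x)))\<^sup>2"
    using norm_step[of "mesh n" "euler n j x"] by (simp add: euler_Suc)
  also have "\<dots> \<le> (norm (euler n (Suc j) x))\<^sup>2 + (mesh n)\<^sup>2 * (norm (A x))\<^sup>2"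
    by (intro add_mono mult_left_mono power_mono) (auto simp: A_euler[OF x] norm_euler_le)
  finally show ?case using Suc by (simp add: algebra_simps)
qed simp

lemma norm_U:
  assumes t: "t \<ge> 0" shows "norm (U t x) = norm x"
proof -
  have D: "norm x \<le> norm (U t x)" if x: "x \<in> D" for x
  proof -
    have "(\<lambda>n. (norm x)\<^sup>2 - (real (steps t n) * mesh n) * mesh n * (norm (A x))\<^sup>2) \<longlonglongrightarrow> (norm x)\<^sup>2 - t * 0 * (norm (A x))\<^sup>2"
      by (intro tendsto_intros steps_tendsto t mesh_tendsto)
    moreover have "(\<lambda>n. (norm (euler n (steps t n) x))\<^sup>2) \<longlonglongrightarrow> (norm (U t x))\<^sup>2"
      by (intro tendsto_intros euler_tendsto t)
    moreover have "(norm x)\<^sup>2 - (real (steps t n) * mesh n) * mesh n * (norm (A x))\<^sup>2 \<le> (norm (euler n (steps t n) x))\<^sup>2" for n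
      using norm_euler_ge[OF x, of "steps t n" n] by (simp add: power2_eq_square mult_ac)
    then have "\<exists>N. \<forall>n\<ge>N. (norm x)\<^sup>2 - (real (steps t n) * mesh n) * mesh n * (norm (A x))\<^sup>2 \<le> (norm (euler n (steps t n) x))\<^sup>2"
      by blast
    ultimately have "(norm x)\<^sup>2 - t * 0 * (norm (A x))\<^sup>2 \<le> (norm (U t x))\<^sup>2" by (rule LIMSEQ_le)
    then show ?thesis using power2_le_imp_le[of "norm x" "norm (U t x)"] by simp
  qed
  interpret U: bounded_linear "U t" by (rule U_linear[OF t])
  have "closure D \<subseteq> {x. norm x \<le> norm (U t x)}"
    by (intro closure_minimal subsetI closed_Collect_le continuous_intros U.continuous_on)
       (use D in auto)
  then have "norm x \<le> norm (U t x)" using dense_D by blast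
  then show ?thesis using norm_U_le[OF t] by (simp add: order_antisym)
qed

theorem generates_isometric: "generates J D A U"
  unfolding generates_def c0_semigroup_def bounded_clinear_op_def
  using U_linear U_J U_0 U_add U_continuous_0 U_differentiable U_domain
  by (auto simp: fun_eq_iff) blast

end

section \<open>Similarity of semigroups\<close>

lemma generates_similar:
  fixes E :: "'h::real_normed_vector \<Rightarrow> 'h"
  assumes T: "generates J D E T" and R: "bounded_clinear_op J J R" and S: "bounded_clinear_op J J S"
    and RS: "R \<circ> S = id" and SR: "S \<circ> R = id"
  shows "generates J {x. S x \<in> D} (\<lambda>x. R (E (S x))) (\<lambda>t. R \<circ> T t \<circ> S)"
proof -
  interpret R: bounded_linear R using R by (simp add: bounded_clinear_op_def)
  interpret S: bounded_linear S using S by (simp add: bounded_clinear_op_def)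
  have RS': "R (S x) = x" and SR': "S (R x) = x" for x using RS SR by (metis comp_apply id_apply)+
  have c0: "c0_semigroup J T" and dom: "x \<in> D \<longleftrightarrow> (\<exists>y. ((\<lambda>t. (1 / t) *\<^sub>R (T t x - x)) \<longlongrightarrow> y) (at_right 0))"
    and der: "x \<in> D \<Longrightarrow> ((\<lambda>t. (1 / t) *\<^sub>R (T t x - x)) \<longlongrightarrow> E x) (at_right 0)" for x
    using T by (auto simp: generates_def)
  have q: "(1 / t) *\<^sub>R (R (T t (S x)) - x) = R ((1 / t) *\<^sub>R (T t (S x) - S x))" for t x
    by (simp add: R.scaleR R.diff RS')
  have "c0_semigroup J (\<lambda>t. R \<circ> T t \<circ> S)"
    unfolding c0_semigroup_def
  proof (intro conjI allI impI)
    fix t :: real assume t: "t \<ge> 0"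
    then have "bounded_clinear_op J J (T t)" using c0 by (simp add: c0_semigroup_def)
    then show "bounded_clinear_op J J (R \<circ> T t \<circ> S)"
      using R S unfolding bounded_clinear_op_def o_def
      by (auto intro!: bounded_linear_compose[of R] bounded_linear_compose[of "T t"])
  next
    show "R \<circ> T 0 \<circ> S = id" using c0 by (simp add: c0_semigroup_def RS)
  next
    fix s t :: real assume "s \<ge> 0" "t \<ge> 0"
    then show "R \<circ> T (s + t) \<circ> S = (R \<circ> T s \<circ> S) \<circ> (R \<circ> T t \<circ> S)"
      using c0 by (simp add: c0_semigroup_def fun_eq_iff SR')
  next
    fix x
    have "((\<lambda>t. T t (S x)) \<longlongrightarrow> S x) (at_right 0)" using c0 by (simp add: c0_semigroup_def)
    from R.tendsto[OF this] show "((\<lambda>t. (R \<circ> T t \<circ> S) x) \<longlongrightarrow> x) (at_right 0)" by (simp add: RS')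
  qed
  moreover have "S x \<in> D \<longleftrightarrow> (\<exists>y. ((\<lambda>t. (1 / t) *\<^sub>R (R (T t (S x)) - x)) \<longlongrightarrow> y) (at_right 0))" for x
  proof
    assume "S x \<in> D"
    from R.tendsto[OF der[OF this]] show "\<exists>y. ((\<lambda>t. (1 / t) *\<^sub>R (R (T t (S x)) - x)) \<longlongrightarrow> y) (at_right 0)"
      unfolding q by blast
  next
    assume "\<exists>y. ((\<lambda>t. (1 / t) *\<^sub>R (R (T t (S x)) - x)) \<longlongrightarrow> y) (at_right 0)"
    then obtain y where "((\<lambda>t. R ((1 / t) *\<^sub>R (T t (S x) - S x))) \<longlongrightarrow> y) (at_right 0)" unfolding q by blast
    from S.tendsto[OF this] show "S x \<in> D" unfolding SR' dom[of "S x"] by blast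
  qed
  moreover have "((\<lambda>t. (1 / t) *\<^sub>R (R (T t (S x)) - x)) \<longlongrightarrow> R (E (S x))) (at_right 0)" if "S x \<in> D" for x
    unfolding q by (rule R.tendsto[OF der[OF that]])
  ultimately show ?thesis unfolding generates_def by simp
qed

text \<open>Conjugation by \<open>R\<close> turns skewness of \<open>E\<close> for the form
  \<open>inner (R x) (R y)\<close> into skewness of \<open>R E S\<close> for the original inner
  product, where \<open>skew_generator\<close> applies.\<close>

lemma cond_i_if_skew:
  fixes J :: "'h::{real_inner,complete_space} \<Rightarrow> 'h"
  assumes J: "cstruct J" and E: "lin_op J J D E"
    and R: "bounded_clinear_op J J R" and S: "bounded_clinear_op J J S"
    and RS: "R \<circ> S = id" and SR: "S \<circ> R = id"
    and skew: "\<And>x. x \<in> D \<Longrightarrow> inner (R (E x)) (R x) = 0"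
    and onto: "\<And>r y. r > 0 \<Longrightarrow> \<exists>x\<in>D. r *\<^sub>R x - E x = y"
  shows "cond_i J D E"
proof -
  interpret R: bounded_linear R using R by (simp add: bounded_clinear_op_def)
  interpret S: bounded_linear S using S by (simp add: bounded_clinear_op_def)
  have RS': "R (S x) = x" and SR': "S (R x) = x" for x using RS SR by (metis comp_apply id_apply)+
  have RJ: "R (J x) = J (R x)" and SJ: "S (J x) = J (S x)" for x using R S by (auto simp: bounded_clinear_op_def)
  define D' A where "D' = {x. S x \<in> D}" and "A = (\<lambda>x. R (E (S x)))"
  interpret skew_generator J D' A
  proof
    show "cstruct J" by fact
    show "lin_op J J D' A" using E
      unfolding lin_op_def csubspace_def subspace_def D'_def A_def
      by (auto simp: S.add S.scaleR S.zero SJ R.add R.scaleR RJ)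
    show "inner (A x) x = 0" if "x \<in> D'" for x
      using skew[of "S x"] that by (simp add: D'_def A_def RS')
    show "\<exists>x\<in>D'. r *\<^sub>R x - A x = y" if r: "r > 0" for r y
    proof -
      obtain x where x: "x \<in> D" "r *\<^sub>R x - E x = S y" using onto[OF r] by blast
      have "r *\<^sub>R R x - A (R x) = R (r *\<^sub>R x - E x)" by (simp add: A_def SR' R.diff R.scaleR)
      then show ?thesis using x by (intro bexI[of _ "R x"]) (auto simp: D'_def SR' RS')
    qed
  qed
  have "generates J {x. R x \<in> D'} (\<lambda>x. S (A (R x))) (\<lambda>t. S \<circ> U t \<circ> R)"
    by (rule generates_similar[OF generates_isometric S R SR RS])
  moreover have "{x. R x \<in> D'} = D" by (auto simp: D'_def SR')
  moreover have "(\<lambda>x. S (A (R x))) = E" by (auto simp: A_def SR')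
  ultimately have "generates J D E (\<lambda>t. S \<circ> U t \<circ> R)" by simp
  moreover have "norm (R ((S \<circ> U t \<circ> R) (S x))) = norm x" if "t \<ge> 0" for t x
    using norm_U[OF that] by (simp add: RS')
  ultimately show ?thesis unfolding cond_i_def using R S RS SR by blast
qed

section \<open>Generalized limits of inner products\<close>

text \<open>All hypotheses are only eventual, with a starting point depending on the vectors and on
  the tolerance \<open>d\<close>. They become exact for the limit along a finer filter, whose limit
  form is symmetric, coercive and bounded.\<close>

lemma limit_form_similarity:
  fixes J :: "'h::{real_inner,complete_space} \<Rightarrow> 'h" and F :: "'i filter"
  assumes J: "cstruct J" and F: "F \<noteq> bot" and a: "a > 0"
    and add: "\<And>x y z. eventually (\<lambda>i. B i (x + y) z = B i x z + B i y z) F"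
    and scale: "\<And>r x y. eventually (\<lambda>i. B i (r *\<^sub>R x) y = r * B i x y) F"
    and sym: "\<And>x y. eventually (\<lambda>i. B i x y = B i y x) F"
    and BJ: "\<And>x y. eventually (\<lambda>i. B i (J x) (J y) = B i x y) F"
    and lo: "\<And>x d. d > 0 \<Longrightarrow> eventually (\<lambda>i. a * (norm x)\<^sup>2 - d \<le> B i x x) F"
    and up: "\<And>x d. d > 0 \<Longrightarrow> eventually (\<lambda>i. B i x x \<le> b * (norm x)\<^sup>2 + d) F"
  shows "\<exists>G R S. G \<le> F \<and> G \<noteq> bot \<and> bounded_clinear_op J J R \<and> bounded_clinear_op J J S \<and>
    R \<circ> S = id \<and> S \<circ> R = id \<and> (\<forall>x y. ((\<lambda>i. B i x y) \<longlongrightarrow> inner (R x) (R y)) G)"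
proof -
  \<comment> \<open>By polarization \<open>4 * B i x y\<close> is the difference of the values at
    \<open>x + y\<close> and \<open>x - y\<close>. Taking \<open>d = 1\<close>, each value lies
    between -1 and the corresponding summand of \<open>c\<close>.\<close>
  define c where "c = (\<lambda>(x :: 'h, y :: 'h). (b * (norm (x + y))\<^sup>2 + 1 + (b * (norm (x - y))\<^sup>2 + 1) + 2) / 4)"
  have "eventually (\<lambda>i. \<bar>(\<lambda>(x, y). B i x y) p\<bar> \<le> c p) F" for p
  proof -
    obtain x y where p: "p = (x, y)" by force
    have "eventually (\<lambda>i. \<bar>B i x y\<bar> \<le> c p) F"
      using lo[OF zero_less_one, of "x + y"] lo[OF zero_less_one, of "x - y"] up[OF zero_less_one, of "x + y"] up[OF zero_less_one, of "x - y"] 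
        add[of x y "x + y"] add[of x "-1 *\<^sub>R y" "x - y"] scale[of "-1" y "x - y"]
        sym[of x "x + y"] sym[of y "x + y"] sym[of x "x - y"] sym[of y "x - y"]
        add[of x y x] add[of x y y] add[of x "-1 *\<^sub>R y" x] add[of x "-1 *\<^sub>R y" y]
        scale[of "-1" y x] scale[of "-1" y y] sym[of x y]
    proof eventually_elim
      case (elim i)
      have "0 \<le> a * (norm (x + y))\<^sup>2" "0 \<le> a * (norm (x - y))\<^sup>2" using a by simp_all
      then show ?case using elim by (simp add: c_def p)
    qed
    then show ?thesis by (simp add: p)
  qed
  from cluster_filter[of F "\<lambda>i (x, y). B i x y" c, OF F this] obtain G where G: "G \<le> F" "G \<noteq> bot"
    and l: "\<And>p. \<exists>l. ((\<lambda>i. (\<lambda>(x, y). B i x y) p) \<longlongrightarrow> l) G" by blast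
  have "\<exists>l. ((\<lambda>i. B i x y) \<longlongrightarrow> l) G" for x y using l[of "(x, y)"] by simp
  then obtain L where L: "\<And>x y. ((\<lambda>i. B i x y) \<longlongrightarrow> L x y) G" by metis
  have eq: "l = m" if "eventually (\<lambda>i. f i = g i) F" "(f \<longlongrightarrow> l) G" "(g \<longlongrightarrow> m) G" for f g l and m :: real
    using tendsto_unique[OF G(2) that(3)] Lim_transform_eventually[OF that(2) filter_leD[OF G(1) that(1)]] by simp
  have Ladd: "L (x + y) z = L x z + L y z" for x y z by (rule eq[OF add L tendsto_add[OF L L]])
  have Lscale: "L (r *\<^sub>R x) y = r * L x y" for r x y by (rule eq[OF scale L tendsto_mult_left[OF L]])
  have Lsym: "L x y = L y x" for x y by (rule eq[OF sym L L])
  have LJ: "L (J x) (J y) = L x y" for x y by (rule eq[OF BJ L L])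
  have Llo: "a * (norm x)\<^sup>2 \<le> L x x" for x
  proof (rule field_le_epsilon)
    fix d :: real assume "d > 0"
    from tendsto_lowerbound[OF L filter_leD[OF G(1) lo[OF this]] G(2)]
    show "a * (norm x)\<^sup>2 \<le> L x x + d" by (simp add: algebra_simps)
  qed
  have Lup: "L x x \<le> b * (norm x)\<^sup>2" for x
  proof (rule field_le_epsilon)
    fix d :: real assume "d > 0"
    from tendsto_upperbound[OF L filter_leD[OF G(1) up[OF this]] G(2)]
    show "L x x \<le> b * (norm x)\<^sup>2 + d" .
  qed
  have Lnn: "0 \<le> L x x" for x using Llo[of x] a by (meson order_trans mult_nonneg_nonneg less_imp_le zero_le_power2)
  \<comment> \<open>Nonnegativity of the form at \<open>x + y\<close> and \<open>x - y\<close> gives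
    \<open>2 * \<bar>L x y\<bar> \<le> L x x + L y y\<close>; normalizing the vectors turns this
    into the bilinear bound.\<close>
  have unit: "\<bar>L x y\<bar> \<le> b" if "norm x = 1" "norm y = 1" for x y
  proof -
    have "L (x + y) (x + y) = L x x + 2 * L x y + L y y"
      using Lsym[of x "x + y"] Lsym[of y "x + y"] Lsym[of y x] by (simp add: Ladd)
    moreover have "L (x - y) z = L x z - L y z" for x y z
      using Ladd[of x "(-1) *\<^sub>R y" z] Lscale[of "-1" y z] by simp
    then have "L (x - y) (x - y) = L x x - 2 * L x y + L y y"
      using Lsym[of x "x - y"] Lsym[of y "x - y"] Lsym[of y x] by simp
    ultimately show ?thesis using Lnn[of "x + y"] Lnn[of "x - y"] Lup[of x] Lup[of y] that by simp
  qed
  have "\<bar>L x y\<bar> \<le> b * norm x * norm y" for x y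
  proof (cases "x = 0 \<or> y = 0")
    case True
    then have "L x y = 0" using Lscale[of 0 x y] Lscale[of 0 y x] Lsym[of x y] by auto
    then show ?thesis using True by auto
  next
    case False
    define u v where "u = (1 / norm x) *\<^sub>R x" and "v = (1 / norm y) *\<^sub>R y"
    have uv: "norm u = 1" "norm v = 1" "x = norm x *\<^sub>R u" "y = norm y *\<^sub>R v"
      using False by (auto simp: u_def v_def)
    have "L x y = norm x * (norm y * L u v)"
      by (metis uv(3,4) Lscale Lsym)
    then have "\<bar>L x y\<bar> = norm x * norm y * \<bar>L u v\<bar>" by (simp add: abs_mult)
    also have "\<dots> \<le> norm x * norm y * b" using unit[OF uv(1,2)] by (intro mult_left_mono) auto
    finally show ?thesis by (simp add: mult_ac)
  qed
  then have "\<exists>R S. bounded_clinear_op J J R \<and> bounded_clinear_op J J S \<and> R \<circ> S = id \<and> S \<circ> R = id \<and>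
      (\<forall>x y. inner (R x) (R y) = L x y)"
    by (intro form_similarity[where a = a and b = b] J Lsym Ladd Lscale LJ a Llo)
  then show ?thesis using G L by metis
qed

section \<open>Measurability\<close>

text \<open>Norms of simple functions are real simple functions, hence Borel measurable even when
  the codomain is not separable. Their limit is the norm of \<open>g\<close> only almost everywhere,
  which is enough because Lebesgue measure is complete.\<close>

lemma bochner_measurable_norm_on:
  fixes g :: "'a::euclidean_space \<Rightarrow> 'b::real_normed_vector"
  assumes S: "S \<in> sets lebesgue" and g: "bochner_measurable (lebesgue_on S) g"
  shows "(\<lambda>x. if x \<in> S then norm (g x) else 0) \<in> borel_measurable lebesgue"
proof -
  obtain s where s: "\<And>i::nat. simple_function (lebesgue_on S) (s i)"
    and lim: "AE x in lebesgue_on S. (\<lambda>i. s i x) \<longlonglongrightarrow> g x"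
    using g by (auto simp: bochner_measurable_def)
  define u where "u i x = (if x \<in> S then norm (s i x) else 0)" for i x
  have "(\<lambda>x. norm (s i x)) \<in> borel_measurable (lebesgue_on S)" for i
    using simple_function_compose1[OF s, of norm i] by (rule borel_measurable_simple_function)
  then have u: "u i \<in> borel_measurable lebesgue" for i
    unfolding u_def by (intro borel_measurable_if_I S)
  have "AE x in lebesgue. x \<in> S \<longrightarrow> (\<lambda>i. s i x) \<longlonglongrightarrow> g x"
    using lim S by (simp add: AE_restrict_space_iff)
  then have "AE x in lebesgue. lim (\<lambda>i. u i x) = (if x \<in> S then norm (g x) else 0)"
  proof eventually_elim
    case (elim x)
    then show ?case by (auto simp: u_def intro!: limI tendsto_norm)
  qed
  then show ?thesis by (rule borel_measurable_AE[OF borel_measurable_lim_metric[OF u]])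
qed

lemma bochner_measurable_norm:
  fixes g :: "'a::euclidean_space \<Rightarrow> 'b::real_normed_vector"
  assumes "bochner_measurable lebesgue g"
  shows "(\<lambda>x. norm (g x)) \<in> borel_measurable lebesgue"
  using bochner_measurable_norm_on[of UNIV g] assms by (simp add: lebesgue_on_UNIV_eq)

section \<open>Resolvents\<close>

lemma cscale_add: "linear J \<Longrightarrow> cscale J c (x + y) = cscale J c x + cscale J c y"
  and cscale_diff: "linear J \<Longrightarrow> cscale J c (x - y) = cscale J c x - cscale J c y"
  and cscale_scaleR: "linear J \<Longrightarrow> cscale J c (r *\<^sub>R x) = r *\<^sub>R cscale J c x"
  and cscale_J: "linear J \<Longrightarrow> cscale J c (J x) = J (cscale J c x)"
  by (simp_all add: cscale_def linear_add linear_diff linear_scale algebra_simps)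

text \<open>The inverse in \<open>resolvent_set\<close> is a real-linear map and
  \<open>resolvent\<close> a definite description. Additivity, homogeneity and commutation with
  \<open>J\<close> are all read off from uniqueness of the solution.\<close>

lemma
  assumes J: "cstruct J" and E: "lin_op J J D E" and lam: "lam \<in> resolvent_set J D E"
  shows resolvent_in: "resolvent J D E lam y \<in> D"
    and resolvent_eq: "cscale J lam (resolvent J D E lam y) - E (resolvent J D E lam y) = y"
    and resolvent_unique: "x \<in> D \<Longrightarrow> cscale J lam x - E x = y \<Longrightarrow> resolvent J D E lam y = x"
    and resolvent_add: "resolvent J D E lam (x + y) = resolvent J D E lam x + resolvent J D E lam y"
    and resolvent_scaleR: "resolvent J D E lam (c *\<^sub>R x) = c *\<^sub>R resolvent J D E lam x"
    and resolvent_J: "resolvent J D E lam (J x) = J (resolvent J D E lam x)"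
    and resolvent_E: "x \<in> D \<Longrightarrow> resolvent J D E lam (E x) = cscale J lam (resolvent J D E lam x) - x"
proof -
  have lJ: "linear J" using J by (simp add: cstruct_def)
  obtain R where R: "\<And>x. x \<in> D \<Longrightarrow> R (cscale J lam x - E x) = x"
    "\<And>y. R y \<in> D" "\<And>y. cscale J lam (R y) - E (R y) = y"
    using lam unfolding resolvent_set_def by blast
  have u: "resolvent J D E lam y = x" if "x \<in> D" "cscale J lam x - E x = y" for x y
    unfolding resolvent_def by (rule the_equality) (use that R(1) in metis)+
  have res: "resolvent J D E lam y = R y" for y by (rule u) (use R in auto)
  show 1: "resolvent J D E lam y \<in> D" and 2: "cscale J lam (resolvent J D E lam y) - E (resolvent J D E lam y) = y" for y
    unfolding res using R by auto
  show "x \<in> D \<Longrightarrow> cscale J lam x - E x = y \<Longrightarrow> resolvent J D E lam y = x" by (rule u)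
  have sub: "subspace D" and EJ: "\<And>x. x \<in> D \<Longrightarrow> J x \<in> D \<and> E (J x) = J (E x)"
    and Eadd: "\<And>x y. x \<in> D \<Longrightarrow> y \<in> D \<Longrightarrow> E (x + y) = E x + E y"
    and Esc: "\<And>c x. x \<in> D \<Longrightarrow> E (c *\<^sub>R x) = c *\<^sub>R E x"
    using E by (auto simp: lin_op_def csubspace_def)
  show radd: "resolvent J D E lam (x + y) = resolvent J D E lam x + resolvent J D E lam y" for x y
  proof (rule u)
    let ?a = "resolvent J D E lam x" and ?b = "resolvent J D E lam y"
    show "?a + ?b \<in> D" using 1 sub by (simp add: subspace_add)
    have "cscale J lam (?a + ?b) - E (?a + ?b) = (cscale J lam ?a - E ?a) + (cscale J lam ?b - E ?b)"
      by (simp add: Eadd 1 cscale_add[OF lJ])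
    then show "cscale J lam (?a + ?b) - E (?a + ?b) = x + y" unfolding 2 .
  qed
  show rsc: "resolvent J D E lam (c *\<^sub>R x) = c *\<^sub>R resolvent J D E lam x" for c x
  proof (rule u)
    let ?a = "resolvent J D E lam x"
    show "c *\<^sub>R ?a \<in> D" using 1 sub by (simp add: subspace_scale)
    have "cscale J lam (c *\<^sub>R ?a) - E (c *\<^sub>R ?a) = c *\<^sub>R (cscale J lam ?a - E ?a)"
      by (simp add: Esc 1 cscale_scaleR[OF lJ] scaleR_diff_right)
    then show "cscale J lam (c *\<^sub>R ?a) - E (c *\<^sub>R ?a) = c *\<^sub>R x" unfolding 2 .
  qed
  show rJ: "resolvent J D E lam (J x) = J (resolvent J D E lam x)" for x
  proof (rule u)
    let ?a = "resolvent J D E lam x"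
    show "J ?a \<in> D" using 1 EJ by simp
    have "cscale J lam (J ?a) - E (J ?a) = J (cscale J lam ?a - E ?a)"
      by (simp add: EJ 1 cscale_J[OF lJ] linear_diff[OF lJ])
    then show "cscale J lam (J ?a) - E (J ?a) = J x" unfolding 2 .
  qed
  show "resolvent J D E lam (E x) = cscale J lam (resolvent J D E lam x) - x" if x: "x \<in> D" for x
  proof -
    have rd: "resolvent J D E lam (a - b) = resolvent J D E lam a - resolvent J D E lam b" for a b
      using radd[of a "(-1) *\<^sub>R b"] rsc[of "-1" b] by simp
    have "x = resolvent J D E lam (cscale J lam x - E x)" using u[OF x] by simp
    also have "\<dots> = resolvent J D E lam (cscale J lam x) - resolvent J D E lam (E x)" by (rule rd)
    also have "resolvent J D E lam (cscale J lam x) = cscale J lam (resolvent J D E lam x)"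
      by (simp add: cscale_def radd rsc rJ)
    finally show ?thesis by (simp add: algebra_simps)
  qed
qed

section \<open>From resolvent bounds to isometries\<close>

lemma integrable_inverse_square_weight: "integrable lebesgue (\<lambda>x::real. 2 / (1 + x\<^sup>2))"
proof -
  have "set_integrable lborel (einterval (-\<infinity>) \<infinity>) (\<lambda>x. 2 / (1 + x\<^sup>2))"
  proof (rule interval_integral_FTC_nonneg)
    show "DERIV (\<lambda>x. 2 * arctan x) x :> 2 / (1 + x\<^sup>2)" for x :: real
      by (auto intro!: derivative_eq_intros simp: divide_inverse)
    show "isCont (\<lambda>x. 2 / (1 + x\<^sup>2)) x" for x :: real
      by (auto intro!: continuous_intros simp: add_nonneg_eq_0_iff)
    have "((\<lambda>x. 2 * arctan x) \<longlongrightarrow> 2 * (-(pi/2))) at_bot" by (intro tendsto_intros tendsto_arctan_at_bot)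
    then show "(((\<lambda>x. 2 * arctan x) \<circ> real_of_ereal) \<longlongrightarrow> - pi) (at_right (-\<infinity>))"
      by (simp add: ereal_tendsto_simps1)
    have "((\<lambda>x. 2 * arctan x) \<longlongrightarrow> 2 * (pi/2)) at_top" by (intro tendsto_intros tendsto_arctan_at_top)
    then show "(((\<lambda>x. 2 * arctan x) \<circ> real_of_ereal) \<longlongrightarrow> pi) (at_left \<infinity>)"
      by (simp add: ereal_tendsto_simps1)
  qed (auto simp: add_nonneg_nonneg)
  then have "integrable lborel (\<lambda>x::real. 2 / (1 + x\<^sup>2))"
    by (simp add: set_integrable_def einterval_def)
  then show ?thesis by (rule integrable_completion[THEN iffD2, rotated]) simp
qed

lemma young: "(0::real) < s \<Longrightarrow> a * b \<le> a\<^sup>2 / (2 * s) + s / 2 * b\<^sup>2"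
proof -
  assume s: "0 < s"
  have "0 \<le> (a - s * b)\<^sup>2 / (2 * s)" using s by simp
  also have "\<dots> = a\<^sup>2 / (2 * s) - a * b + s / 2 * b\<^sup>2" using s by (simp add: power2_eq_square field_simps)
  finally show ?thesis by simp
qed

text \<open>For small \<open>\<xi>\<close> the trivial bound is good enough; for large \<open>\<xi>\<close> one gains a factor \<open>1/\<xi>\<close>
  from \<open>u = (c + v) / (\<epsilon> + i\<xi>)\<close>.\<close>

lemma resolvent_cross_term:
  fixes u v c :: "'k::real_inner"
  assumes J: "cstruct J" and e: "0 < e" and s: "0 < s" and eq: "v = cscale J (Complex e xi) u - c"
  shows "\<bar>inner c u\<bar> \<le> (e + 1 / (2 * s)) * (norm c)\<^sup>2 * (2 / (1 + xi\<^sup>2)) + s / 2 * ((norm u)\<^sup>2 + (norm v)\<^sup>2)"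
proof (cases "\<bar>xi\<bar> \<le> 1")
  case True
  then have "xi\<^sup>2 \<le> 1" by (simp add: abs_square_le_1)
  then have w: "1 \<le> 2 / (1 + xi\<^sup>2)" by (simp add: pos_le_divide_eq add_pos_nonneg)
  have "\<bar>inner c u\<bar> \<le> norm c * norm u" by (rule Cauchy_Schwarz_ineq2)
  also have "\<dots> \<le> (norm c)\<^sup>2 / (2 * s) + s / 2 * (norm u)\<^sup>2" by (rule young[OF s])
  also have "(norm c)\<^sup>2 / (2 * s) \<le> (e + 1 / (2 * s)) * (norm c)\<^sup>2 * 1"
    using e by (simp add: algebra_simps)
  also have "\<dots> \<le> (e + 1 / (2 * s)) * (norm c)\<^sup>2 * (2 / (1 + xi\<^sup>2))"
    using w e s by (intro mult_left_mono) auto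
  finally have "\<bar>inner c u\<bar> \<le> (e + 1 / (2 * s)) * (norm c)\<^sup>2 * (2 / (1 + xi\<^sup>2)) + s / 2 * (norm u)\<^sup>2"
    by simp
  moreover have "0 \<le> s / 2 * (norm v)\<^sup>2" using s by simp
  ultimately show ?thesis unfolding distrib_left by linarith
next
  case False
  define P where "P = e\<^sup>2 + xi\<^sup>2"
  have x1: "1 < xi\<^sup>2" using False by (metis abs_square_le_1 not_le)
  then have P: "0 < P" "xi\<^sup>2 \<le> P" using zero_le_power2[of e] unfolding P_def by linarith+
  \<comment> \<open>From \<open>xi\<^sup>2 > 1\<close> follows
    \<open>1 + xi\<^sup>2 \<le> 2 * xi\<^sup>2 \<le> 2 * P\<close>.\<close>
  have w: "1 / P \<le> 2 / (1 + xi\<^sup>2)"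
    using P x1 by (simp add: field_simps)
  have lJ: "linear J" and JJ: "J (J x) = - x" and Jin: "inner (J x) (J y) = inner x y" for x y
    using J by (auto simp: cstruct_def)
  have skew: "inner x (J y) = - inner (J x) y" for x y
    using Jin[of x "J y"] by (simp add: JJ)
  have Jc: "inner c (J c) = 0" using skew[of c c] by (simp add: inner_commute)
  have cv: "c + v = e *\<^sub>R u + xi *\<^sub>R J u" using eq by (simp add: cscale_def)
  have 1: "inner (c + v) c = e * inner u c + xi * inner (J u) c" unfolding cv by (simp add: inner_add_left)
  have 2: "inner (c + v) (J c) = - e * inner (J u) c + xi * inner u c"
    unfolding cv by (simp add: inner_add_left Jin skew[of u c])
  \<comment> \<open>\<open>P\<close> is the squared modulus of \<open>e + i xi\<close>. Multiplying
    \<open>c + v = (e + i xi) u\<close> by the conjugate \<open>e - i xi\<close> isolates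
    \<open>u\<close>, and the conjugate factor is moved to the other side of the inner
    product.\<close>
  have "P * inner c u = e * inner (c + v) c + xi * inner (c + v) (J c)"
    unfolding 1 2 P_def by (simp add: algebra_simps power2_eq_square inner_commute[of c u])
  also have "\<dots> = e * (norm c)\<^sup>2 + inner v (e *\<^sub>R c + xi *\<^sub>R J c)"
    by (simp add: inner_add_left inner_add_right Jc power2_norm_eq_inner algebra_simps)
  finally have "P * \<bar>inner c u\<bar> = \<bar>e * (norm c)\<^sup>2 + inner v (e *\<^sub>R c + xi *\<^sub>R J c)\<bar>"
    using P by (metis abs_mult abs_of_pos)
  also have "\<dots> \<le> e * (norm c)\<^sup>2 + norm v * norm (e *\<^sub>R c + xi *\<^sub>R J c)"
    using Cauchy_Schwarz_ineq2[of v "e *\<^sub>R c + xi *\<^sub>R J c"] e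
    by (intro order_trans[OF abs_triangle_ineq] add_mono) auto
  also have "norm (e *\<^sub>R c + xi *\<^sub>R J c) = sqrt P * norm c"
  proof -
    have "(norm (e *\<^sub>R c + xi *\<^sub>R J c))\<^sup>2 = P * (norm c)\<^sup>2"
      unfolding power2_norm_eq_inner
      by (simp add: inner_add_left inner_add_right Jc Jin inner_commute[of "J c" c] P_def algebra_simps power2_eq_square)
    then have "sqrt ((norm (e *\<^sub>R c + xi *\<^sub>R J c))\<^sup>2) = sqrt (P * (norm c)\<^sup>2)" by simp
    then show ?thesis by (simp add: real_sqrt_mult)
  qed
  also have "norm v * (sqrt P * norm c) = norm c * (sqrt P * norm v)" by simp
  also have "\<dots> \<le> (norm c)\<^sup>2 / (2 * s) + s / 2 * (sqrt P * norm v)\<^sup>2" by (rule young[OF s])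
  finally have "P * \<bar>inner c u\<bar> \<le> (e + 1 / (2 * s)) * (norm c)\<^sup>2 + P * (s / 2 * (norm v)\<^sup>2)"
    using P by (simp add: power_mult_distrib algebra_simps)
  then have "\<bar>inner c u\<bar> \<le> (e + 1 / (2 * s)) * (norm c)\<^sup>2 * (1 / P) + s / 2 * (norm v)\<^sup>2"
    using P by (simp add: field_simps)
  also have "(e + 1 / (2 * s)) * (norm c)\<^sup>2 * (1 / P) \<le> (e + 1 / (2 * s)) * (norm c)\<^sup>2 * (2 / (1 + xi\<^sup>2))"
    using w e s by (intro mult_left_mono) auto
  finally have "\<bar>inner c u\<bar> \<le> (e + 1 / (2 * s)) * (norm c)\<^sup>2 * (2 / (1 + xi\<^sup>2)) + s / 2 * (norm v)\<^sup>2"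
    by simp
  moreover have "0 \<le> s / 2 * (norm u)\<^sup>2" using s by simp
  ultimately show ?thesis unfolding distrib_left by linarith
qed

text \<open>A finite limes superior makes the integrals eventually finite. From then on they are
  ordinary real integrals, for which differences and polarization make sense.\<close>

lemma eventually_scaled_integral:
  fixes g :: "real \<Rightarrow> 'a \<Rightarrow> real" and F :: "real filter"
  assumes meas: "\<And>e. e > 0 \<Longrightarrow> g e \<in> borel_measurable M" and nn: "\<And>e x. 0 \<le> g e x"
    and pos: "eventually (\<lambda>e. e > 0) F" and d: "d > 0" and b: "b \<ge> 0"
    and up: "Limsup F (\<lambda>e. ennreal e * (\<integral>\<^sup>+x. ennreal (g e x) \<partial>M)) \<le> ennreal b"
  shows "eventually (\<lambda>e. e > 0 \<and> integrable M (g e) \<and> e * integral\<^sup>L M (g e) \<le> b + d \<and>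
    ennreal e * (\<integral>\<^sup>+x. ennreal (g e x) \<partial>M) = ennreal (e * integral\<^sup>L M (g e))) F"
proof -
  have "Limsup F (\<lambda>e. ennreal e * (\<integral>\<^sup>+x. ennreal (g e x) \<partial>M)) < ennreal (b + d)"
    using up d b by (auto intro: le_less_trans simp: ennreal_lessI)
  from Limsup_lessD[OF this] pos show ?thesis
  proof eventually_elim
    case (elim e)
    have "(\<integral>\<^sup>+x. ennreal (g e x) \<partial>M) < \<infinity>"
    proof (rule ccontr)
      assume "\<not> (\<integral>\<^sup>+x. ennreal (g e x) \<partial>M) < \<infinity>"
      then have "(\<integral>\<^sup>+x. ennreal (g e x) \<partial>M) = top" by (simp add: less_top[symmetric])
      then show False using elim by (simp add: ennreal_mult_top)
    qed
    then have int: "integrable M (g e)"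
      using elim nn by (intro integrableI_nonneg meas) auto
    have eq: "ennreal e * (\<integral>\<^sup>+x. ennreal (g e x) \<partial>M) = ennreal (e * integral\<^sup>L M (g e))"
      using nn_integral_eq_integral[OF int] nn elim by (simp add: ennreal_mult integral_nonneg_AE)
    have "e * integral\<^sup>L M (g e) < b + d"
      using elim(1) unfolding eq by (subst (asm) ennreal_less_iff) (use elim nn in \<open>auto intro!: mult_nonneg_nonneg integral_nonneg_AE\<close>)
    then show ?case using int eq elim by simp
  qed
qed

lemma cond_iii_imp_cond_i:
  fixes J :: "'h::{real_inner,complete_space} \<Rightarrow> 'h" and JK :: "'k::{real_inner,complete_space} \<Rightarrow> 'k"
  assumes J: "cstruct J" and E: "lin_op J J D E" and iii: "cond_iii J JK D E"
  shows "cond_i J D E"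
proof -
  obtain DC C \<alpha> \<beta> where JK: "cstruct JK" and spec: "spectrum J D E \<subseteq> {z. Re z \<le> 0}"
    and C: "lin_op J JK DC (C :: 'h \<Rightarrow> 'k)" and DDC: "D \<subseteq> DC"
    and bm: "\<And>\<epsilon> h. \<epsilon> > 0 \<Longrightarrow> bochner_measurable lebesgue (\<lambda>\<xi>. C (resolvent J D E (Complex \<epsilon> \<xi>) h))"
    and ab: "\<alpha> > 0" "\<beta> > 0"
    and up: "\<And>h. Limsup (at_right 0) (\<lambda>\<epsilon>. ennreal \<epsilon> *
                 (\<integral>\<^sup>+ \<xi>. ennreal ((norm (C (resolvent J D E (Complex \<epsilon> \<xi>) h)))\<^sup>2) \<partial>lebesgue))
                 \<le> ennreal (\<beta> * (norm h)\<^sup>2)"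
    and lo: "\<And>h. ennreal (\<alpha> * (norm h)\<^sup>2) \<le> Liminf (at_right 0) (\<lambda>\<epsilon>. ennreal \<epsilon> *
                 (\<integral>\<^sup>+ \<xi>. ennreal ((norm (C (resolvent J D E (Complex \<epsilon> \<xi>) h)))\<^sup>2) \<partial>lebesgue))"
    using iii unfolding cond_iii_def by blast
  have JKin: "\<And>x y. inner (JK x) (JK y) = inner x y"
    and JKJK: "\<And>x. JK (JK x) = - x"
    using J JK by (auto simp: cstruct_def)
  have res: "lam \<in> resolvent_set J D E" if "Re lam > 0" for lam
    using spec that by (auto simp: spectrum_def)
  have Cadd: "\<And>x y. x \<in> D \<Longrightarrow> y \<in> D \<Longrightarrow> C (x + y) = C x + C y"
    and Csc: "\<And>c x. x \<in> D \<Longrightarrow> C (c *\<^sub>R x) = c *\<^sub>R C x" and CJ: "\<And>x. x \<in> D \<Longrightarrow> C (J x) = JK (C x)"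
    using C DDC unfolding lin_op_def by (meson subsetD)+
  have subD: "subspace D" and JD: "\<And>x. x \<in> D \<Longrightarrow> J x \<in> D" using E by (auto simp: lin_op_def csubspace_def)
  have Cdiff: "C (x - y) = C x - C y" if "x \<in> D" "y \<in> D" for x y
    using Cadd[of x "(-1) *\<^sub>R y"] Csc[of y "-1"] that subD by (simp add: subspace_neg)
  define r where "r \<epsilon> \<xi> = resolvent J D E (Complex \<epsilon> \<xi>)" for \<epsilon> \<xi>
  define f where "f \<epsilon> h \<xi> = C (r \<epsilon> \<xi> h)" for \<epsilon> h \<xi>
  note rr = r_def resolvent_in[OF J E res] resolvent_add[OF J E res] resolvent_scaleR[OF J E res]
    resolvent_J[OF J E res]
  have f_add: "f \<epsilon> (x + y) \<xi> = f \<epsilon> x \<xi> + f \<epsilon> y \<xi>" if "\<epsilon> > 0" for \<epsilon> x y \<xi>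
    using that by (simp add: f_def rr Cadd)
  have f_sc: "f \<epsilon> (c *\<^sub>R x) \<xi> = c *\<^sub>R f \<epsilon> x \<xi>" if "\<epsilon> > 0" for \<epsilon> c x \<xi>
    using that by (simp add: f_def rr Csc)
  have f_J: "f \<epsilon> (J x) \<xi> = JK (f \<epsilon> x \<xi>)" if "\<epsilon> > 0" for \<epsilon> x \<xi>
    using that by (simp add: f_def rr CJ)
  have f_diff: "f \<epsilon> (x - y) \<xi> = f \<epsilon> x \<xi> - f \<epsilon> y \<xi>" if "\<epsilon> > 0" for \<epsilon> x y \<xi>
    using f_add[OF that, of x "(-1) *\<^sub>R y"] f_sc[OF that, of "-1" y] by simp
  \<comment> \<open>\<open>E\<close> becomes multiplication by \<epsilon> + i \<xi>, up to a defect
    \<open>C h\<close> that does not depend on \<xi>. Since \<open>C\<close> is applied only to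
    elements of \<open>D\<close>, its linearity suffices.\<close>
  have f_E: "f \<epsilon> (E h) \<xi> = cscale JK (Complex \<epsilon> \<xi>) (f \<epsilon> h \<xi>) - C h" if "\<epsilon> > 0" "h \<in> D" for \<epsilon> h \<xi>
  proof -
    have lam: "Complex \<epsilon> \<xi> \<in> resolvent_set J D E" using that by (intro res) simp
    let ?r = "r \<epsilon> \<xi> h"
    have rD: "?r \<in> D" using resolvent_in[OF J E lam] by (simp add: r_def)
    then have "cscale J (Complex \<epsilon> \<xi>) ?r \<in> D"
      using JD subD by (simp add: cscale_def subspace_add subspace_scale)
    then have "f \<epsilon> (E h) \<xi> = C (cscale J (Complex \<epsilon> \<xi>) ?r) - C h"
      using resolvent_E[OF J E lam that(2)] that(2) by (simp add: f_def r_def Cdiff)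
    also have "C (cscale J (Complex \<epsilon> \<xi>) ?r) = cscale JK (Complex \<epsilon> \<xi>) (C ?r)"
      using rD JD subD by (simp add: cscale_def Cadd Csc CJ subspace_scale)
    finally show ?thesis by (simp add: f_def)
  qed
  have meas: "(\<lambda>\<xi>. (norm (f \<epsilon> h \<xi>))\<^sup>2) \<in> borel_measurable lebesgue" if "\<epsilon> > 0" for \<epsilon> h
    unfolding f_def r_def by (intro borel_measurable_power bochner_measurable_norm bm that)
  \<comment> \<open>Polarization reduces integrability of the mixed products to that of squared
    norms.\<close>
  have pol: "inner (f \<epsilon> x \<xi>) (f \<epsilon> y \<xi>) = ((norm (f \<epsilon> (x + y) \<xi>))\<^sup>2 - (norm (f \<epsilon> (x - y) \<xi>))\<^sup>2) / 4"
    if "\<epsilon> > 0" for \<epsilon> x y \<xi>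
    unfolding f_add[OF that] f_diff[OF that] power2_norm_eq_inner
    by (simp add: inner_add_left inner_add_right inner_diff_left inner_diff_right inner_commute)
  define I where "I \<epsilon> h = integral\<^sup>L lebesgue (\<lambda>\<xi>. (norm (f \<epsilon> h \<xi>))\<^sup>2)" for \<epsilon> h
  have pos: "eventually (\<lambda>\<epsilon>::real. \<epsilon> > 0) (at_right 0)" by (simp add: eventually_at_right_less)
  have fin: "eventually (\<lambda>\<epsilon>. \<epsilon> > 0 \<and> integrable lebesgue (\<lambda>\<xi>. (norm (f \<epsilon> h \<xi>))\<^sup>2) \<and> \<epsilon> * I \<epsilon> h \<le> \<beta> * (norm h)\<^sup>2 + d \<and>
      ennreal \<epsilon> * (\<integral>\<^sup>+\<xi>. ennreal ((norm (f \<epsilon> h \<xi>))\<^sup>2) \<partial>lebesgue) = ennreal (\<epsilon> * I \<epsilon> h)) (at_right 0)"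
    if "d > 0" for h d
    unfolding I_def
    by (rule eventually_scaled_integral[OF meas _ pos that _ up[folded r_def, folded f_def]]) (use ab in auto)
  have I_nn: "0 \<le> I \<epsilon> h" for \<epsilon> h by (simp add: I_def)
  have low: "eventually (\<lambda>\<epsilon>. \<alpha> * (norm h)\<^sup>2 - d \<le> \<epsilon> * I \<epsilon> h) (at_right 0)" if d: "d > 0" for h d
  proof (cases "0 \<le> \<alpha> * (norm h)\<^sup>2 - d")
    case True
    have "ennreal (\<alpha> * (norm h)\<^sup>2 - d) < ennreal (\<alpha> * (norm h)\<^sup>2)"
      using True d by (intro ennreal_lessI) auto
    also note lo[of h, folded r_def, folded f_def]
    finally have "eventually (\<lambda>\<epsilon>. ennreal (\<alpha> * (norm h)\<^sup>2 - d) < ennreal \<epsilon> *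
      (\<integral>\<^sup>+\<xi>. ennreal ((norm (f \<epsilon> h \<xi>))\<^sup>2) \<partial>lebesgue)) (at_right 0)" by (rule less_LiminfD)
    with fin[OF zero_less_one, of h] show ?thesis
    proof eventually_elim
      case (elim \<epsilon>)
      then have "ennreal (\<alpha> * (norm h)\<^sup>2 - d) < ennreal (\<epsilon> * I \<epsilon> h)" by simp
      then show ?case using True by (simp add: ennreal_less_iff)
    qed
  next
    case False
    show ?thesis using pos by eventually_elim (use False I_nn in \<open>smt (verit) mult_nonneg_nonneg\<close>)
  qed
  define B where "B \<epsilon> x y = \<epsilon> * integral\<^sup>L lebesgue (\<lambda>\<xi>. inner (f \<epsilon> x \<xi>) (f \<epsilon> y \<xi>))" for \<epsilon> x y
  have BI: "B \<epsilon> x x = \<epsilon> * I \<epsilon> x" for \<epsilon> x by (simp add: B_def I_def power2_norm_eq_inner)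
  have int: "eventually (\<lambda>\<epsilon>. \<epsilon> > 0 \<and> integrable lebesgue (\<lambda>\<xi>. inner (f \<epsilon> x \<xi>) (f \<epsilon> y \<xi>))) (at_right 0)" for x y
    using fin[OF zero_less_one, of "x + y"] fin[OF zero_less_one, of "x - y"]
  proof eventually_elim
    case (elim \<epsilon>)
    then have "integrable lebesgue (\<lambda>\<xi>. ((norm (f \<epsilon> (x + y) \<xi>))\<^sup>2 - (norm (f \<epsilon> (x - y) \<xi>))\<^sup>2) / 4)"
      by (intro integrable_divide_zero Bochner_Integration.integrable_diff) auto
    then show ?case using elim by (simp add: pol)
  qed
  have "\<exists>G R S. G \<le> at_right 0 \<and> G \<noteq> bot \<and> bounded_clinear_op J J R \<and> bounded_clinear_op J J S \<and>
    R \<circ> S = id \<and> S \<circ> R = id \<and> (\<forall>x y. ((\<lambda>\<epsilon>. B \<epsilon> x y) \<longlongrightarrow> inner (R x) (R y)) G)"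
  proof (rule limit_form_similarity[OF J _ ab(1)])
    show "at_right (0::real) \<noteq> bot" by simp
    show "eventually (\<lambda>\<epsilon>. B \<epsilon> (x + y) z = B \<epsilon> x z + B \<epsilon> y z) (at_right 0)" for x y z
      using int[of x z] int[of y z]
      by eventually_elim (simp add: B_def f_add inner_add_left distrib_left)
    show "eventually (\<lambda>\<epsilon>. B \<epsilon> (r *\<^sub>R x) y = r * B \<epsilon> x y) (at_right 0)" for r x y
      using pos by eventually_elim (simp add: B_def f_sc)
    show "eventually (\<lambda>\<epsilon>. B \<epsilon> x y = B \<epsilon> y x) (at_right 0)" for x y
      by (simp add: B_def inner_commute)
    show "eventually (\<lambda>\<epsilon>. B \<epsilon> (J x) (J y) = B \<epsilon> x y) (at_right 0)" for x y
      using pos by eventually_elim (simp add: B_def f_J JKin)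
    show "eventually (\<lambda>\<epsilon>. \<alpha> * (norm x)\<^sup>2 - d \<le> B \<epsilon> x x) (at_right 0)" if "d > 0" for x d
      unfolding BI by (rule low[OF that])
    show "eventually (\<lambda>\<epsilon>. B \<epsilon> x x \<le> \<beta> * (norm x)\<^sup>2 + d) (at_right 0)" if "d > 0" for x d
      unfolding BI using fin[OF that, of x] by eventually_elim simp
  qed
  then obtain G R S where G: "G \<le> at_right 0" "G \<noteq> bot" and RS: "bounded_clinear_op J J R" "bounded_clinear_op J J S"
    "R \<circ> S = id" "S \<circ> R = id" and lim: "\<And>x y. ((\<lambda>\<epsilon>. B \<epsilon> x y) \<longlongrightarrow> inner (R x) (R y)) G" by blast
  have "((\<lambda>\<epsilon>. B \<epsilon> (E h) h) \<longlongrightarrow> 0) (at_right 0)" if h: "h \<in> D" for h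
  proof (rule Lim_null_comparison)
    define W where "W = integral\<^sup>L lebesgue (\<lambda>x::real. 2 / (1 + x\<^sup>2))"
    define K1 K2 where "K1 = \<beta> * (norm h)\<^sup>2 + 1" and "K2 = \<beta> * (norm (E h))\<^sup>2 + 1"
    define c where "c = (norm (C h))\<^sup>2"
    let ?b = "\<lambda>\<epsilon>. \<epsilon> * K1 + ((\<epsilon>\<^sup>2 + sqrt \<epsilon> / 2) * c * W + sqrt \<epsilon> / 2 * (K1 + K2))"
    have "(?b \<longlongrightarrow> 0 * K1 + ((0\<^sup>2 + sqrt 0 / 2) * c * W + sqrt 0 / 2 * (K1 + K2))) (at_right 0)"
      by (intro tendsto_intros) auto
    then show "(?b \<longlongrightarrow> 0) (at_right 0)" by simp
    show "eventually (\<lambda>\<epsilon>. norm (B \<epsilon> (E h) h) \<le> ?b \<epsilon>) (at_right 0)"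
      using fin[OF zero_less_one, of h] fin[OF zero_less_one, of "E h"] int[of "E h" h]
    proof eventually_elim
      case (elim \<epsilon>)
      then have e: "\<epsilon> > 0" and i1: "integrable lebesgue (\<lambda>\<xi>. (norm (f \<epsilon> h \<xi>))\<^sup>2)"
        and i2: "integrable lebesgue (\<lambda>\<xi>. (norm (f \<epsilon> (E h) \<xi>))\<^sup>2)"
        and i3: "integrable lebesgue (\<lambda>\<xi>. inner (f \<epsilon> (E h) \<xi>) (f \<epsilon> h \<xi>))"
        and k1: "\<epsilon> * I \<epsilon> h \<le> K1" and k2: "\<epsilon> * I \<epsilon> (E h) \<le> K2" by (auto simp: K1_def K2_def)
      \<comment> \<open>The choice balances Young's inequality: after multiplication by \<epsilon>,
        the weight term is of order \<open>\<epsilon> / s\<close> and the energy term of order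
        \<open>s\<close> times the bounded quantities \<open>\<epsilon> * I\<close>. With
        \<open>s = sqrt \<epsilon>\<close> both vanish.\<close>
      define s where "s = sqrt \<epsilon>"
      have s: "s > 0" "s * s = \<epsilon>" using e by (auto simp: s_def)
      have skewK: "inner (JK x) x = 0" for x
        using JKin[of x "JK x"] by (simp add: JKJK inner_commute)
      \<comment> \<open>The imaginary part of \<epsilon> + i \<xi> drops out since \<open>JK\<close>
        is skew, so the unbounded factor \<xi> disappears.\<close>
      have cr: "inner (C h) (f \<epsilon> h \<xi>) = \<epsilon> * (norm (f \<epsilon> h \<xi>))\<^sup>2 - inner (f \<epsilon> (E h) \<xi>) (f \<epsilon> h \<xi>)" for \<xi>
        unfolding f_E[OF e h] by (simp add: cscale_def inner_diff_left inner_add_left skewK power2_norm_eq_inner)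
      have i4: "integrable lebesgue (\<lambda>\<xi>. inner (C h) (f \<epsilon> h \<xi>))"
        unfolding cr by (intro Bochner_Integration.integrable_diff integrable_mult_right i1 i3)
      let ?X = "integral\<^sup>L lebesgue (\<lambda>\<xi>. inner (C h) (f \<epsilon> h \<xi>))"
      have "?X = \<epsilon> * I \<epsilon> h - integral\<^sup>L lebesgue (\<lambda>\<xi>. inner (f \<epsilon> (E h) \<xi>) (f \<epsilon> h \<xi>))"
        unfolding cr I_def using i1 i3 by simp
      then have "integral\<^sup>L lebesgue (\<lambda>\<xi>. inner (f \<epsilon> (E h) \<xi>) (f \<epsilon> h \<xi>)) = \<epsilon> * I \<epsilon> h - ?X" by linarith
      then have B: "B \<epsilon> (E h) h = \<epsilon> * (\<epsilon> * I \<epsilon> h) - \<epsilon> * ?X" by (simp only: B_def right_diff_distrib)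
      have "\<bar>?X\<bar> \<le> integral\<^sup>L lebesgue (\<lambda>\<xi>. (\<epsilon> + 1 / (2 * s)) * c * (2 / (1 + \<xi>\<^sup>2)) +
          s / 2 * ((norm (f \<epsilon> h \<xi>))\<^sup>2 + (norm (f \<epsilon> (E h) \<xi>))\<^sup>2))" (is "_ \<le> integral\<^sup>L _ ?g")
      proof (rule order_trans[OF integral_abs_bound])
        have "integrable lebesgue ?g"
          by (intro Bochner_Integration.integrable_add integrable_mult_right integrable_inverse_square_weight i1 i2)
        then show "(\<integral>\<xi>. \<bar>inner (C h) (f \<epsilon> h \<xi>)\<bar> \<partial>lebesgue) \<le> integral\<^sup>L lebesgue ?g"
          using i4 unfolding c_def
          by (intro integral_mono resolvent_cross_term[OF JK e s(1) f_E[OF e h]]) auto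
      qed
      also have "\<dots> = (\<epsilon> + 1 / (2 * s)) * c * W + s / 2 * (I \<epsilon> h + I \<epsilon> (E h))"
      proof -
        define w where "w x = 2 / (1 + x\<^sup>2)" for x :: real
        have "integrable lebesgue w" unfolding w_def by (rule integrable_inverse_square_weight)
        then show ?thesis unfolding W_def I_def w_def[symmetric] using i1 i2 by simp
      qed
      finally have X: "\<bar>?X\<bar> \<le> (\<epsilon> + 1 / (2 * s)) * c * W + s / 2 * (I \<epsilon> h + I \<epsilon> (E h))" .
      have "\<bar>B \<epsilon> (E h) h\<bar> \<le> \<epsilon> * (\<epsilon> * I \<epsilon> h) + \<epsilon> * \<bar>?X\<bar>"
        unfolding B using e I_nn[of \<epsilon> h] by (simp add: abs_mult order_trans[OF abs_triangle_ineq4])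
      also have "\<dots> \<le> \<epsilon> * K1 + \<epsilon> * ((\<epsilon> + 1 / (2 * s)) * c * W + s / 2 * (I \<epsilon> h + I \<epsilon> (E h)))"
        using e k1 X by (intro add_mono mult_left_mono) auto
      also have "\<dots> = \<epsilon> * K1 + ((\<epsilon>\<^sup>2 + s / 2) * c * W + s / 2 * (\<epsilon> * I \<epsilon> h + \<epsilon> * I \<epsilon> (E h)))"
        using s(1) unfolding s(2)[symmetric] by (simp add: field_simps power2_eq_square)
      also have "\<dots> \<le> ?b \<epsilon>"
        unfolding s_def[symmetric] using s k1 k2 by (intro add_left_mono mult_left_mono add_mono) auto
      finally show ?case by simp
    qed
  qed
  then have skew: "inner (R (E h)) (R h) = 0" if "h \<in> D" for h
    using tendsto_unique[OF G(2) lim[of "E h" h]] tendsto_mono[OF G(1)] that by blast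
  show ?thesis
  proof (rule cond_i_if_skew[OF J E RS skew])
    \<comment> \<open>The range condition is the hypothesis on the spectrum, used at positive real
      points.\<close>
    show "\<exists>x\<in>D. r *\<^sub>R x - E x = y" if "r > 0" for r y
    proof -
      have lam: "Complex r 0 \<in> resolvent_set J D E" using that by (intro res) simp
      show ?thesis using resolvent_in[OF J E lam, of y] resolvent_eq[OF J E lam, of y]
        by (auto simp: cscale_def)
    qed
  qed
qed

section \<open>Averages along the semigroup\<close>

text \<open>Factoring out the smaller of the two times bounds \<open>T t x - T s x\<close> by a
  multiple of \<open>T (t - s) x - x\<close>. Right continuity at 0 thus controls both sides of
  every point.\<close>

lemma c0_semigroup_continuous:
  assumes T: "c0_semigroup J T" and M: "\<And>t x. t \<ge> 0 \<Longrightarrow> norm (T t x) \<le> M * norm x"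
  shows "continuous_on {0..} (\<lambda>t. T t x)"
proof -
  have lin: "bounded_linear (T t)" if "t \<ge> 0" for t
    using T that by (auto simp: c0_semigroup_def bounded_clinear_op_def)
  have add: "T (s + t) y = T s (T t y)" if "s \<ge> 0" "t \<ge> 0" for s t y
    using T that by (auto simp: c0_semigroup_def)
  have lim: "((\<lambda>t. T t x) \<longlongrightarrow> x) (at_right 0)" using T by (auto simp: c0_semigroup_def)
  define K where "K = \<bar>M\<bar> + 1"
  have K: "K > 0" by (simp add: K_def add_nonneg_pos)
  have MK: "norm (T t y) \<le> K * norm y" if "t \<ge> 0" for t y
    by (rule order_trans[OF M[OF that]]) (simp add: K_def mult_right_mono)
  have step: "norm (T t x - T s x) \<le> K * norm (T (t - s) x - x)" if "0 \<le> s" "s \<le> t" for s t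
  proof -
    have "T t x - T s x = T s (T (t - s) x - x)"
      using lin[OF that(1)] add[of s "t - s" x] that by (simp add: linear_simps)
    then show ?thesis using MK[OF that(1)] by metis
  qed
  have "\<exists>d>0. \<forall>t\<in>{0..}. dist t s < d \<longrightarrow> dist (T t x) (T s x) < e" if e: "e > 0" and s: "s \<in> {0..}" for s e :: real
  proof -
    have "eventually (\<lambda>t. dist (T t x) x < e / K) (at_right 0)" using tendstoD[OF lim, of "e / K"] e K by simp
    then obtain d where d: "d > 0" "\<And>t. 0 < t \<Longrightarrow> t < d \<Longrightarrow> norm (T t x - x) < e / K"
      by (auto simp: eventually_at_right_field dist_norm)
    have "dist (T t x) (T s x) < e" if t: "t \<in> {0..}" "dist t s < d" for t
    proof (cases "t = s")
      case False
      define u v where "u = min s t" and "v = max s t"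
      have uv: "0 \<le> u" "u \<le> v" "0 < v - u" "v - u < d" using s t False by (auto simp: u_def v_def dist_real_def)
      have "dist (T t x) (T s x) = norm (T v x - T u x)"
        by (auto simp: u_def v_def dist_norm norm_minus_commute min_def max_def)
      also have "\<dots> \<le> K * norm (T (v - u) x - x)" by (rule step[OF uv(1,2)])
      also have "\<dots> < K * (e / K)" using d(2)[OF uv(3,4)] K by (intro mult_strict_left_mono) auto
      also have "\<dots> = e" using K by simp
      finally show ?thesis .
    qed (use e in simp)
    then show ?thesis using d(1) by blast
  qed
  then show ?thesis unfolding continuous_on_iff by blast
qed

text \<open>Sz.-Nagy's argument: the lower and upper bounds on the orbits make the averaged forms
  uniformly coercive and bounded, and a generalized limit of averages is translation
  invariant.\<close>

lemma semigroup_similar_isometric: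
  fixes J :: "'h::{real_inner,complete_space} \<Rightarrow> 'h"
  assumes J: "cstruct J" and T: "c0_semigroup J T" and a: "a > 0"
    and lo: "\<And>t x. t \<ge> 0 \<Longrightarrow> a * (norm x)\<^sup>2 \<le> (norm (T t x))\<^sup>2"
    and up: "\<And>t x. t \<ge> 0 \<Longrightarrow> (norm (T t x))\<^sup>2 \<le> b * (norm x)\<^sup>2"
  shows "\<exists>R S. bounded_clinear_op J J R \<and> bounded_clinear_op J J S \<and>
        R \<circ> S = id \<and> S \<circ> R = id \<and> (\<forall>t\<ge>0. \<forall>x. norm (R (T t (S x))) = norm x)"
proof -
  have lin: "bounded_linear (T t)" and TJ: "T t (J x) = J (T t x)" if "t \<ge> 0" for t x
    using T that by (auto simp: c0_semigroup_def bounded_clinear_op_def)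
  have Tadd: "T (s + t) y = T s (T t y)" if "s \<ge> 0" "t \<ge> 0" for s t y
    using T that by (auto simp: c0_semigroup_def)
  have Jin: "\<And>x y. inner (J x) (J y) = inner x y" using J by (simp add: cstruct_def)
  have nb: "norm (T t x) \<le> sqrt b * norm x" if "t \<ge> 0" for t x
    using real_sqrt_le_mono[OF up[OF that, of x]] by (simp add: real_sqrt_mult)
  have cont: "continuous_on {0..} (\<lambda>t. T t x)" for x
    by (rule c0_semigroup_continuous[OF T nb])
  define p where "p x y s = inner (T s x) (T s y)" for x y s
  have pc: "continuous_on {0..} (p x y)" for x y unfolding p_def by (intro continuous_on_inner cont)
  have pci: "continuous_on {c..d} (p x y)" if "c \<ge> 0" for c d x y
    by (rule continuous_on_subset[OF pc]) (use that in auto)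
  have pint: "p x y integrable_on {c..d}" if "c \<ge> 0" for c d x y
    by (intro integrable_continuous_interval pci that)
  define B where "B t x y = (1/t) * integral {0..t} (p x y)" for t x y
  have pos: "eventually (\<lambda>t::real. t > 0) at_top" by (rule eventually_gt_at_top)
  have "\<exists>G R S. G \<le> at_top \<and> G \<noteq> bot \<and> bounded_clinear_op J J R \<and> bounded_clinear_op J J S \<and>
    R \<circ> S = id \<and> S \<circ> R = id \<and> (\<forall>x y. ((\<lambda>t. B t x y) \<longlongrightarrow> inner (R x) (R y)) G)"
  proof (rule limit_form_similarity[OF J _ a])
    show "(at_top :: real filter) \<noteq> bot" by simp
    show "eventually (\<lambda>t. B t (x + y) z = B t x z + B t y z) at_top" for x y z
    proof (intro always_eventually allI)
      fix t
      have "integral {0..t} (p (x + y) z) = integral {0..t} (\<lambda>s. p x z s + p y z s)"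
        by (rule integral_cong) (use lin in \<open>auto simp: p_def linear_simps inner_add_left\<close>)
      also have "\<dots> = integral {0..t} (p x z) + integral {0..t} (p y z)"
        by (intro Henstock_Kurzweil_Integration.integral_add pint) auto
      finally show "B t (x + y) z = B t x z + B t y z" by (simp add: B_def distrib_left add_divide_distrib)
    qed
    show "eventually (\<lambda>t. B t (r *\<^sub>R x) y = r * B t x y) at_top" for r x y
    proof (intro always_eventually allI)
      fix t
      have "integral {0..t} (p (r *\<^sub>R x) y) = integral {0..t} (\<lambda>s. r *\<^sub>R p x y s)"
        by (rule integral_cong) (use lin in \<open>auto simp: p_def linear_simps\<close>)
      also have "\<dots> = r *\<^sub>R integral {0..t} (p x y)" by (rule Henstock_Kurzweil_Integration.integral_cmul)
      finally show "B t (r *\<^sub>R x) y = r * B t x y" by (simp add: B_def)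
    qed
    show "eventually (\<lambda>t. B t x y = B t y x) at_top" for x y
    proof -
      have "p x y = p y x" unfolding p_def by (rule ext) (rule inner_commute)
      then show ?thesis by (simp add: B_def)
    qed
    show "eventually (\<lambda>t. B t (J x) (J y) = B t x y) at_top" for x y
    proof (intro always_eventually allI)
      fix t
      have "integral {0..t} (p (J x) (J y)) = integral {0..t} (p x y)"
        by (rule integral_cong) (simp add: p_def TJ Jin)
      then show "B t (J x) (J y) = B t x y" by (simp add: B_def)
    qed
    show "eventually (\<lambda>t. a * (norm x)\<^sup>2 - d \<le> B t x x) at_top" if "d > 0" for x d
      using pos
    proof eventually_elim
      case (elim t)
      have "integral {0..t} (\<lambda>_. a * (norm x)\<^sup>2) \<le> integral {0..t} (p x x)"
        by (intro integral_le pint) (auto simp: p_def lo simp flip: power2_norm_eq_inner)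
      then have "t * (a * (norm x)\<^sup>2) \<le> integral {0..t} (p x x)" using elim by (simp add: mult_ac)
      then have "a * (norm x)\<^sup>2 \<le> B t x x" using elim by (simp add: B_def field_simps)
      then show ?case using that by simp
    qed
    show "eventually (\<lambda>t. B t x x \<le> b * (norm x)\<^sup>2 + d) at_top" if "d > 0" for x d
      using pos
    proof eventually_elim
      case (elim t)
      have "integral {0..t} (p x x) \<le> integral {0..t} (\<lambda>_. b * (norm x)\<^sup>2)"
        by (intro integral_le pint) (auto simp: p_def up simp flip: power2_norm_eq_inner)
      then have "integral {0..t} (p x x) \<le> t * (b * (norm x)\<^sup>2)" using elim by (simp add: mult_ac)
      then have "B t x x \<le> b * (norm x)\<^sup>2" using elim by (simp add: B_def field_simps)
      then show ?case using that by simp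
    qed
  qed
  then obtain G R S where G: "G \<le> at_top" "G \<noteq> bot" and RS: "bounded_clinear_op J J R" "bounded_clinear_op J J S"
    "R \<circ> S = id" "S \<circ> R = id" and lim: "\<And>x y. ((\<lambda>t. B t x y) \<longlongrightarrow> inner (R x) (R y)) G" by blast
  have inv: "norm (R (T u x)) = norm (R x)" if u: "u \<ge> 0" for u x
  proof -
    have "((\<lambda>t. B t (T u x) (T u x) - B t x x) \<longlongrightarrow> 0) at_top"
    proof (rule Lim_null_comparison)
      let ?M = "b * (norm x)\<^sup>2"
      have pb: "norm (p x x s) \<le> ?M" if "s \<ge> 0" for s
        using up[OF that, of x] by (simp add: p_def flip: power2_norm_eq_inner)
      show "((\<lambda>t. (2 * u * ?M) / t) \<longlongrightarrow> 0) at_top"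
        by (intro tendsto_divide_0[OF tendsto_const] filterlim_at_top_imp_at_infinity filterlim_ident)
      show "eventually (\<lambda>t. norm (B t (T u x) (T u x) - B t x x) \<le> (2 * u * ?M) / t) at_top"
        using pos
      proof eventually_elim
        case (elim t)
        have "integral {0..t} (p (T u x) (T u x)) = integral {0..t} (p x x \<circ> (+) u)"
          by (rule integral_cong) (use Tadd u in \<open>auto simp: p_def add.commute[of u]\<close>)
        also have "\<dots> = integral {0 + u..t + u} (p x x)"
          by (rule integral_shift_Icc_real)
        finally have 1: "integral {0..t} (p (T u x) (T u x)) = integral {u..t + u} (p x x)" by simp
        \<comment> \<open>Shifting by \<open>u\<close> changes the integral only by two end pieces
          of length \<open>u\<close>. Each is at most \<open>u * ?M\<close> whatever
          \<open>t\<close> is, so the change vanishes after division by \<open>t\<close>.\<close>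
        have 2: "integral {0..u} (p x x) + integral {u..t + u} (p x x) = integral {0..t + u} (p x x)"
          using elim u by (intro Henstock_Kurzweil_Integration.integral_combine pint) auto
        have 3: "integral {0..t} (p x x) + integral {t..t + u} (p x x) = integral {0..t + u} (p x x)"
          using elim u by (intro Henstock_Kurzweil_Integration.integral_combine pint) auto
        have 4: "norm (integral {0..u} (p x x)) \<le> ?M * (u - 0)"
          using u by (intro integral_bound pci) (use pb in auto)
        have 5: "norm (integral {t..t + u} (p x x)) \<le> ?M * (t + u - t)"
          using u elim by (intro integral_bound pci) (use pb in auto)
        have "B t (T u x) (T u x) - B t x x = (1/t) * (integral {t..t + u} (p x x) - integral {0..u} (p x x))"
        proof -
          have "integral {u..t + u} (p x x) - integral {0..t} (p x x) = integral {t..t + u} (p x x) - integral {0..u} (p x x)"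
            using 2 3 by linarith
          then show ?thesis by (simp only: B_def 1 right_diff_distrib[symmetric])
        qed
        also have "norm \<dots> = (1/t) * \<bar>integral {t..t + u} (p x x) - integral {0..u} (p x x)\<bar>"
          using elim by (simp add: abs_mult)
        also have "\<dots> \<le> (1/t) * (2 * u * ?M)"
          using abs_triangle_ineq4[of "integral {t..t + u} (p x x)" "integral {0..u} (p x x)"] 4 5 elim
          by (intro mult_left_mono) (simp_all add: mult_ac)
        finally show ?case by simp
      qed
    qed
    then have "((\<lambda>t. B t (T u x) (T u x) - B t x x) \<longlongrightarrow> 0) G" by (rule tendsto_mono[OF G(1)])
    moreover have "((\<lambda>t. B t (T u x) (T u x) - B t x x) \<longlongrightarrow> inner (R (T u x)) (R (T u x)) - inner (R x) (R x)) G"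
      by (intro tendsto_diff lim)
    ultimately have "inner (R (T u x)) (R (T u x)) - inner (R x) (R x) = 0"
      using tendsto_unique[OF G(2)] by blast
    then show ?thesis by (simp add: norm_eq_sqrt_inner)
  qed
  have "norm (R (T t (S x))) = norm x" if "t \<ge> 0" for t x
    unfolding inv[OF that] using RS(3) by (metis comp_apply id_apply)
  then show ?thesis using RS by blast
qed

section \<open>Translation invariance and Bochner measurability of continuous functions\<close>

lemma nn_integral_lebesgue_shift:
  assumes "f \<in> borel_measurable lebesgue"
  shows "(\<integral>\<^sup>+x. f (x + c) \<partial>lebesgue) = (\<integral>\<^sup>+x. f (x::real) \<partial>lebesgue)"
proof -
  have eq: "lebesgue = density (distr lebesgue lebesgue (\<lambda>x::real. c + 1 * x)) (\<lambda>_. ennreal \<bar>1\<bar>)"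
    by (rule lebesgue_real_affine) simp
  have m: "(\<lambda>x. c + 1 * x) \<in> lebesgue \<rightarrow>\<^sub>M lebesgue"
    using lebesgue_affine_measurable[where c="\<lambda>x::real. 1" and t=c] by simp
  have "(\<integral>\<^sup>+x. f x \<partial>lebesgue) = (\<integral>\<^sup>+x. f x \<partial>(distr lebesgue lebesgue (\<lambda>x::real. c + 1 * x)))"
    by (subst (1) eq) (simp add: nn_integral_density assms)
  also have "\<dots> = (\<integral>\<^sup>+x. f (c + 1 * x) \<partial>lebesgue)" by (subst nn_integral_distr[OF m]) (simp_all add: assms)
  finally show ?thesis by (simp add: add.commute)
qed

text \<open>The argument is discretized instead of the value: \<open>\<phi> n\<close> clamps to
  \<open>[-n, n]\<close> and rounds down to a multiple of \<open>1 / 2 ^ n\<close>. It has finitely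
  many values, hence so has \<open>g\<close> after \<open>\<phi> n\<close>, and continuity gives
  pointwise convergence. The premise on \<open>M\<close> covers Lebesgue measure as well as its
  restriction to the half-line.\<close>

lemma bochner_measurable_continuous:
  fixes g :: "real \<Rightarrow> 'b::real_normed_vector"
  assumes g: "continuous_on UNIV g" and M: "\<And>f :: real \<Rightarrow> real. f \<in> borel_measurable borel \<Longrightarrow> f \<in> borel_measurable M"
  shows "bochner_measurable M g"
proof -
  define \<phi> where "\<phi> n x = real_of_int \<lfloor>max (- real n) (min (real n) x) * 2 ^ n\<rfloor> / 2 ^ n" for n :: nat and x :: real
  have "simple_function M (\<phi> n)" for n
  proof (rule simple_function_borel_measurable)
    show "\<phi> n \<in> borel_measurable M" unfolding \<phi>_def by (intro M) measurable
    have "\<phi> n x \<in> (\<lambda>k. real_of_int k / 2 ^ n) ` {- int n * 2 ^ n..int n * 2 ^ n}" for x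
    proof -
      define m where "m = max (- real n) (min (real n) x)"
      have "- real n \<le> m" "m \<le> real n" by (auto simp: m_def)
      then have "- real n * 2 ^ n \<le> m * 2 ^ n" "m * 2 ^ n \<le> real n * 2 ^ n"
        by (intro mult_right_mono; simp)+
      moreover have "real_of_int (- int n * 2 ^ n) = - real n * 2 ^ n" "real_of_int (int n * 2 ^ n) = real n * 2 ^ n"
        by simp_all
      ultimately have "real_of_int (- int n * 2 ^ n) \<le> m * 2 ^ n" "m * 2 ^ n < real_of_int (int n * 2 ^ n) + 1"
        by linarith+
      then have "\<lfloor>m * 2 ^ n\<rfloor> \<in> {- int n * 2 ^ n..int n * 2 ^ n}"
        by (simp only: atLeastAtMost_iff le_floor_iff floor_le_iff)
      then show ?thesis unfolding \<phi>_def m_def by blast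
    qed
    then have "\<phi> n ` space M \<subseteq> (\<lambda>k. real_of_int k / 2 ^ n) ` {- int n * 2 ^ n..int n * 2 ^ n}"
      by (rule image_subsetI)
    then show "finite (\<phi> n ` space M)" by (rule finite_subset) simp
  qed
  then have "simple_function M (\<lambda>x. g (\<phi> n x))" for n by (rule simple_function_compose1)
  moreover have "(\<lambda>n. g (\<phi> n x)) \<longlonglongrightarrow> g x" for x
  proof -
    have "(\<lambda>n. \<phi> n x) \<longlonglongrightarrow> x"
    proof (rule tendsto_sandwich)
      obtain N :: nat where N: "\<bar>x\<bar> \<le> real N" using real_arch_simple by blast
      have b: "x - (1/2) ^ n \<le> \<phi> n x \<and> \<phi> n x \<le> x" if "n \<ge> N" for n
      proof -
        have "\<bar>x\<bar> \<le> real n" using N that by linarith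
        then have e: "max (- real n) (min (real n) x) = x" by auto
        have "x * 2 ^ n - 1 \<le> real_of_int \<lfloor>x * 2 ^ n\<rfloor>" "real_of_int \<lfloor>x * 2 ^ n\<rfloor> \<le> x * 2 ^ n" by linarith+
        then have "(x * 2 ^ n - 1) / 2 ^ n \<le> \<phi> n x" "\<phi> n x \<le> (x * 2 ^ n) / 2 ^ n"
          unfolding \<phi>_def e by (intro divide_right_mono; simp)+
        then show ?thesis by (simp add: diff_divide_distrib power_one_over)
      qed
      show "eventually (\<lambda>n. x - (1/2) ^ n \<le> \<phi> n x) sequentially" "eventually (\<lambda>n. \<phi> n x \<le> x) sequentially"
        using b unfolding eventually_sequentially by blast+
      have "(\<lambda>n. x - (1/2::real) ^ n) \<longlonglongrightarrow> x - 0" by (intro tendsto_intros LIMSEQ_power_zero) simp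
      then show "(\<lambda>n. x - (1/2) ^ n) \<longlonglongrightarrow> x" by simp
    qed simp
    then show ?thesis by (rule continuous_on_tendsto_compose[OF g]) auto
  qed
  ultimately show ?thesis unfolding bochner_measurable_def by (intro exI[of _ "\<lambda>n x. g (\<phi> n x)"]) auto
qed

lemma bochner_measurable_cong:
  assumes "bochner_measurable M f" "\<And>x. x \<in> space M \<Longrightarrow> f x = g x"
  shows "bochner_measurable M g"
proof -
  obtain s where s: "\<And>i::nat. simple_function M (s i)" "AE x in M. (\<lambda>i. s i x) \<longlonglongrightarrow> f x"
    using assms(1) by (auto simp: bochner_measurable_def)
  have "AE x in M. (\<lambda>i. s i x) \<longlonglongrightarrow> g x"
    using s(2) AE_space by eventually_elim (simp add: assms(2))
  then show ?thesis using s(1) unfolding bochner_measurable_def by blast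
qed

lemma similarity_bounds:
  assumes "bounded_clinear_op J J R" "bounded_clinear_op J J S" "S \<circ> R = id"
  obtains K where "K > 0" "\<And>x. norm (R x) \<le> K * norm x" "\<And>x. norm (S x) \<le> K * norm x" "\<And>x. norm x \<le> K * norm (R x)"
proof -
  obtain K1 where K1: "K1 > 0" "\<And>x. norm (R x) \<le> norm x * K1"
    using assms(1) bounded_linear.pos_bounded unfolding bounded_clinear_op_def by blast
  obtain K2 where K2: "K2 > 0" "\<And>x. norm (S x) \<le> norm x * K2"
    using assms(2) bounded_linear.pos_bounded unfolding bounded_clinear_op_def by blast
  define K where "K = max K1 K2"
  have K: "norm x * K1 \<le> K * norm x" "norm y * K2 \<le> K * norm y" for x y
    by (simp_all add: K_def mult.commute[of "norm _"] mult_right_mono)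
  have S: "norm (S x) \<le> K * norm x" for x using K2(2)[of x] K(2)[of x] by linarith
  have R: "norm (R x) \<le> K * norm x" for x using K1(2)[of x] K(1)[of x] by linarith
  have "norm x \<le> K * norm (R x)" for x using S[of "R x"] assms(3) by (metis comp_apply id_apply)
  then show ?thesis using that[of K] S R K1(1) by (auto simp: K_def)
qed

text \<open>With \<open>C = R\<close> the integrand is the constant
  \<open>(norm (R h))\<^sup>2\<close>, so every average over a positive time equals it.\<close>

lemma cond_i_imp_cond_ii:
  fixes J :: "'h::{real_inner,complete_space} \<Rightarrow> 'h"
  assumes J: "cstruct J" and i: "cond_i J D E"
  shows "cond_ii J J D E"
proof -
  obtain T R S where T: "generates J D E T" and R: "bounded_clinear_op J J R" and S: "bounded_clinear_op J J S"
    and SR: "S \<circ> R = id" and iso: "\<And>t x. t \<ge> 0 \<Longrightarrow> norm (R (T t (S x))) = norm x"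
    using i unfolding cond_i_def by blast
  obtain K where K: "K > 0" "\<And>x. norm (R x) \<le> K * norm x" "\<And>x. norm (S x) \<le> K * norm x" "\<And>x. norm x \<le> K * norm (R x)"
    using similarity_bounds[OF R S SR] by blast
  have RT: "norm (R (T t x)) = norm (R x)" if "t \<ge> 0" for t x
    using iso[OF that, of "R x"] SR by (metis comp_apply id_apply)
  interpret R: bounded_linear R using R by (simp add: bounded_clinear_op_def)
  have c0: "c0_semigroup J T" using T by (simp add: generates_def)
  have "norm (T t x) \<le> (K * K) * norm x" if "t \<ge> 0" for t x
  proof -
    have "norm (T t x) \<le> K * norm (R x)" using K(4)[of "T t x"] RT[OF that, of x] by simp
    also have "\<dots> \<le> K * (K * norm x)" using K(1) by (intro mult_left_mono K) simp
    finally show ?thesis by (simp only: mult.assoc)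
  qed
  then have cont: "continuous_on {0..} (\<lambda>t. T t x)" for x by (rule c0_semigroup_continuous[OF c0])
  have avg: "eventually (\<lambda>t. ennreal (1 / t) *
                  set_nn_integral lebesgue {0..t} (\<lambda>s. ennreal ((norm (R (T s h)))\<^sup>2)) = ennreal ((norm (R h))\<^sup>2)) at_top" for h
    using eventually_gt_at_top[of 0]
  proof eventually_elim
    case (elim t)
    have "set_nn_integral lebesgue {0..t} (\<lambda>s. ennreal ((norm (R (T s h)))\<^sup>2)) = set_nn_integral lebesgue {0..t} (\<lambda>s. ennreal ((norm (R h))\<^sup>2))"
      by (intro nn_integral_cong) (auto simp: RT indicator_def)
    also have "\<dots> = ennreal ((norm (R h))\<^sup>2) * ennreal t" using elim by (simp add: nn_integral_cmult_indicator)
    finally show ?case using elim by (simp add: mult.left_commute flip: ennreal_mult)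
  qed
  have lim: "Limsup at_top (\<lambda>t. ennreal (1 / t) *
                  set_nn_integral lebesgue {0..t} (\<lambda>s. ennreal ((norm (R (T s h)))\<^sup>2))) = ennreal ((norm (R h))\<^sup>2)" for h
    using Limsup_eq[OF avg] by (simp add: Limsup_const)
  have "ennreal (1 / K\<^sup>2 * (norm h)\<^sup>2) \<le> ennreal ((norm (R h))\<^sup>2)" for h
  proof (intro ennreal_leI)
    have "(norm h)\<^sup>2 \<le> (K * norm (R h))\<^sup>2" by (intro power_mono K) simp
    then show "1 / K\<^sup>2 * (norm h)\<^sup>2 \<le> (norm (R h))\<^sup>2" using K(1) by (simp add: field_simps power_mult_distrib)
  qed
  moreover have "ennreal ((norm (R h))\<^sup>2) \<le> ennreal (K\<^sup>2 * (norm h)\<^sup>2)" for h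
    unfolding power_mult_distrib[symmetric] by (intro ennreal_leI power_mono K) simp
  ultimately have "\<exists>\<alpha> \<beta>::real. \<alpha> > 0 \<and> \<beta> > 0 \<and>
          (\<forall>h\<in>UNIV.
              ennreal (\<alpha> * (norm h)\<^sup>2) \<le> Limsup at_top (\<lambda>t. ennreal (1 / t) *
                  set_nn_integral lebesgue {0..t} (\<lambda>s. ennreal ((norm (R (T s h)))\<^sup>2))) \<and>
              Limsup at_top (\<lambda>t. ennreal (1 / t) *
                  set_nn_integral lebesgue {0..t} (\<lambda>s. ennreal ((norm (R (T s h)))\<^sup>2)))
                \<le> ennreal (\<beta> * (norm h)\<^sup>2))"
    using K(1) by (intro exI[of _ "1 / K\<^sup>2"] exI[of _ "K\<^sup>2"]) (simp add: lim)
  moreover have "lin_op J J UNIV R"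
    using R by (simp add: lin_op_def csubspace_def R.add R.scaleR bounded_clinear_op_def)
  moreover have "bochner_measurable (lebesgue_on {0..}) (\<lambda>t. R (T t h))" for h
  proof (rule bochner_measurable_cong)
    \<comment> \<open>Nothing is known about \<open>T\<close> at negative times;
      \<open>max 0 t\<close> extends the orbit continuously to the whole line.\<close>
    show "bochner_measurable (lebesgue_on {0..}) (\<lambda>t. R (T (max 0 t) h))"
    proof (rule bochner_measurable_continuous)
      show "continuous_on UNIV (\<lambda>t. R (T (max 0 t) h))"
        by (intro R.continuous_on continuous_on_compose2[OF cont]) (auto intro!: continuous_intros)
      show "f \<in> borel_measurable (lebesgue_on {0..})" if "f \<in> borel_measurable borel" for f :: "real \<Rightarrow> real"
        by (intro measurable_restrict_space1 measurable_completion) (simp add: that)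
    qed
  qed auto
  ultimately show ?thesis
    unfolding cond_ii_def using J T by (intro conjI exI[of _ T] exI[of _ UNIV] exI[of _ R]) auto
qed

section \<open>From bounded averages to two-sided bounds on the semigroup\<close>

lemma average_shift:
  fixes \<phi> :: "real \<Rightarrow> ennreal"
  assumes m: "(\<lambda>s. if 0 \<le> s then \<phi> s else 0) \<in> borel_measurable lebesgue" and u: "0 \<le> u" and t: "0 < t"
  defines "I \<equiv> \<lambda>a b. set_nn_integral lebesgue {a..b} \<phi>"
  shows "set_nn_integral lebesgue {0..t} (\<lambda>s. \<phi> (s + u)) \<le> I 0 (t + u)"
    and "I 0 (t + u) \<le> I 0 u + set_nn_integral lebesgue {0..t} (\<lambda>s. \<phi> (s + u))"
proof -
  define \<psi> where "\<psi> s = (if 0 \<le> s then \<phi> s else 0)" for s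
  have [measurable]: "\<psi> \<in> borel_measurable lebesgue" using m by (simp add: \<psi>_def[abs_def])
  have ind: "(\<lambda>s. \<psi> s * indicator {a..b} s) \<in> borel_measurable lebesgue" for a b
    by (intro borel_measurable_times_ennreal borel_measurable_indicator) auto
  have I: "I a b = (\<integral>\<^sup>+s. \<psi> s * indicator {a..b} s \<partial>lebesgue)" if "0 \<le> a" for a b
    unfolding I_def using that by (intro nn_integral_cong) (auto simp: \<psi>_def indicator_def)
  have "set_nn_integral lebesgue {0..t} (\<lambda>s. \<phi> (s + u)) = (\<integral>\<^sup>+s. (\<psi> (s + u) * indicator {u..t + u} (s + u)) \<partial>lebesgue)"
    using u by (intro nn_integral_cong) (auto simp: \<psi>_def indicator_def)
  also have "\<dots> = (\<integral>\<^sup>+s. \<psi> s * indicator {u..t + u} s \<partial>lebesgue)"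
    by (rule nn_integral_lebesgue_shift[OF ind])
  finally have sh: "set_nn_integral lebesgue {0..t} (\<lambda>s. \<phi> (s + u)) = (\<integral>\<^sup>+s. \<psi> s * indicator {u..t + u} s \<partial>lebesgue)" .
  show "set_nn_integral lebesgue {0..t} (\<lambda>s. \<phi> (s + u)) \<le> I 0 (t + u)"
    unfolding sh I[OF order_refl] using u by (intro nn_integral_mono) (auto simp: indicator_def)
  \<comment> \<open>The intervals share the point \<open>u\<close>, and \<open>t + u\<close> may be
    compared with both; an inequality is all that is required.\<close>
  have "I 0 (t + u) \<le> (\<integral>\<^sup>+s. \<psi> s * indicator {0..u} s + \<psi> s * indicator {u..t + u} s \<partial>lebesgue)"
    unfolding I[OF order_refl] by (intro nn_integral_mono) (auto simp: indicator_def)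
  also have "\<dots> = I 0 u + (\<integral>\<^sup>+s. \<psi> s * indicator {u..t + u} s \<partial>lebesgue)"
    unfolding I[OF order_refl] by (rule nn_integral_add[OF ind ind])
  finally show "I 0 (t + u) \<le> I 0 u + set_nn_integral lebesgue {0..t} (\<lambda>s. \<phi> (s + u))" by (simp only: sh)
qed

lemma eventually_shift_at_top:
  fixes u :: real
  shows "eventually (\<lambda>t. P (t + u)) at_top \<longleftrightarrow> eventually P at_top"
proof
  assume "eventually (\<lambda>t. P (t + u)) at_top"
  then obtain N where "\<And>t. t \<ge> N \<Longrightarrow> P (t + u)" by (auto simp: eventually_at_top_linorder)
  then have "P t" if "t \<ge> N + u" for t using that by (metis diff_add_cancel le_diff_eq)
  then show "eventually P at_top" by (auto simp: eventually_at_top_linorder)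
next
  assume "eventually P at_top"
  then obtain N where "\<And>t. t \<ge> N \<Longrightarrow> P t" by (auto simp: eventually_at_top_linorder)
  then have "P (t + u)" if "t \<ge> N - u" for t using that by (simp add: le_diff_eq diff_le_eq)
  then show "eventually (\<lambda>t. P (t + u)) at_top" by (auto simp: eventually_at_top_linorder)
qed

text \<open>\<open>L\<close> is the limes superior or inferior at infinity, and \<open>Q\<close> the matching quantifier
  ``eventually'' or ``frequently''. The growth function \<open>L\<close> is invariant under the semigroup;
  invariance up to constant factors is all that is needed here.\<close>

lemma average_bounds:
  fixes \<phi> :: "real \<Rightarrow> ennreal" and L :: "(real \<Rightarrow> ennreal) \<Rightarrow> ennreal" and Q :: "(real \<Rightarrow> bool) \<Rightarrow> bool"
  assumes m: "(\<lambda>s. if 0 \<le> s then \<phi> s else 0) \<in> borel_measurable lebesgue" and u: "0 \<le> u"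
    and LQ: "\<And>f X. L f < X \<Longrightarrow> Q (\<lambda>t. f t < X)" and QL: "\<And>f X. Q (\<lambda>t. f t \<le> X) \<Longrightarrow> L f \<le> X"
    and Qmono: "\<And>P P'. Q P \<Longrightarrow> eventually (\<lambda>t. P t \<longrightarrow> P' t) at_top \<Longrightarrow> Q P'"
    and Qshift: "\<And>P. Q (\<lambda>t. P (t + u)) \<longleftrightarrow> Q P" and Qtriv: "\<not> Q (\<lambda>_. False)"
  defines "G \<equiv> \<lambda>t. ennreal (1 / t) * set_nn_integral lebesgue {0..t} \<phi>"
    and "G' \<equiv> \<lambda>t. ennreal (1 / t) * set_nn_integral lebesgue {0..t} (\<lambda>s. \<phi> (s + u))"
  shows "L G < X \<Longrightarrow> L G' \<le> 2 * X"
    and "L G < top \<Longrightarrow> 0 < d \<Longrightarrow> L G' < X \<Longrightarrow> L G \<le> ennreal d + X"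
proof -
  assume "L G < X"
  then have "Q (\<lambda>t. G (t + u) < X)" using LQ Qshift[of "\<lambda>t. G t < X"] by simp
  moreover have "eventually (\<lambda>t. G (t + u) < X \<longrightarrow> G' t \<le> 2 * X) at_top"
    using eventually_gt_at_top[of u] eventually_gt_at_top[of 0]
  proof eventually_elim
    case (elim t)
    have "G' t \<le> ennreal (1/t) * set_nn_integral lebesgue {0..t + u} \<phi>"
      unfolding G'_def using average_shift(1)[OF m u elim(2)] by (intro mult_left_mono) auto
    \<comment> \<open>The factor 2 comes from \<open>1 / t \<le> 2 / (t + u)\<close> for
      \<open>t > u\<close>, and later reappears in the growth bound of the semigroup.\<close>
    also have "\<dots> \<le> ennreal (2 * (1 / (t + u))) * set_nn_integral lebesgue {0..t + u} \<phi>"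
      using elim u by (intro mult_right_mono ennreal_leI) (auto simp: field_simps)
    also have "ennreal (2 * (1 / (t + u))) = 2 * ennreal (1 / (t + u))"
      using elim u by (subst ennreal_mult) auto
    also have "2 * ennreal (1 / (t + u)) * set_nn_integral lebesgue {0..t + u} \<phi> = 2 * G (t + u)"
      by (simp only: G_def mult.assoc)
    finally show ?case using mult_left_mono[of "G (t + u)" X 2] by (auto dest: less_imp_le)
  qed
  ultimately have "Q (\<lambda>t. G' t \<le> 2 * X)" by (rule Qmono)
  then show "L G' \<le> 2 * X" by (rule QL)
next
  assume fin: "L G < top" and d: "0 < d" and X: "L G' < X"
  \<comment> \<open>An infinite integral over the initial piece would make all later averages
    infinite, contradicting \<open>L G < top\<close>.\<close>
  have F: "set_nn_integral lebesgue {0..u} \<phi> < top"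
  proof (rule ccontr)
    assume "\<not> ?thesis"
    then have top: "set_nn_integral lebesgue {0..u} \<phi> = top" by (simp add: less_top[symmetric])
    have "eventually (\<lambda>t. G t < top \<longrightarrow> False) at_top"
      using eventually_gt_at_top[of u] eventually_gt_at_top[of 0]
    proof eventually_elim
      case (elim t)
      have "set_nn_integral lebesgue {0..u} \<phi> \<le> set_nn_integral lebesgue {0..t} \<phi>"
        using elim by (intro nn_integral_mono) (auto simp: indicator_def)
      then have "set_nn_integral lebesgue {0..t} \<phi> = top" using top by (simp add: top_unique)
      then show ?case using elim by (simp add: G_def ennreal_mult_top)
    qed
    from Qmono[OF LQ[OF fin] this] show False using Qtriv by simp
  qed
  define c where "c = enn2real (set_nn_integral lebesgue {0..u} \<phi>)"
  have c: "set_nn_integral lebesgue {0..u} \<phi> = ennreal c" "0 \<le> c" using F by (simp_all add: c_def)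
  have "Q (\<lambda>t. G' t < X)" by (rule LQ[OF X])
  moreover have "eventually (\<lambda>t. G' t < X \<longrightarrow> G (t + u) \<le> ennreal d + X) at_top"
    \<comment> \<open>Beyond this time the initial piece contributes at most \<open>d\<close> to the
      average.\<close>
    using eventually_gt_at_top[of "c / d"] eventually_gt_at_top[of 0]
  proof eventually_elim
    case (elim t)
    have "G (t + u) \<le> ennreal (1/t) * set_nn_integral lebesgue {0..t + u} \<phi>"
      unfolding G_def using elim u by (intro mult_right_mono ennreal_leI) (auto simp: field_simps)
    also have "\<dots> \<le> ennreal (1/t) * (ennreal c + set_nn_integral lebesgue {0..t} (\<lambda>s. \<phi> (s + u)))"
      using average_shift(2)[OF m u elim(2)] by (intro mult_left_mono) (auto simp: c)
    also have "\<dots> = ennreal (c / t) + G' t"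
      using elim c by (simp add: G'_def distrib_left flip: ennreal_mult)
    finally have 1: "G (t + u) \<le> ennreal (c / t) + G' t" .
    have 2: "ennreal (c / t) \<le> ennreal d" using elim d by (intro ennreal_leI) (simp add: field_simps)
    show ?case
    proof
      assume "G' t < X"
      then have "ennreal (c / t) + G' t \<le> ennreal d + X" by (intro add_mono 2 less_imp_le)
      with 1 show "G (t + u) \<le> ennreal d + X" by (rule order_trans)
    qed
  qed
  ultimately have "Q (\<lambda>t. G (t + u) \<le> ennreal d + X)" by (rule Qmono)
  then have "Q (\<lambda>t. G t \<le> ennreal d + X)" using Qshift[of "\<lambda>t. G t \<le> ennreal d + X"] by simp
  then show "L G \<le> ennreal d + X" by (rule QL)
qed

text \<open>For \<open>h\<close> in \<open>DC\<close> the averages of \<open>h\<close> and of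
  \<open>T u h\<close> have the same growth up to a factor 2. Since \<open>L\<close> of them is
  comparable to the squared norm of the starting vector, \<open>T u\<close> is bounded above and
  below uniformly in \<open>u\<close>, with constants \<open>2 * \<beta> / \<alpha>\<close> and
  \<open>\<alpha> / \<beta>\<close>.\<close>

lemma cond_ii_imp_cond_i:
  fixes J :: "'h::{real_inner,complete_space} \<Rightarrow> 'h" and JK :: "'k::{real_inner,complete_space} \<Rightarrow> 'k"
  assumes J: "cstruct J" and ii: "cond_ii J JK D E"
  shows "cond_i J D E"
proof -
  obtain T DC C \<alpha> \<beta> where T: "generates J D E T" and dense: "closure DC = UNIV"
    and TDC: "\<forall>t\<ge>0. T t ` DC \<subseteq> DC"
    and bm: "\<forall>h\<in>DC. bochner_measurable (lebesgue_on {0..}) (\<lambda>t. (C :: 'h \<Rightarrow> 'k) (T t h))"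
    and ab: "\<alpha> > 0" "\<beta> > 0"
    and alt: "(\<forall>h\<in>DC.
              ennreal (\<alpha> * (norm h)\<^sup>2) \<le> Limsup at_top (\<lambda>t. ennreal (1 / t) *
                  set_nn_integral lebesgue {0..t} (\<lambda>s. ennreal ((norm (C (T s h)))\<^sup>2))) \<and>
              Limsup at_top (\<lambda>t. ennreal (1 / t) *
                  set_nn_integral lebesgue {0..t} (\<lambda>s. ennreal ((norm (C (T s h)))\<^sup>2)))
                \<le> ennreal (\<beta> * (norm h)\<^sup>2))
           \<or>
           (\<forall>h\<in>DC.
              ennreal (\<alpha> * (norm h)\<^sup>2) \<le> Liminf at_top (\<lambda>t. ennreal (1 / t) *
                  set_nn_integral lebesgue {0..t} (\<lambda>s. ennreal ((norm (C (T s h)))\<^sup>2))) \<and>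
              Liminf at_top (\<lambda>t. ennreal (1 / t) *
                  set_nn_integral lebesgue {0..t} (\<lambda>s. ennreal ((norm (C (T s h)))\<^sup>2)))
                \<le> ennreal (\<beta> * (norm h)\<^sup>2))"
    using ii unfolding cond_ii_def by (elim exE conjE) (rule that; assumption)
  define G where "G h = (\<lambda>t. ennreal (1 / t) * set_nn_integral lebesgue {0..t} (\<lambda>s. ennreal ((norm (C (T s h)))\<^sup>2)))" for h
  have alt': "(\<forall>h\<in>DC. ennreal (\<alpha> * (norm h)\<^sup>2) \<le> Limsup at_top (G h) \<and> Limsup at_top (G h) \<le> ennreal (\<beta> * (norm h)\<^sup>2)) \<or>
      (\<forall>h\<in>DC. ennreal (\<alpha> * (norm h)\<^sup>2) \<le> Liminf at_top (G h) \<and> Liminf at_top (G h) \<le> ennreal (\<beta> * (norm h)\<^sup>2))"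
    using alt unfolding G_def .
  \<comment> \<open>Both alternatives of (ii) are treated at once by abstracting the limit operation
    together with the quantifier that characterizes it.\<close>
  obtain L :: "(real \<Rightarrow> ennreal) \<Rightarrow> ennreal" and Q :: "(real \<Rightarrow> bool) \<Rightarrow> bool"
    where lu: "\<forall>h\<in>DC. ennreal (\<alpha> * (norm h)\<^sup>2) \<le> L (G h) \<and> L (G h) \<le> ennreal (\<beta> * (norm h)\<^sup>2)"
    and LQ: "\<And>f X. L f < X \<Longrightarrow> Q (\<lambda>t. f t < X)" and QL: "\<And>f X. Q (\<lambda>t. f t \<le> X) \<Longrightarrow> L f \<le> X"
    and Qm: "\<And>P P'. Q P \<Longrightarrow> eventually (\<lambda>t. P t \<longrightarrow> P' t) at_top \<Longrightarrow> Q P'"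
    and Qs: "\<And>P u. Q (\<lambda>t. P (t + u)) \<longleftrightarrow> Q P" and Qt: "\<not> Q (\<lambda>_. False)"
    using alt'
  proof
    assume a: "\<forall>h\<in>DC. ennreal (\<alpha> * (norm h)\<^sup>2) \<le> Limsup at_top (G h) \<and> Limsup at_top (G h) \<le> ennreal (\<beta> * (norm h)\<^sup>2)"
    show thesis
    proof (rule that[of "Limsup at_top" "\<lambda>P. eventually P at_top", OF a])
      show "eventually (\<lambda>t. f t < X) at_top" if "Limsup at_top f < X" for f :: "real \<Rightarrow> ennreal" and X
        using that by (rule Limsup_lessD)
      show "Limsup at_top f \<le> X" if "eventually (\<lambda>t. f t \<le> X) at_top" for f :: "real \<Rightarrow> ennreal" and X
        using that by (rule Limsup_bounded)
      show "eventually P' at_top" if "eventually P at_top" "eventually (\<lambda>t. P t \<longrightarrow> P' t) at_top" for P P' :: "real \<Rightarrow> bool"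
        using that by eventually_elim simp
    qed (rule eventually_shift_at_top, simp)
  next
    assume a: "\<forall>h\<in>DC. ennreal (\<alpha> * (norm h)\<^sup>2) \<le> Liminf at_top (G h) \<and> Liminf at_top (G h) \<le> ennreal (\<beta> * (norm h)\<^sup>2)"
    show thesis
    proof (rule that[of "Liminf at_top" "\<lambda>P. frequently P at_top", OF a])
      show "frequently (\<lambda>t. f t < X) at_top" if "Liminf at_top f < X" for f :: "real \<Rightarrow> ennreal" and X
      proof (rule ccontr)
        assume "\<not> ?thesis"
        then have "eventually (\<lambda>t. X \<le> f t) at_top" by (simp add: frequently_def not_less)
        then have "X \<le> Liminf at_top f" by (rule Liminf_bounded)
        then show False using that by simp
      qed
      show "Liminf at_top f \<le> X" if "frequently (\<lambda>t. f t \<le> X) at_top" for f :: "real \<Rightarrow> ennreal" and X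
      proof (rule ccontr)
        assume "\<not> ?thesis"
        then have "eventually (\<lambda>t. X < f t) at_top" by (intro less_LiminfD) simp
        then show False using that by (simp add: frequently_def not_le)
      qed
      show "frequently P' at_top" if "frequently P at_top" "eventually (\<lambda>t. P t \<longrightarrow> P' t) at_top" for P P' :: "real \<Rightarrow> bool"
        using that(2,1) by (rule frequently_rev_mp[rotated])
      show "frequently (\<lambda>t. P (t + u)) at_top \<longleftrightarrow> frequently P at_top" for P and u :: real
        unfolding frequently_def by (simp only: eventually_shift_at_top[of "\<lambda>t. \<not> P t"])
    qed simp
  qed
  have lo: "ennreal (\<alpha> * (norm h)\<^sup>2) \<le> L (G h)" and up: "L (G h) \<le> ennreal (\<beta> * (norm h)\<^sup>2)" if "h \<in> DC" for h
    using lu that by auto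
  have c0: "c0_semigroup J T" using T by (simp add: generates_def)
  have Tadd: "T (s + t) y = T s (T t y)" if "s \<ge> 0" "t \<ge> 0" for s t y
    using c0 that by (auto simp: c0_semigroup_def)
  have lin: "bounded_linear (T t)" if "t \<ge> 0" for t
    using c0 that by (auto simp: c0_semigroup_def bounded_clinear_op_def)
  have D: "(norm (T u h))\<^sup>2 \<le> (2 * \<beta> / \<alpha>) * (norm h)\<^sup>2" "(\<alpha> / \<beta>) * (norm h)\<^sup>2 \<le> (norm (T u h))\<^sup>2"
    if u: "u \<ge> 0" and h: "h \<in> DC" for u h
  proof -
    let ?\<phi> = "\<lambda>s. ennreal ((norm (C (T s h)))\<^sup>2)"
    have Tu: "T u h \<in> DC" using TDC u h by blast
    have m1: "(\<lambda>s. ennreal ((if s \<in> {0..} then norm (C (T s h)) else 0)\<^sup>2)) \<in> borel_measurable lebesgue"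
    proof -
      have "{0::real..} \<in> sets lebesgue" by (intro sets_completionI_sets) simp
      from bochner_measurable_norm_on[OF this bm[rule_format, OF h]] show ?thesis by measurable
    qed
    have m2: "(\<lambda>s. ennreal ((if s \<in> {0..} then norm (C (T s h)) else 0)\<^sup>2)) = (\<lambda>s. if 0 \<le> s then ?\<phi> s else 0)"
      by auto
    have m: "(\<lambda>s. if 0 \<le> s then ?\<phi> s else 0) \<in> borel_measurable lebesgue" using m1 unfolding m2 .
    have "set_nn_integral lebesgue {0..t} (\<lambda>s. ennreal ((norm (C (T s (T u h))))\<^sup>2)) = set_nn_integral lebesgue {0..t} (\<lambda>s. ?\<phi> (s + u))" for t
      by (intro nn_integral_cong) (auto simp: indicator_def Tadd u)
    then have Gu: "G (T u h) = (\<lambda>t. ennreal (1 / t) * set_nn_integral lebesgue {0..t} (\<lambda>s. ?\<phi> (s + u)))"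
      by (simp add: G_def fun_eq_iff)
    have Gh: "G h = (\<lambda>t. ennreal (1 / t) * set_nn_integral lebesgue {0..t} ?\<phi>)" by (simp add: G_def fun_eq_iff)
    have bnd1: "L (G (T u h)) \<le> 2 * X" if "L (G h) < X" for X
      unfolding Gu
    proof (rule average_bounds(1)[where L=L and Q=Q, OF m u])
      show "Q (\<lambda>t. f t < Y)" if "L f < Y" for f Y using that by (rule LQ)
      show "L f \<le> Y" if "Q (\<lambda>t. f t \<le> Y)" for f Y using that by (rule QL)
      show "Q P'" if "Q P" "eventually (\<lambda>t. P t \<longrightarrow> P' t) at_top" for P P' using that by (rule Qm)
      show "Q (\<lambda>t. P (t + u)) \<longleftrightarrow> Q P" for P by (rule Qs)
      show "\<not> Q (\<lambda>_. False)" by (rule Qt)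
    qed (use that in \<open>simp only: Gh\<close>)
    have bnd2: "L (G h) \<le> ennreal d + X" if "L (G h) < top" "0 < d" "L (G (T u h)) < X" for d X
      unfolding Gh
    proof (rule average_bounds(2)[where L=L and Q=Q, OF m u])
      show "Q (\<lambda>t. f t < Y)" if "L f < Y" for f Y using that by (rule LQ)
      show "L f \<le> Y" if "Q (\<lambda>t. f t \<le> Y)" for f Y using that by (rule QL)
      show "Q P'" if "Q P" "eventually (\<lambda>t. P t \<longrightarrow> P' t) at_top" for P P' using that by (rule Qm)
      show "Q (\<lambda>t. P (t + u)) \<longleftrightarrow> Q P" for P by (rule Qs)
      show "\<not> Q (\<lambda>_. False)" by (rule Qt)
    qed (use that in \<open>simp_all only: Gh Gu\<close>)
    have "\<alpha> * (norm (T u h))\<^sup>2 \<le> 2 * \<beta> * (norm h)\<^sup>2"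
    proof (rule field_le_epsilon)
      fix d :: real assume d: "d > 0"
      \<comment> \<open>\<open>LQ\<close> requires a strict inequality, so the upper bound is
        relaxed by \<open>d / 2\<close>; the factor 2 turns this into \<open>d\<close>.\<close>
      have "L (G h) < ennreal (\<beta> * (norm h)\<^sup>2 + d / 2)"
        using up[OF h] by (rule le_less_trans) (use d ab in \<open>simp add: ennreal_lessI\<close>)
      from bnd1[OF this] lo[OF Tu] have "ennreal (\<alpha> * (norm (T u h))\<^sup>2) \<le> 2 * ennreal (\<beta> * (norm h)\<^sup>2 + d / 2)"
        by (rule order_trans[rotated])
      also have "\<dots> = ennreal (2 * (\<beta> * (norm h)\<^sup>2 + d / 2))"
        using d ab by (subst ennreal_mult) auto
      finally show "\<alpha> * (norm (T u h))\<^sup>2 \<le> 2 * \<beta> * (norm h)\<^sup>2 + d"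
        using d ab by (subst (asm) ennreal_le_iff) auto
    qed
    then show "(norm (T u h))\<^sup>2 \<le> (2 * \<beta> / \<alpha>) * (norm h)\<^sup>2" using ab by (simp add: field_simps)
    have "\<alpha> * (norm h)\<^sup>2 \<le> \<beta> * (norm (T u h))\<^sup>2"
    proof (rule field_le_epsilon)
      fix d :: real assume d: "d > 0"
      have "L (G (T u h)) < ennreal (\<beta> * (norm (T u h))\<^sup>2 + d / 2)"
        using up[OF Tu] by (rule le_less_trans) (use d ab in \<open>simp add: ennreal_lessI\<close>)
      moreover have "L (G h) < top" using up[OF h] by (rule le_less_trans) simp
      ultimately have "L (G h) \<le> ennreal (d / 2) + ennreal (\<beta> * (norm (T u h))\<^sup>2 + d / 2)"
        using d by (intro bnd2) auto
      with lo[OF h] have "ennreal (\<alpha> * (norm h)\<^sup>2) \<le> ennreal (d / 2) + ennreal (\<beta> * (norm (T u h))\<^sup>2 + d / 2)"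
        by (rule order_trans)
      also have "\<dots> = ennreal (\<beta> * (norm (T u h))\<^sup>2 + d)" using d ab by (simp add: add.commute flip: ennreal_plus)
      finally show "\<alpha> * (norm h)\<^sup>2 \<le> \<beta> * (norm (T u h))\<^sup>2 + d"
        using d ab by (subst (asm) ennreal_le_iff) auto
    qed
    then show "(\<alpha> / \<beta>) * (norm h)\<^sup>2 \<le> (norm (T u h))\<^sup>2" using ab by (simp add: field_simps)
  qed
  have all: "(norm (T u h))\<^sup>2 \<le> (2 * \<beta> / \<alpha>) * (norm h)\<^sup>2 \<and> (\<alpha> / \<beta>) * (norm h)\<^sup>2 \<le> (norm (T u h))\<^sup>2" if u: "u \<ge> 0" for u h
  proof -
    interpret Tu: bounded_linear "T u" by (rule lin[OF u])
    \<comment> \<open>For fixed \<open>u\<close> both estimates are closed conditions on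
      \<open>h\<close>, so density of \<open>DC\<close> extends them to the whole space.\<close>
    have "closure DC \<subseteq> {h. (norm (T u h))\<^sup>2 \<le> (2 * \<beta> / \<alpha>) * (norm h)\<^sup>2 \<and> (\<alpha> / \<beta>) * (norm h)\<^sup>2 \<le> (norm (T u h))\<^sup>2}"
      by (intro closure_minimal closed_Collect_conj closed_Collect_le continuous_intros Tu.continuous_on)
         (use D[OF u] in auto)
    then show ?thesis using dense by blast
  qed
  have "\<alpha> / \<beta> > 0" using ab by simp
  from semigroup_similar_isometric[OF J c0 this, of "2 * \<beta> / \<alpha>"] all T show ?thesis
    unfolding cond_i_def by blast
qed

section \<open>Resolvents of isometric semigroups\<close>

lemma integral_average_tendsto:
  fixes f :: "real \<Rightarrow> 'h::{real_inner,complete_space}"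
  assumes f: "continuous_on {0..} f" and a: "0 \<le> a"
  shows "((\<lambda>t. (1/t) *\<^sub>R integral {a..a + t} f) \<longlongrightarrow> f a) (at_right 0)"
proof (rule tendstoI)
  fix e :: real assume e: "0 < e"
  obtain d where d: "d > 0" "\<And>s. s \<ge> 0 \<Longrightarrow> \<bar>s - a\<bar> < d \<Longrightarrow> norm (f s - f a) < e/2"
    using f a e unfolding continuous_on_iff by (metis atLeast_iff dist_norm dist_real_def half_gt_zero)
  have "eventually (\<lambda>t. t < d) (at_right 0)" using d by (intro eventually_at_rightI[of 0 d]) auto
  moreover have "eventually (\<lambda>t::real. t > 0) (at_right 0)" by (simp add: eventually_at_right_less)
  ultimately show "eventually (\<lambda>t. dist ((1/t) *\<^sub>R integral {a..a + t} f) (f a) < e) (at_right 0)"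
  proof eventually_elim
    case (elim t)
    have "f integrable_on {a..a + t}"
      by (rule integrable_continuous_hilbert[OF continuous_on_subset[OF f]]) (use a in auto)
    then have "((\<lambda>s. f s - f a) has_integral (integral {a..a + t} f - t *\<^sub>R f a)) {a..a + t}"
      using elim has_integral_const_real[of "f a" a "a + t"] by (intro has_integral_diff integrable_integral) auto
    then have "norm (integral {a..a + t} f - t *\<^sub>R f a) \<le> e/2 * measure lborel (cbox a (a + t))"
      using e elim a d(2) by (intro has_integral_bound[of _ "\<lambda>s. f s - f a"]) (auto intro!: less_imp_le)
    then have le: "norm (integral {a..a + t} f - t *\<^sub>R f a) \<le> e/2 * t" using elim by simp
    have "(1/t) *\<^sub>R integral {a..a + t} f - f a = (1/t) *\<^sub>R (integral {a..a + t} f - t *\<^sub>R f a)"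
      using elim by (simp add: scaleR_diff_right)
    then have "norm ((1/t) *\<^sub>R integral {a..a + t} f - f a) = (1/t) * norm (integral {a..a + t} f - t *\<^sub>R f a)"
      using elim by simp
    also have "\<dots> \<le> (1/t) * (e/2 * t)" using elim by (intro mult_left_mono le) auto
    also have "\<dots> < e" using elim e by simp
    finally show ?case by (simp add: dist_norm)
  qed
qed

lemma
  assumes J: "cstruct J"
  shows cscale_mult: "cscale J (c * d) x = cscale J c (cscale J d x)"
    and norm_cscale: "norm (cscale J c x) = cmod c * norm x"
    and bounded_linear_cscale: "bounded_linear (cscale J c)"
proof -
  have lin: "linear J" and JJ: "\<And>x. J (J x) = - x" and Jin: "\<And>x y. inner (J x) (J y) = inner x y"
    using J by (auto simp: cstruct_def)
  show "cscale J (c * d) x = cscale J c (cscale J d x)"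
    by (simp add: cscale_def linear_add[OF lin] linear_scale[OF lin] JJ algebra_simps)
  have sk: "inner (J x) x = 0" for x using Jin[of x "J x"] by (simp add: JJ inner_commute)
  have n: "norm (cscale J c x) = cmod c * norm x" for x
  proof -
    have "(norm (cscale J c x))\<^sup>2 = inner (cscale J c x) (cscale J c x)" by (rule power2_norm_eq_inner)
    also have "\<dots> = ((Re c)\<^sup>2 + (Im c)\<^sup>2) * inner x x"
      by (simp add: cscale_def inner_add_left inner_add_right Jin sk inner_commute[of x "J x"]
          power2_eq_square algebra_simps)
    also have "\<dots> = (cmod c * norm x)\<^sup>2"
      by (simp only: power_mult_distrib cmod_power2 power2_norm_eq_inner)
    finally have "(norm (cscale J c x))\<^sup>2 = (cmod c * norm x)\<^sup>2" .
    then show ?thesis by (simp add: power2_eq_iff_nonneg)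
  qed
  then show "norm (cscale J c x) = cmod c * norm x" .
  show "bounded_linear (cscale J c)"
    by (rule bounded_linear_intro[where K="cmod c"])
       (simp_all add: cscale_add[OF lin] cscale_scaleR[OF lin] n)
qed

lemma cscale_diff_left: "cscale J (c - d) x = cscale J c x - cscale J d x"
  by (simp add: cscale_def algebra_simps)

lemma cscale_of_real: "cscale J (complex_of_real r) x = r *\<^sub>R x"
  by (simp add: cscale_def)

locale isometric_semigroup =
  fixes J :: "'h::{real_inner,complete_space} \<Rightarrow> 'h" and D :: "'h set" and A :: "'h \<Rightarrow> 'h"
    and U :: "real \<Rightarrow> 'h \<Rightarrow> 'h"
  assumes J: "cstruct J" and A: "lin_op J J D A" and gen: "generates J D A U"
    and iso: "\<And>t x. t \<ge> 0 \<Longrightarrow> norm (U t x) = norm x"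
begin

lemma c0: "c0_semigroup J U" using gen by (simp add: generates_def)

lemma U_lin: "t \<ge> 0 \<Longrightarrow> bounded_linear (U t)" and U_J: "t \<ge> 0 \<Longrightarrow> U t (J x) = J (U t x)"
  and U_0: "U 0 x = x" and U_add: "s \<ge> 0 \<Longrightarrow> t \<ge> 0 \<Longrightarrow> U (s + t) x = U s (U t x)"
  using c0 by (auto simp: c0_semigroup_def bounded_clinear_op_def)

lemma A_lim: "x \<in> D \<Longrightarrow> ((\<lambda>t. (1 / t) *\<^sub>R (U t x - x)) \<longlongrightarrow> A x) (at_right 0)"
  using gen by (simp add: generates_def)

lemma A_I:
  assumes "((\<lambda>t. (1 / t) *\<^sub>R (U t x - x)) \<longlongrightarrow> y) (at_right 0)" shows "x \<in> D" "A x = y"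
proof -
  show "x \<in> D" using gen assms unfolding generates_def by blast
  then show "A x = y" using tendsto_unique[OF _ A_lim assms] by simp
qed

lemma U_cont: "continuous_on {0..} (\<lambda>t. U t x)"
  by (rule c0_semigroup_continuous[OF c0, of 1]) (simp add: iso)

lemma skew:
  assumes x: "x \<in> D" shows "inner (A x) x = 0"
proof -
  have U0: "((\<lambda>t. U t x) \<longlongrightarrow> x) (at_right 0)" using c0 by (simp add: c0_semigroup_def)
  have "((\<lambda>t. inner ((1 / t) *\<^sub>R (U t x - x)) (U t x + x)) \<longlongrightarrow> inner (A x) (x + x)) (at_right 0)"
    by (intro tendsto_intros A_lim x U0)
  moreover have "eventually (\<lambda>t. inner ((1 / t) *\<^sub>R (U t x - x)) (U t x + x) = 0) (at_right (0::real))"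
    using eventually_at_right_less[of 0]
  proof eventually_elim
    case (elim t)
    have "inner (U t x) (U t x) = inner x x" using iso[of t x] elim by (simp add: norm_eq_sqrt_inner)
    moreover have "inner (U t x - x) (U t x + x) = inner (U t x) (U t x) - inner x x"
      by (simp add: inner_diff_left inner_add_right inner_commute[of x "U t x"])
    ultimately show ?case by (simp only: inner_scaleR_left) simp
  qed
  ultimately have "((\<lambda>t::real. 0::real) \<longlongrightarrow> inner (A x) (x + x)) (at_right 0)"
    by (rule Lim_transform_eventually)
  then show ?thesis by (simp add: tendsto_const_iff inner_add_right)
qed

text \<open>The rescaled semigroup, with generator \<open>A - lam\<close>; \<open>Z\<close> below is
  the Laplace transform of the orbit cut off at time \<open>t\<close>. The full Laplace integral is
  never formed.\<close>

definition V :: "complex \<Rightarrow> real \<Rightarrow> 'h \<Rightarrow> 'h" where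
  "V lam s x = cscale J (exp (- (lam * complex_of_real s))) (U s x)"

definition Z :: "complex \<Rightarrow> real \<Rightarrow> 'h \<Rightarrow> 'h" where
  "Z lam t x = integral {0..t} (\<lambda>s. V lam s x)"

lemma norm_V: "s \<ge> 0 \<Longrightarrow> norm (V lam s x) = exp (- (Re lam * s)) * norm x"
  by (simp add: V_def norm_cscale[OF J] iso)

lemma V_lin: "s \<ge> 0 \<Longrightarrow> bounded_linear (V lam s)"
  unfolding V_def by (rule bounded_linear_compose[OF bounded_linear_cscale[OF J] U_lin])

lemma V_0: "V lam 0 x = x" by (simp add: V_def U_0 cscale_def)

lemma U_cscale: "s \<ge> 0 \<Longrightarrow> U s (cscale J c x) = cscale J c (U s x)"
  using U_lin[of s] by (simp add: cscale_def linear_simps U_J)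

lemma V_add: "s \<ge> 0 \<Longrightarrow> t \<ge> 0 \<Longrightarrow> V lam (s + t) x = V lam s (V lam t x)"
proof -
  assume "s \<ge> 0" "t \<ge> 0"
  moreover have "exp (- (lam * complex_of_real (s + t))) = exp (- (lam * complex_of_real s)) * exp (- (lam * complex_of_real t))"
    by (simp add: distrib_left mult_exp_exp)
  ultimately show ?thesis by (simp only: V_def U_cscale U_add cscale_mult[OF J])
qed

lemma V_cont: "continuous_on {0..} (\<lambda>s. V lam s x)"
  unfolding V_def cscale_def
  by (intro continuous_intros U_cont bounded_linear.continuous_on[OF cstruct_bounded_linear[OF J]])

lemma V_integrable: "0 \<le> a \<Longrightarrow> (\<lambda>s. V lam s x) integrable_on {a..b}"
  by (rule integrable_continuous_hilbert[OF continuous_on_subset[OF V_cont]]) auto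

text \<open>\<open>V lam u\<close> shifts the interval of integration from \<open>{0..t}\<close> to
  \<open>{u..t + u}\<close>. Splitting the integral over \<open>{0..t + u}\<close> at
  \<open>u\<close> and at \<open>t\<close> gives the difference.\<close>

lemma V_Z:
  assumes t: "t \<ge> 0" and u: "u \<ge> 0"
  shows "V lam u (Z lam t x) - Z lam t x = integral {t..t + u} (\<lambda>s. V lam s x) - integral {0..0 + u} (\<lambda>s. V lam s x)"
proof -
  let ?f = "\<lambda>s. V lam s x"
  have hi: "(?f has_integral integral {a..b} ?f) {a..b}" if "0 \<le> a" for a b
    by (rule integrable_integral[OF V_integrable[OF that]])
  have "((V lam u \<circ> ?f) has_integral V lam u (Z lam t x)) {0..t}"
    unfolding Z_def by (rule has_integral_linear[OF hi V_lin[OF u]]) simp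
  then have "((?f \<circ> (+) u) has_integral V lam u (Z lam t x)) {0..t}"
    by (rule has_integral_eq[rotated]) (use u in \<open>auto simp: V_add\<close>)
  then have "(?f has_integral V lam u (Z lam t x)) {u..t + u}"
    by (simp add: has_integral_shift_Icc_real)
  then have "(?f has_integral (integral {0..u} ?f + V lam u (Z lam t x))) {0..t + u}"
    using t u by (intro has_integral_combine_hilbert[of 0 u] hi) auto
  moreover have "(?f has_integral (Z lam t x + integral {t..t + u} ?f)) {0..t + u}"
    using t u unfolding Z_def by (intro has_integral_combine_hilbert[of 0 t] hi) auto
  ultimately have "integral {0..u} ?f + V lam u (Z lam t x) = Z lam t x + integral {t..t + u} ?f"
    by (rule has_integral_unique)
  then show ?thesis by (simp add: algebra_simps)
qed

lemma exp_difference_quotient: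
  "((\<lambda>t. complex_of_real (1/t) * (exp (lam * complex_of_real t) - 1)) \<longlongrightarrow> lam) (at_right 0)"
proof -
  have "((\<lambda>z. exp (lam * z)) has_field_derivative lam) (at 0)"
    by (auto intro!: derivative_eq_intros)
  then have "(\<lambda>h. (exp (lam * h) - 1) / h) \<midarrow>0\<rightarrow> lam" by (simp add: DERIV_def)
  moreover have "filterlim complex_of_real (at 0) (at_right 0)"
    unfolding filterlim_at
    by (auto intro!: tendsto_eq_intros eventually_mono[OF eventually_at_right_less])
  ultimately have "((\<lambda>t. (exp (lam * complex_of_real t) - 1) / complex_of_real t) \<longlongrightarrow> lam) (at_right 0)"
    by (rule filterlim_compose)
  then show ?thesis by (simp add: of_real_divide)
qed

text \<open>By \<open>V_Z\<close> the right derivative at 0 of the rescaled orbit of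
  \<open>Z lam t x\<close> is \<open>V lam t x - x\<close>; a product rule with the factor
  \<open>exp (lam u)\<close> returns to \<open>U\<close> and adds \<open>lam\<close> times the
  vector.\<close>

lemma Z_in_D:
  assumes t: "t \<ge> 0"
  shows "Z lam t x \<in> D" "cscale J lam (Z lam t x) - A (Z lam t x) = x - V lam t x"
proof -
  let ?z = "Z lam t x" and ?f = "\<lambda>s. V lam s x"
  let ?e = "\<lambda>u. exp (lam * complex_of_real u)"
  have "((\<lambda>u. (1/u) *\<^sub>R integral {t..t + u} ?f - (1/u) *\<^sub>R integral {0..0 + u} ?f) \<longlongrightarrow> V lam t x - V lam 0 x) (at_right 0)"
    by (intro tendsto_diff integral_average_tendsto V_cont t order_refl)
  moreover have "eventually (\<lambda>u. (1/u) *\<^sub>R integral {t..t + u} ?f - (1/u) *\<^sub>R integral {0..0 + u} ?f =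
      (1/u) *\<^sub>R (V lam u ?z - ?z)) (at_right 0)"
    using eventually_at_right_less[of 0]
    by eventually_elim (simp only: V_Z[OF t less_imp_le] scaleR_diff_right)
  ultimately have V: "((\<lambda>u. (1/u) *\<^sub>R (V lam u ?z - ?z)) \<longlongrightarrow> V lam t x - x) (at_right 0)"
    unfolding V_0 by (rule Lim_transform_eventually)
  have e0: "(?e \<longlongrightarrow> 1) (at_right 0)"
    by (rule tendsto_eq_intros refl | simp)+
  have J': "bounded_linear J" by (rule cstruct_bounded_linear[OF J])
  have "((\<lambda>u. cscale J (?e u) ((1/u) *\<^sub>R (V lam u ?z - ?z)) +
      cscale J (complex_of_real (1/u) * (?e u - 1)) ?z) \<longlongrightarrow> cscale J 1 (V lam t x - x) + cscale J lam ?z) (at_right 0)"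
    unfolding cscale_def
    by (intro tendsto_intros e0 V exp_difference_quotient bounded_linear.tendsto[OF J'])
  moreover have "eventually (\<lambda>u. cscale J (?e u) ((1/u) *\<^sub>R (V lam u ?z - ?z)) +
      cscale J (complex_of_real (1/u) * (?e u - 1)) ?z = (1/u) *\<^sub>R (U u ?z - ?z)) (at_right 0)"
    using eventually_at_right_less[of 0]
  proof eventually_elim
    case (elim u)
    have lJ: "linear J" using J by (simp add: cstruct_def)
    have "cscale J (?e u) (V lam u ?z) = U u ?z"
      unfolding V_def by (simp add: cscale_def[of J 1] flip: cscale_mult[OF J] exp_add)
    then have "cscale J (?e u) (V lam u ?z - ?z) + cscale J (?e u - 1) ?z = U u ?z - ?z"
      by (simp add: cscale_diff[OF lJ] cscale_diff_left cscale_def[of J 1])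
    then have "(1/u) *\<^sub>R cscale J (?e u) (V lam u ?z - ?z) + (1/u) *\<^sub>R cscale J (?e u - 1) ?z = (1/u) *\<^sub>R (U u ?z - ?z)"
      by (simp flip: scaleR_add_right)
    then show ?case by (simp only: cscale_scaleR[OF lJ] cscale_mult[OF J] cscale_of_real)
  qed
  ultimately have "((\<lambda>u. (1/u) *\<^sub>R (U u ?z - ?z)) \<longlongrightarrow> cscale J 1 (V lam t x - x) + cscale J lam ?z) (at_right 0)"
    by (rule Lim_transform_eventually)
  from A_I[OF this] show "?z \<in> D" "cscale J lam ?z - A ?z = x - V lam t x"
    by (auto simp: cscale_def[of J 1])
qed

text \<open>\<open>A\<close> and \<open>J\<close> are both skew, so only the real part of
  \<open>lam\<close> contributes. At resolvent vectors this makes \<open>inner y (res lam y)\<close>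
  a nonnegative energy density.\<close>

lemma norm_resolvent_eq:
  assumes x: "x \<in> D"
  shows "inner (cscale J lam x - A x) x = Re lam * (norm x)\<^sup>2"
proof -
  have Jin: "inner (J x) (J y) = inner x y" and JJ: "J (J x) = - x" for x y using J by (auto simp: cstruct_def)
  have sk: "inner (J x) x = 0" using Jin[of x "J x"] by (simp add: JJ inner_commute)
  show ?thesis by (simp add: cscale_def inner_diff_left inner_add_left sk skew[OF x] power2_norm_eq_inner)
qed

lemma norm_le_resolvent:
  assumes x: "x \<in> D" and lam: "Re lam > 0"
  shows "norm x \<le> norm (cscale J lam x - A x) / Re lam"
proof (cases "x = 0")
  case False
  have "Re lam * (norm x)\<^sup>2 \<le> norm (cscale J lam x - A x) * norm x"
    unfolding norm_resolvent_eq[OF x, symmetric] by (rule norm_cauchy_schwarz)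
  then show ?thesis using False lam by (simp add: power2_eq_square field_simps)
qed (use lam in simp)

text \<open>\<open>lam - A\<close> maps \<open>Z lam 1 x\<close> to \<open>x - V lam 1 x\<close>.
  Since \<open>V lam 1\<close> is a strict contraction with factor \<open>exp (- Re lam)\<close>,
  every \<open>y\<close> has this form.\<close>

lemma onto:
  assumes lam: "Re lam > 0"
  shows "\<exists>x\<in>D. cscale J lam x - A x = y"
proof -
  define q where "q = exp (- Re lam)"
  have q: "0 \<le> q" "q < 1" using lam by (auto simp: q_def)
  have "\<exists>!x. y + V lam 1 x = x"
  proof (rule banach_fix_type[OF q])
    show "\<forall>x x'. dist (y + V lam 1 x) (y + V lam 1 x') \<le> q * dist x x'"
    proof (intro allI)
      fix x x'
      have "dist (y + V lam 1 x) (y + V lam 1 x') = norm (V lam 1 (x - x'))"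
        using V_lin[of 1 lam] by (simp add: dist_norm linear_simps)
      also have "\<dots> = q * dist x x'" by (simp add: norm_V q_def dist_norm)
      finally show "dist (y + V lam 1 x) (y + V lam 1 x') \<le> q * dist x x'" by simp
    qed
  qed
  then obtain x where "y + V lam 1 x = x" by blast
  then have "x - V lam 1 x = y" by (metis add_diff_cancel_right')
  then show ?thesis using Z_in_D[of 1 lam x] by auto
qed

lemma in_resolvent_set:
  assumes lam: "Re lam > 0" shows "lam \<in> resolvent_set J D A"
proof -
  have lJ: "linear J" using J by (simp add: cstruct_def)
  have sub: "subspace D" and Aadd: "\<And>x y. x \<in> D \<Longrightarrow> y \<in> D \<Longrightarrow> A (x + y) = A x + A y"
    and Asc: "\<And>c x. x \<in> D \<Longrightarrow> A (c *\<^sub>R x) = c *\<^sub>R A x"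
    using A by (auto simp: lin_op_def csubspace_def)
  have Adiff: "A (x - y) = A x - A y" if "x \<in> D" "y \<in> D" for x y
    using Aadd[of x "(-1) *\<^sub>R y"] Asc[of y "-1"] that sub by (simp add: subspace_neg)
  let ?L = "\<lambda>x. cscale J lam x - A x"
  have inj: "x = y" if "x \<in> D" "y \<in> D" "?L x = ?L y" for x y
  proof -
    have "x - y \<in> D" using that sub by (simp add: subspace_diff)
    moreover have "?L (x - y) = 0" using that by (simp add: cscale_diff[OF lJ] Adiff algebra_simps)
    ultimately have "norm (x - y) \<le> 0" using norm_le_resolvent[of "x - y" lam] lam by simp
    then show ?thesis by simp
  qed
  obtain R where R: "\<And>y. R y \<in> D" "\<And>y. ?L (R y) = y" using onto[OF lam] by metis
  have "bounded_linear R"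
  proof (rule bounded_linear_intro)
    show "R (x + y) = R x + R y" for x y
    proof (rule inj)
      have "?L (R x + R y) = ?L (R x) + ?L (R y)" using R(1) by (simp add: cscale_add[OF lJ] Aadd)
      then show "?L (R (x + y)) = ?L (R x + R y)" by (simp only: R)
    qed (use R sub in \<open>auto intro: subspace_add\<close>)
    show "R (c *\<^sub>R x) = c *\<^sub>R R x" for c x
    proof (rule inj)
      have "?L (c *\<^sub>R R x) = c *\<^sub>R ?L (R x)" using R(1) by (simp add: cscale_scaleR[OF lJ] Asc scaleR_diff_right)
      then show "?L (R (c *\<^sub>R x)) = ?L (c *\<^sub>R R x)" by (simp only: R)
    qed (use R sub in \<open>auto intro: subspace_scale\<close>)
    show "norm (R y) \<le> norm y * (1 / Re lam)" for y
      using norm_le_resolvent[OF R(1)[of y] lam] by (simp add: R)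
  qed
  moreover have "R (?L x) = x" if "x \<in> D" for x by (rule inj) (use that R in auto)
  ultimately show ?thesis unfolding resolvent_set_def using R by blast
qed

end

section \<open>Fejer means of the resolvent\<close>

text \<open>The Fejer kernel: the Fourier transform of the triangle
  \<open>1 - \<bar>x\<bar> / a\<close> on \<open>[-a, a]\<close>, folded onto the positive
  half.\<close>

definition fejer :: "real \<Rightarrow> real \<Rightarrow> real" where
  "fejer a s = integral {0..a} (\<lambda>x. 2 * (1 - x / a) * cos (x * s))"

lemma fejer_integrable: "(\<lambda>x::real. 2 * (1 - x / a) * cos (x * s)) integrable_on {0..a}"
  unfolding divide_inverse by (intro integrable_continuous_interval continuous_intros)

lemma fejer_weight: "a > 0 \<Longrightarrow> ((\<lambda>x::real. 2 * (1 - x / a)) has_integral a) {0..a}"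
proof -
  assume a: "a > 0"
  have "((\<lambda>x. 2 * (1 - x / a)) has_integral ((2 * a - a\<^sup>2 / a) - (2 * 0 - 0\<^sup>2 / a))) {0..a}"
    by (rule fundamental_theorem_of_calculus)
       (use a in \<open>auto intro!: derivative_eq_intros simp: has_real_derivative_iff_has_vector_derivative[symmetric] field_simps\<close>)
  then show ?thesis using a by (simp add: power2_eq_square)
qed

text \<open>Integration by parts: the weight vanishes at \<open>a\<close> and the sine at 0, so no
  boundary term of order \<open>1 / s\<close> is left. This gives both nonnegativity and the decay
  \<open>1 / s\<^sup>2\<close>.\<close>

lemma fejer_eq:
  assumes a: "a > 0" and s: "s \<noteq> 0" shows "fejer a s = 2 * (1 - cos (a * s)) / (a * s\<^sup>2)"
proof -
  let ?F = "\<lambda>x. 2 * ((1 - x / a) * sin (x * s) / s - cos (x * s) / (a * s\<^sup>2))"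
  have "((\<lambda>x. 2 * (1 - x / a) * cos (x * s)) has_integral (?F a - ?F 0)) {0..a}"
    by (rule fundamental_theorem_of_calculus)
       (use a s in \<open>auto intro!: derivative_eq_intros
          simp: has_real_derivative_iff_has_vector_derivative[symmetric] field_simps power2_eq_square\<close>)
  then have "fejer a s = ?F a - ?F 0" unfolding fejer_def by (rule integral_unique)
  also have "\<dots> = 2 * (1 - cos (a * s)) / (a * s\<^sup>2)" using a s by (simp add: diff_divide_distrib)
  finally show ?thesis .
qed

lemma fejer_le_a:
  assumes a: "a > 0" shows "fejer a s \<le> a"
proof -
  have "fejer a s \<le> integral {0..a} (\<lambda>x. 2 * (1 - x / a))"
    unfolding fejer_def
  proof (intro integral_le fejer_integrable has_integral_integrable[OF fejer_weight[OF a]])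
    show "2 * (1 - x / a) * cos (x * s) \<le> 2 * (1 - x / a)" if "x \<in> {0..a}" for x
      by (rule mult_left_le) (use that a in \<open>auto simp: field_simps\<close>)
  qed
  then show ?thesis using integral_unique[OF fejer_weight[OF a]] by simp
qed

text \<open>For \<open>x * s \<le> 1\<close> the half-angle formula and
  \<open>\<bar>sin x\<bar> \<le> \<bar>x\<bar>\<close> give a cosine of at least 1/2, and the weight
  alone integrates to \<open>a\<close>.\<close>

lemma fejer_ge:
  assumes a: "a > 0" and s: "0 \<le> s" "a * s \<le> 1" shows "a / 2 \<le> fejer a s"
proof -
  have li: "(\<lambda>x. (1/2) * (2 * (1 - x / a))) integrable_on {0..a}"
    by (rule integrable_on_mult_right[OF has_integral_integrable[OF fejer_weight[OF a]]])
  have "integral {0..a} (\<lambda>x. (1/2) * (2 * (1 - x / a))) \<le> fejer a s"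
    unfolding fejer_def
  proof (rule integral_le[OF li fejer_integrable])
    fix x assume x: "x \<in> {0..a}"
    have "x * s \<le> a * s" using x s by (intro mult_right_mono) auto
    then have xs: "0 \<le> x * s" "x * s \<le> 1" using x s by auto
    have "\<bar>sin (x * s / 2)\<bar> \<le> \<bar>x * s / 2\<bar>" by (rule abs_sin_x_le_abs_x)
    also have "\<dots> \<le> 1/2" using xs by simp
    finally have "(sin (x * s / 2))\<^sup>2 \<le> (1/2)\<^sup>2" by (simp add: abs_le_square_iff[symmetric])
    moreover have "cos (x * s) = 1 - 2 * (sin (x * s / 2))\<^sup>2" using cos_double_sin[of "x * s / 2"] by simp
    ultimately have "1/2 \<le> cos (x * s)" by (simp add: power2_eq_square)
    moreover have "0 \<le> 2 * (1 - x / a)" using x a by (simp add: divide_le_eq)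
    ultimately show "(1/2) * (2 * (1 - x / a)) \<le> 2 * (1 - x / a) * cos (x * s)"
      by (subst mult.commute) (rule mult_left_mono)
  qed
  then show ?thesis using integral_unique[OF has_integral_mult_right[OF fejer_weight[OF a], of "1/2"]] by simp
qed

lemma fejer_nonneg:
  assumes a: "a > 0" and s: "0 \<le> s" shows "0 \<le> fejer a s"
proof (cases "s = 0")
  case True
  then show ?thesis using fejer_ge[OF a, of s] a by simp
next
  case False
  then show ?thesis using a by (simp add: fejer_eq)
qed

lemma fejer_le:
  assumes a: "a > 0" and s: "s > 0" shows "fejer a s \<le> 4 / (a * s\<^sup>2)"
proof -
  have "2 * (1 - cos (a * s)) \<le> 4" using cos_ge_minus_one[of "a * s"] by argo
  then show ?thesis using a s by (simp add: fejer_eq divide_right_mono)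
qed

text \<open>One integrable majorant for both regimes: \<open>(a * s)\<^sup>2 \<le> 4\<close> means
  \<open>1 + (a * s)\<^sup>2 \<le> 5\<close>, so the bound \<open>a\<close> suffices; otherwise
  \<open>1 + (a * s)\<^sup>2\<close> is at most 5/4 of \<open>(a * s)\<^sup>2\<close> and the decay
  \<open>4 / (a * s\<^sup>2)\<close> suffices.\<close>

lemma fejer_le_arctan:
  assumes a: "a > 0" and s: "s \<ge> 0" shows "fejer a s \<le> 5 * (a / (1 + (a * s)\<^sup>2))"
proof (cases "(a * s)\<^sup>2 \<le> 4")
  case True
  have "1 + (a * s)\<^sup>2 > 0" by (simp add: add_pos_nonneg)
  moreover have "a * (1 + (a * s)\<^sup>2) \<le> a * 5" using a True by (intro mult_left_mono) auto
  ultimately have "a \<le> 5 * (a / (1 + (a * s)\<^sup>2))" by (simp add: pos_le_divide_eq mult.commute)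
  then show ?thesis using fejer_le_a[OF a, of s] by simp
next
  case False
  then have s0: "s > 0" using s by (cases "s = 0") auto
  have p: "1 + (a * s)\<^sup>2 > 0" by (simp add: add_pos_nonneg)
  have "4 / (a * s\<^sup>2) = 4 * a / (a * s)\<^sup>2" using a s0 by (simp add: power2_eq_square field_simps)
  also have "\<dots> \<le> 5 * (a / (1 + (a * s)\<^sup>2))"
  proof -
    have "4 * a * (1 + (a * s)\<^sup>2) \<le> 4 * a * ((5/4) * (a * s)\<^sup>2)"
      using a False by (intro mult_left_mono) auto
    then have "4 * a * (1 + (a * s)\<^sup>2) \<le> 5 * a * (a * s)\<^sup>2" by simp
    then show ?thesis using p a s0 by (simp add: divide_le_eq pos_le_divide_eq mult_ac)
  qed
  finally show ?thesis using fejer_le[OF a s0] by simp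
qed

section \<open>Fourier representation of the symmetrized resolvent\<close>

context isometric_semigroup
begin

abbreviation res :: "complex \<Rightarrow> 'h \<Rightarrow> 'h" where "res \<equiv> resolvent J D A"

lemmas res_D = resolvent_in[OF J A in_resolvent_set]
  and res_eq = resolvent_eq[OF J A in_resolvent_set]
  and res_unique = resolvent_unique[OF J A in_resolvent_set]
  and res_add = resolvent_add[OF J A in_resolvent_set]
  and res_scaleR = resolvent_scaleR[OF J A in_resolvent_set]

lemma norm_res_le: "Re lam > 0 \<Longrightarrow> norm (res lam y) \<le> norm y / Re lam"
  using norm_le_resolvent[OF res_D[of lam y], of lam] res_eq[of lam y] by simp

lemma res_energy: "Re lam > 0 \<Longrightarrow> inner y (res lam y) = Re lam * (norm (res lam y))\<^sup>2"
  using norm_resolvent_eq[OF res_D[of lam y], of lam] res_eq[of lam y] by simp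

text \<open>The resolvent identity. It provides the continuity in \<xi> on which all measurability
  rests here.\<close>

lemma res_lipschitz:
  assumes "Re lam > 0" "Re mu > 0"
  shows "norm (res lam y - res mu y) \<le> cmod (lam - mu) * norm y / (Re lam * Re mu)"
proof -
  let ?x = "res mu y"
  have "cscale J lam ?x - A ?x = y + cscale J (lam - mu) ?x"
    using res_eq[OF assms(2), of y] by (simp add: cscale_diff_left) (simp add: algebra_simps)
  from res_unique[OF assms(1) res_D[OF assms(2)] this]
  have "?x = res lam (y + cscale J (lam - mu) ?x)" ..
  then have "?x = res lam y + res lam (cscale J (lam - mu) ?x)" by (simp only: res_add[OF assms(1)])
  moreover have "x = a + b \<Longrightarrow> a - x = - b" for a b x :: 'h by simp
  ultimately have "res lam y - ?x = - res lam (cscale J (lam - mu) ?x)" by blast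
  then have "norm (res lam y - ?x) \<le> cmod (lam - mu) * norm ?x / Re lam"
    using norm_res_le[OF assms(1), of "cscale J (lam - mu) ?x"] by (simp add: norm_cscale[OF J])
  also have "\<dots> \<le> cmod (lam - mu) * (norm y / Re mu) / Re lam"
    using assms by (intro divide_right_mono mult_left_mono norm_res_le) auto
  finally show ?thesis by (simp add: mult.commute)
qed

lemma res_continuous:
  assumes "\<epsilon> > 0" shows "continuous_on UNIV (\<lambda>\<xi>. res (Complex \<epsilon> \<xi>) y)"
proof (rule lipschitz_on_continuous_on)
  show "(norm y / (\<epsilon> * \<epsilon>))-lipschitz_on UNIV (\<lambda>\<xi>. res (Complex \<epsilon> \<xi>) y)"
  proof (rule lipschitz_onI)
    fix x z :: real
    have "Complex \<epsilon> x - Complex \<epsilon> z = \<i> * complex_of_real (x - z)" by (simp add: complex_eq_iff)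
    then have "cmod (Complex \<epsilon> x - Complex \<epsilon> z) = \<bar>x - z\<bar>" by (simp only: norm_mult norm_ii norm_of_real) simp
    then show "dist (res (Complex \<epsilon> x) y) (res (Complex \<epsilon> z) y) \<le> norm y / (\<epsilon> * \<epsilon>) * dist x z"
      using res_lipschitz[of "Complex \<epsilon> x" "Complex \<epsilon> z" y] assms by (simp add: dist_norm mult.commute)
  qed (use assms in auto)
qed

text \<open>The tail of the Laplace transform beyond \<open>t\<close> is itself a resolvent value,
  \<open>res lam (V lam t y)\<close>, and is exponentially small.\<close>

lemma res_truncate:
  assumes lam: "Re lam > 0" and t: "t \<ge> 0"
  shows "norm (res lam y - Z lam t y) \<le> exp (- (Re lam * t)) * norm y / Re lam"
proof -
  have "res lam (y - V lam t y) = Z lam t y"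
    by (rule res_unique[OF lam Z_in_D[OF t]])
  moreover have "res lam (y - V lam t y) = res lam y - res lam (V lam t y)"
    using res_add[OF lam, of y "(-1) *\<^sub>R V lam t y"] res_scaleR[OF lam, of "-1" "V lam t y"] by simp
  ultimately have "norm (res lam y - Z lam t y) = norm (res lam (V lam t y))" by (metis add_diff_cancel_left' diff_diff_eq2 diff_add_cancel)
  then show ?thesis using norm_res_le[OF lam, of "V lam t y"] by (simp add: norm_V[OF t])
qed

definition corr :: "'h \<Rightarrow> real \<Rightarrow> real" where "corr y s = inner y (U s y)"

lemma corr_cont: "continuous_on {0..} (corr y)"
  unfolding corr_def by (intro continuous_on_inner continuous_on_const U_cont)

lemma corr_le: "s \<ge> 0 \<Longrightarrow> \<bar>corr y s\<bar> \<le> (norm y)\<^sup>2"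
  using Cauchy_Schwarz_ineq2[of y "U s y"] by (simp add: corr_def iso power2_eq_square)

text \<open>Adding the contributions of \<open>\<xi>\<close> and \<open>-\<xi>\<close> removes the odd part of the Fourier integrand.\<close>

lemma inner_V_sum:
  "inner y (V (Complex \<epsilon> \<xi>) s y) + inner y (V (Complex \<epsilon> (- \<xi>)) s y) = 2 * exp (- (\<epsilon> * s)) * cos (\<xi> * s) * corr y s"
  by (simp add: V_def cscale_def corr_def inner_add_right inner_diff_right Re_exp Im_exp algebra_simps)

definition even_res :: "'h \<Rightarrow> real \<Rightarrow> real \<Rightarrow> real" where
  "even_res y \<epsilon> \<xi> = inner y (res (Complex \<epsilon> \<xi>) y) + inner y (res (Complex \<epsilon> (- \<xi>)) y)"

definition even_res_trunc :: "'h \<Rightarrow> real \<Rightarrow> real \<Rightarrow> real \<Rightarrow> real" where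
  "even_res_trunc y \<epsilon> t \<xi> = integral {0..t} (\<lambda>s. 2 * exp (- (\<epsilon> * s)) * cos (\<xi> * s) * corr y s)"

text \<open>The error does not depend on \<xi>, so it can be integrated over
  \<open>{0..a}\<close>.\<close>

lemma even_res_truncate:
  assumes e: "\<epsilon> > 0" and t: "t \<ge> 0"
  shows "\<bar>even_res y \<epsilon> \<xi> - even_res_trunc y \<epsilon> t \<xi>\<bar> \<le> 2 * (exp (- (\<epsilon> * t)) * (norm y)\<^sup>2 / \<epsilon>)"
proof -
  have hi: "((\<lambda>s. inner y (V lam s y)) has_integral inner y (Z lam t y)) {0..t}" for lam
    using has_integral_linear[OF integrable_integral[OF V_integrable[OF order_refl, of lam y t]] bounded_linear_inner_right[of y]]
    by (simp add: o_def Z_def)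
  have "even_res_trunc y \<epsilon> t \<xi> = inner y (Z (Complex \<epsilon> \<xi>) t y) + inner y (Z (Complex \<epsilon> (- \<xi>)) t y)"
    using has_integral_add[OF hi[of "Complex \<epsilon> \<xi>"] hi[of "Complex \<epsilon> (- \<xi>)"]]
    unfolding inner_V_sum even_res_trunc_def by (rule integral_unique)
  then have "even_res y \<epsilon> \<xi> - even_res_trunc y \<epsilon> t \<xi> = inner y (res (Complex \<epsilon> \<xi>) y - Z (Complex \<epsilon> \<xi>) t y) +
      inner y (res (Complex \<epsilon> (- \<xi>)) y - Z (Complex \<epsilon> (- \<xi>)) t y)"
    by (simp add: even_res_def inner_diff_right)
  moreover have "\<bar>inner y (res (Complex \<epsilon> x) y - Z (Complex \<epsilon> x) t y)\<bar> \<le> exp (- (\<epsilon> * t)) * (norm y)\<^sup>2 / \<epsilon>" for x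
  proof -
    have "\<bar>inner y (res (Complex \<epsilon> x) y - Z (Complex \<epsilon> x) t y)\<bar> \<le> norm y * norm (res (Complex \<epsilon> x) y - Z (Complex \<epsilon> x) t y)"
      by (rule Cauchy_Schwarz_ineq2)
    also have "\<dots> \<le> norm y * (exp (- (\<epsilon> * t)) * norm y / \<epsilon>)"
      using res_truncate[of "Complex \<epsilon> x" t y] e t by (intro mult_left_mono) auto
    finally show ?thesis by (simp add: power2_eq_square mult_ac)
  qed
  ultimately show ?thesis
    using abs_triangle_ineq[of "inner y (res (Complex \<epsilon> \<xi>) y - Z (Complex \<epsilon> \<xi>) t y)" "inner y (res (Complex \<epsilon> (- \<xi>)) y - Z (Complex \<epsilon> (- \<xi>)) t y)"]
    by (smt (verit, best))
qed

lemma even_res_cont: "\<epsilon> > 0 \<Longrightarrow> continuous_on S (even_res y \<epsilon>)"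
proof -
  assume e: "\<epsilon> > 0"
  have "continuous_on UNIV (\<lambda>\<xi>. res (Complex \<epsilon> (- \<xi>)) y)"
    by (rule continuous_on_compose2[OF res_continuous[OF e, of y], of UNIV uminus]) (auto intro: continuous_intros)
  then have "continuous_on UNIV (even_res y \<epsilon>)"
    unfolding even_res_def by (intro continuous_intros res_continuous e)
  then show ?thesis by (rule continuous_on_subset) simp
qed

lemma even_res_nonneg: "\<epsilon> > 0 \<Longrightarrow> 0 \<le> even_res y \<epsilon> \<xi>"
  by (simp add: even_res_def res_energy)

text \<open>After truncation the double integral is over a compact rectangle with continuous
  integrand. Integrating over \<xi> first produces the Fejer kernel.\<close>

lemma fejer_swap:
  assumes a: "a > 0" and t: "t \<ge> 0"
  shows "integral {0..a} (\<lambda>\<xi>. (1 - \<xi> / a) * even_res_trunc y \<epsilon> t \<xi>) = integral {0..t} (\<lambda>s. exp (- (\<epsilon> * s)) * corr y s * fejer a s)"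
    and "continuous_on {0..t} (\<lambda>s. exp (- (\<epsilon> * s)) * corr y s * fejer a s)"
    and "continuous_on {0..a} (\<lambda>\<xi>. (1 - \<xi> / a) * even_res_trunc y \<epsilon> t \<xi>)"
proof -
  let ?f = "\<lambda>\<xi> s. (1 - \<xi> / a) * (2 * exp (- (\<epsilon> * s)) * cos (\<xi> * s) * corr y s)"
  have "continuous_on (cbox (0, 0) (a, t)) (\<lambda>z. corr y (snd z))"
    by (rule continuous_on_compose2[OF corr_cont]) (auto intro!: continuous_intros simp: cbox_Pair_eq)
  then have cont: "continuous_on (cbox (0, 0) (a, t)) (\<lambda>(\<xi>, s). ?f \<xi> s)"
    using a unfolding case_prod_beta by (intro continuous_intros) auto
  have inner1: "integral {0..t} (?f \<xi>) = (1 - \<xi> / a) * even_res_trunc y \<epsilon> t \<xi>" for \<xi>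
    unfolding even_res_trunc_def by (rule integral_mult_right)
  have inner2: "integral {0..a} (\<lambda>\<xi>. ?f \<xi> s) = exp (- (\<epsilon> * s)) * corr y s * fejer a s" for s
  proof -
    have "(\<lambda>\<xi>. ?f \<xi> s) = (\<lambda>\<xi>. (exp (- (\<epsilon> * s)) * corr y s) * (2 * (1 - \<xi> / a) * cos (\<xi> * s)))" by (auto simp: mult_ac)
    then show ?thesis unfolding fejer_def by (simp only: integral_mult_right)
  qed
  show "integral {0..a} (\<lambda>\<xi>. (1 - \<xi> / a) * even_res_trunc y \<epsilon> t \<xi>) = integral {0..t} (\<lambda>s. exp (- (\<epsilon> * s)) * corr y s * fejer a s)"
    using integral_swap_continuous[OF cont] by (simp only: cbox_interval inner1 inner2)
  have "continuous_on {0..a} (\<lambda>\<xi>. integral (cbox 0 t) (?f \<xi>))"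
    by (rule integral_continuous_on_param) (use cont in \<open>simp add: cbox_Pair_eq\<close>)
  then show "continuous_on {0..a} (\<lambda>\<xi>. (1 - \<xi> / a) * even_res_trunc y \<epsilon> t \<xi>)" by (simp only: cbox_interval inner1)
  have "continuous_on {0..t} (\<lambda>s. integral (cbox 0 a) (\<lambda>\<xi>. ?f \<xi> s))"
  proof (rule integral_continuous_on_param)
    have "continuous_on ({0..t} \<times> cbox 0 a) ((\<lambda>(\<xi>, s). ?f \<xi> s) \<circ> prod.swap)"
      by (rule continuous_on_compose[OF continuous_on_swap continuous_on_subset[OF cont]]) (auto simp: cbox_Pair_eq)
    then show "continuous_on ({0..t} \<times> cbox 0 a) (\<lambda>(s, \<xi>). ?f \<xi> s)"
      by (rule continuous_on_eq) auto
  qed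
  then show "continuous_on {0..t} (\<lambda>s. exp (- (\<epsilon> * s)) * corr y s * fejer a s)" by (simp only: cbox_interval inner2)
qed

end

lemma nn_integral_real_symmetric:
  fixes f :: "real \<Rightarrow> real"
  assumes f: "continuous_on UNIV f" and nn: "\<And>x. 0 \<le> f x" and a: "0 \<le> a"
  shows "(\<integral>\<^sup>+x. ennreal (f x) * indicator {-a..a} x \<partial>lebesgue) = ennreal (integral {0..a} (\<lambda>x. f x + f (- x)))"
proof -
  have int: "f integrable_on {c..d}" for c d
    by (intro integrable_continuous_interval continuous_on_subset[OF f]) auto
  have neg: "(\<lambda>x. f (- x)) integrable_on {0..a}"
    by (intro integrable_continuous_interval continuous_on_compose2[OF f]) (auto intro: continuous_intros)
  have "integral {-a..a} f = integral {-a..0} f + integral {0..a} f"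
    using a by (intro Henstock_Kurzweil_Integration.integral_combine[symmetric] int) auto
  also have "integral {-a..0} f = integral {0..a} (\<lambda>x. f (- x))"
    using Henstock_Kurzweil_Integration.integral_reflect_real[of a 0 "\<lambda>x. f (- x)"] by simp
  also have "integral {0..a} (\<lambda>x. f (- x)) + integral {0..a} f = integral {0..a} (\<lambda>x. f x + f (- x))"
    using integral_add[OF int neg] by simp
  finally have eq: "integral {-a..a} f = integral {0..a} (\<lambda>x. f x + f (- x))" .
  have "(\<integral>\<^sup>+x. ennreal (indicator {-a..a} x * f x) \<partial>lborel) = ennreal (integral {-a..a} f)"
    by (rule nn_integral_has_integral_lebesgue[OF nn integrable_integral[OF int]])
  moreover have "(\<integral>\<^sup>+x. ennreal (f x) * indicator {-a..a} x \<partial>lebesgue) = (\<integral>\<^sup>+x. ennreal (indicator {-a..a} x * f x) \<partial>lborel)"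
    unfolding nn_integral_completion by (intro nn_integral_cong) (auto simp: indicator_def)
  ultimately show ?thesis by (simp only: eq)
qed

lemma nn_integral_real_bound:
  fixes f :: "real \<Rightarrow> real"
  assumes f: "continuous_on UNIV f" and nn: "\<And>x. 0 \<le> f x"
    and b: "\<And>n::nat. integral {0..real n} (\<lambda>x. f x + f (- x)) \<le> b"
  shows "(\<integral>\<^sup>+x. ennreal (f x) \<partial>lebesgue) \<le> ennreal b"
proof -
  have [measurable]: "f \<in> borel_measurable borel" by (rule borel_measurable_continuous_onI[OF f])
  let ?g = "\<lambda>(n::nat) x. ennreal (f x) * indicator {- real n..real n} x"
  have "(SUP n. ?g n x) = ennreal (f x)" for x
  proof (rule antisym)
    show "(SUP n. ?g n x) \<le> ennreal (f x)" by (rule SUP_least) (auto simp: indicator_def)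
    obtain n :: nat where "\<bar>x\<bar> \<le> real n" using real_arch_simple by blast
    then have eq: "?g n x = ennreal (f x)" by (auto simp: indicator_def)
    have "?g n x \<le> (SUP n. ?g n x)" by (rule SUP_upper) simp
    then show "ennreal (f x) \<le> (SUP n. ?g n x)" unfolding eq .
  qed
  then have "(\<integral>\<^sup>+x. ennreal (f x) \<partial>lborel) = (\<integral>\<^sup>+x. (SUP n. ?g n x) \<partial>lborel)" by simp
  also have "\<dots> = (SUP n. (\<integral>\<^sup>+x. ?g n x \<partial>lborel))"
  proof (rule nn_integral_monotone_convergence_SUP)
    show "incseq ?g" by (auto simp: incseq_def le_fun_def indicator_def)
  qed measurable
  also have "\<dots> \<le> ennreal b"
  proof (rule SUP_least)
    fix n
    show "(\<integral>\<^sup>+x. ?g n x \<partial>lborel) \<le> ennreal b"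
      using nn_integral_real_symmetric[OF f nn, of "real n"] b[of n]
      by (simp add: nn_integral_completion ennreal_leI)
  qed
  finally show ?thesis by (simp add: nn_integral_completion)
qed

section \<open>Bounds for the resolvent energy\<close>

context isometric_semigroup
begin

text \<open>Letting the truncation time grow in \<open>fejer_swap\<close>: the left-hand side
  converges uniformly in \<xi>, hence the right-hand side converges as well.\<close>

lemma fejer_average_limit:
  assumes e: "\<epsilon> > 0" and a: "a > 0"
  shows "((\<lambda>t. integral {0..t} (\<lambda>s. exp (- (\<epsilon> * s)) * corr y s * fejer a s)) \<longlongrightarrow>
    integral {0..a} (\<lambda>\<xi>. (1 - \<xi> / a) * even_res y \<epsilon> \<xi>)) at_top"
proof (rule Lim_transform2)
  show "((\<lambda>t. integral {0..a} (\<lambda>\<xi>. (1 - \<xi> / a) * even_res y \<epsilon> \<xi>)) \<longlongrightarrow> integral {0..a} (\<lambda>\<xi>. (1 - \<xi> / a) * even_res y \<epsilon> \<xi>)) at_top"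
    by (rule tendsto_const)
  have "LIM t at_top. \<epsilon> * t :> at_top"
    by (rule filterlim_tendsto_pos_mult_at_top[OF tendsto_const e filterlim_ident])
  then have "LIM t at_top. - (\<epsilon> * t) :> at_bot" by (simp only: filterlim_uminus_at_top)
  then have "((\<lambda>t. exp (- (\<epsilon> * t))) \<longlongrightarrow> 0) at_top" by (rule filterlim_compose[OF exp_at_bot])
  then have "((\<lambda>t. 2 * (exp (- (\<epsilon> * t)) * (norm y)\<^sup>2 / \<epsilon>) * (a - 0)) \<longlongrightarrow> 2 * (0 * (norm y)\<^sup>2 / \<epsilon>) * (a - 0)) at_top"
    using e by (intro tendsto_intros) auto
  then have lim: "((\<lambda>t. 2 * (exp (- (\<epsilon> * t)) * (norm y)\<^sup>2 / \<epsilon>) * (a - 0)) \<longlongrightarrow> 0) at_top" by simp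
  show "((\<lambda>t. integral {0..a} (\<lambda>\<xi>. (1 - \<xi> / a) * even_res y \<epsilon> \<xi>) -
      integral {0..t} (\<lambda>s. exp (- (\<epsilon> * s)) * corr y s * fejer a s)) \<longlongrightarrow> 0) at_top"
  proof (rule Lim_null_comparison[OF _ lim])
    show "eventually (\<lambda>t. norm (integral {0..a} (\<lambda>\<xi>. (1 - \<xi> / a) * even_res y \<epsilon> \<xi>) -
      integral {0..t} (\<lambda>s. exp (- (\<epsilon> * s)) * corr y s * fejer a s)) \<le> 2 * (exp (- (\<epsilon> * t)) * (norm y)\<^sup>2 / \<epsilon>) * (a - 0)) at_top"
      using eventually_ge_at_top[of 0]
    proof eventually_elim
      case (elim t)
      have c1: "continuous_on {0..a} (\<lambda>\<xi>. (1 - \<xi> / a) * even_res y \<epsilon> \<xi>)"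
        using a by (intro continuous_intros even_res_cont e) auto
      note c2 = fejer_swap(3)[OF a elim, of y \<epsilon>]
      have "integral {0..a} (\<lambda>\<xi>. (1 - \<xi> / a) * even_res y \<epsilon> \<xi>) - integral {0..t} (\<lambda>s. exp (- (\<epsilon> * s)) * corr y s * fejer a s) =
        integral {0..a} (\<lambda>\<xi>. (1 - \<xi> / a) * even_res y \<epsilon> \<xi> - (1 - \<xi> / a) * even_res_trunc y \<epsilon> t \<xi>)"
        unfolding fejer_swap(1)[OF a elim, symmetric]
        by (intro Henstock_Kurzweil_Integration.integral_diff[symmetric] integrable_continuous_interval c1 c2)
      also have "norm \<dots> \<le> 2 * (exp (- (\<epsilon> * t)) * (norm y)\<^sup>2 / \<epsilon>) * (a - 0)"
      proof (rule integral_bound)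
        fix \<xi> assume x: "\<xi> \<in> {0..a}"
        then have "\<bar>1 - \<xi> / a\<bar> \<le> 1" using a by (auto simp: abs_le_iff field_simps)
        then have "\<bar>1 - \<xi> / a\<bar> * \<bar>even_res y \<epsilon> \<xi> - even_res_trunc y \<epsilon> t \<xi>\<bar> \<le> 1 * (2 * (exp (- (\<epsilon> * t)) * (norm y)\<^sup>2 / \<epsilon>))"
          by (intro mult_mono even_res_truncate e elim) auto
        then show "norm ((1 - \<xi> / a) * even_res y \<epsilon> \<xi> - (1 - \<xi> / a) * even_res_trunc y \<epsilon> t \<xi>) \<le> 2 * (exp (- (\<epsilon> * t)) * (norm y)\<^sup>2 / \<epsilon>)"
          by (simp add: abs_mult flip: right_diff_distrib)
      qed (use a c1 c2 in \<open>auto intro: continuous_on_diff\<close>)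
      finally show ?case .
    qed
  qed
qed

lemma fejer_average_le:
  assumes e: "\<epsilon> > 0" and a: "a > 0"
  shows "integral {0..a} (\<lambda>\<xi>. (1 - \<xi> / a) * even_res y \<epsilon> \<xi>) \<le> 10 * (norm y)\<^sup>2"
proof (rule tendsto_upperbound[OF fejer_average_limit[OF e a]])
  show "eventually (\<lambda>t. integral {0..t} (\<lambda>s. exp (- (\<epsilon> * s)) * corr y s * fejer a s) \<le> 10 * (norm y)\<^sup>2) at_top"
    using eventually_ge_at_top[of 0]
  proof eventually_elim
    case (elim t)
    have hi: "((\<lambda>s. (norm y)\<^sup>2 * (5 * (a / (1 + (a * s)\<^sup>2)))) has_integral ((norm y)\<^sup>2 * 5 * arctan (a * t) - (norm y)\<^sup>2 * 5 * arctan (a * 0))) {0..t}"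
      by (rule fundamental_theorem_of_calculus[OF elim])
         (auto intro!: derivative_eq_intros simp: has_real_derivative_iff_has_vector_derivative[symmetric] divide_inverse)
    have "integral {0..t} (\<lambda>s. exp (- (\<epsilon> * s)) * corr y s * fejer a s) \<le> integral {0..t} (\<lambda>s. (norm y)\<^sup>2 * (5 * (a / (1 + (a * s)\<^sup>2))))"
    proof (rule integral_le[OF integrable_continuous_interval[OF fejer_swap(2)[OF a elim]] has_integral_integrable[OF hi]])
      fix s assume s: "s \<in> {0..t}"
      have "exp (- (\<epsilon> * s)) * corr y s \<le> 1 * (norm y)\<^sup>2"
        using corr_le[of s y] s e by (intro order_trans[OF mult_left_mono[of _ "(norm y)\<^sup>2"] mult_right_mono]) auto
      then have "exp (- (\<epsilon> * s)) * corr y s * fejer a s \<le> (norm y)\<^sup>2 * fejer a s"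
        using fejer_nonneg[OF a, of s] s by (intro mult_right_mono) auto
      also have "\<dots> \<le> (norm y)\<^sup>2 * (5 * (a / (1 + (a * s)\<^sup>2)))"
        using fejer_le_arctan[OF a, of s] s by (intro mult_left_mono) auto
      finally show "exp (- (\<epsilon> * s)) * corr y s * fejer a s \<le> (norm y)\<^sup>2 * (5 * (a / (1 + (a * s)\<^sup>2)))" .
    qed
    also have "\<dots> = (norm y)\<^sup>2 * 5 * arctan (a * t)" using integral_unique[OF hi] by simp
    \<comment> \<open>\<open>arctan\<close> stays below half of \<open>pi\<close>, hence below 2;
      this is the origin of the constant 10, which is independent of \<open>a\<close> and
      \<epsilon>.\<close>
    also have "\<dots> \<le> (norm y)\<^sup>2 * 5 * 2"
      using arctan_ubound[of "a * t"] pi_less_4 by (intro mult_left_mono) auto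
    finally show ?case by simp
  qed
qed simp

text \<open>The kernel concentrates at \<open>s = 0\<close>, where the correlation is
  \<open>(norm y)\<^sup>2\<close>. The part near 0 yields at least 1/8 of it, the part beyond
  \<delta> takes away at most 1/16. The resulting \<open>a\<close> depends on \<open>y\<close> but
  serves all \<epsilon> up to 1.\<close>

lemma fejer_average_ge:
  assumes y: "y \<noteq> 0"
  shows "\<exists>a>0. \<forall>\<epsilon>. 0 < \<epsilon> \<and> \<epsilon> \<le> 1 \<longrightarrow> (norm y)\<^sup>2 / 16 \<le> integral {0..a} (\<lambda>\<xi>. (1 - \<xi> / a) * even_res y \<epsilon> \<xi>)"
proof -
  let ?n = "(norm y)\<^sup>2"
  have n: "?n > 0" using y by simp
  have p0: "corr y 0 = ?n" by (simp add: corr_def U_0 power2_norm_eq_inner)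
  obtain d where d: "d > 0" "\<And>s. 0 \<le> s \<Longrightarrow> s < d \<Longrightarrow> \<bar>corr y s - ?n\<bar> < ?n / 2"
    using corr_cont[of y] n unfolding continuous_on_iff dist_real_def
    by (metis p0 abs_of_nonneg atLeast_iff diff_zero half_gt_zero order_refl)
  \<comment> \<open>Below \<open>d\<close> the correlation keeps half of its initial value; the cap
    1/2 makes \<open>exp (- (\<epsilon> * s))\<close> at least 1/2 as well.\<close>
  define \<delta> where "\<delta> = min (d / 2) (1 / 2)"
  have \<delta>: "0 < \<delta>" "\<delta> \<le> 1/2" "\<delta> < d" using d by (auto simp: \<delta>_def)
  \<comment> \<open>With \<open>a * \<delta> = 64\<close> the tail bound
    \<open>4 / (a * \<delta>)\<close> is 1/16.\<close>
  define a where "a = 64 / \<delta>"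
  have a: "a > 0" "1 / a \<le> \<delta>" "a * \<delta> = 64" using \<delta> by (auto simp: a_def)
  have "?n / 16 \<le> integral {0..a} (\<lambda>\<xi>. (1 - \<xi> / a) * even_res y \<epsilon> \<xi>)" if e: "0 < \<epsilon>" "\<epsilon> \<le> 1" for \<epsilon>
  proof (rule tendsto_lowerbound[OF fejer_average_limit[OF e(1) a(1)]])
    let ?f = "\<lambda>s. exp (- (\<epsilon> * s)) * corr y s * fejer a s"
    have low: "?n / 4 \<le> exp (- (\<epsilon> * s)) * corr y s" if s: "0 \<le> s" "s \<le> \<delta>" for s
    proof -
      have "\<epsilon> * s \<le> 1 * (1/2)" using e s \<delta> by (intro mult_mono) auto
      then have "1/2 \<le> exp (- (\<epsilon> * s))" using exp_ge_add_one_self[of "- (\<epsilon> * s)"] by simp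
      moreover have "?n / 2 \<le> corr y s" using d(2)[of s] s \<delta> by linarith
      ultimately have "(1/2) * (?n / 2) \<le> exp (- (\<epsilon> * s)) * corr y s" using n by (intro mult_mono) auto
      then show ?thesis by simp
    qed
    show "eventually (\<lambda>t. ?n / 16 \<le> integral {0..t} ?f) at_top"
      using eventually_ge_at_top[of \<delta>]
    proof eventually_elim
      case (elim t)
      have t: "0 \<le> t" using elim \<delta> by simp
      have cont: "continuous_on {0..t} ?f" by (rule fejer_swap(2)[OF a(1) t])
      have int: "?f integrable_on {c..b}" if "0 \<le> c" "b \<le> t" for c b
        by (intro integrable_continuous_interval continuous_on_subset[OF cont]) (use that in auto)
      have fnn: "0 \<le> ?f s" if "s \<in> {0..\<delta>}" for s
      proof (rule mult_nonneg_nonneg)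
        show "0 \<le> exp (- (\<epsilon> * s)) * corr y s" by (rule order_trans[OF _ low[of s]]) (use that n in auto)
        show "0 \<le> fejer a s" using fejer_nonneg[OF a(1), of s] that by simp
      qed
      \<comment> \<open>Over length \<open>1 / a\<close> the integrand is at least a quarter of
        \<open>?n\<close> times \<open>a / 2\<close>, which gives the 1/8. Between
        \<open>1 / a\<close> and \<delta> it is merely nonnegative.\<close>
      have "integral {0..1/a} (\<lambda>_. ?n / 4 * (a / 2)) \<le> integral {0..1/a} ?f"
      proof (intro integral_le int)
        fix s assume s: "s \<in> {0..1/a}"
        then have "a * s \<le> 1" using a by (simp add: field_simps)
        then have fg: "a / 2 \<le> fejer a s" using s by (intro fejer_ge a(1)) auto
        have l: "?n / 4 \<le> exp (- (\<epsilon> * s)) * corr y s" by (rule low) (use s a in auto)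
        then have "0 \<le> exp (- (\<epsilon> * s)) * corr y s" by (rule order_trans[rotated]) (use n in simp)
        then show "?n / 4 * (a / 2) \<le> ?f s" by (rule mult_mono[OF l fg]) (use a in simp)
      qed (use a elim in auto)
      also have "integral {0..1/a} (\<lambda>_. ?n / 4 * (a / 2)) = ?n / 8" using a by simp
      also have "integral {0..1/a} ?f \<le> integral {0..\<delta>} ?f"
        by (intro integral_subset_le int) (use a elim fnn in auto)
      finally have 1: "?n / 8 \<le> integral {0..\<delta>} ?f" .
      have hi: "((\<lambda>s. - (?n * (4 / (a * s\<^sup>2)))) has_integral (?n * 4 / (a * t) - ?n * 4 / (a * \<delta>))) {\<delta>..t}"
        by (rule fundamental_theorem_of_calculus[OF elim])
           (use \<delta> a in \<open>auto intro!: derivative_eq_intros simp: has_real_derivative_iff_has_vector_derivative[symmetric] power2_eq_square field_simps\<close>)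
      have "integral {\<delta>..t} (\<lambda>s. - (?n * (4 / (a * s\<^sup>2)))) \<le> integral {\<delta>..t} ?f"
      proof (intro integral_le int has_integral_integrable[OF hi])
        fix s assume s: "s \<in> {\<delta>..t}"
        then have s0: "s > 0" using \<delta> by auto
        have "\<bar>exp (- (\<epsilon> * s)) * corr y s\<bar> \<le> 1 * ?n"
          unfolding abs_mult using corr_le[of s y] s0 e by (intro mult_mono) auto
        then have "\<bar>?f s\<bar> \<le> ?n * (4 / (a * s\<^sup>2))"
          unfolding abs_mult[of _ "fejer a s"] using fejer_le[OF a(1) s0] fejer_nonneg[OF a(1), of s] s0
          by (intro mult_mono) auto
        then show "- (?n * (4 / (a * s\<^sup>2))) \<le> ?f s" by linarith
      qed (use \<delta> in auto)
      then have "?n * 4 / (a * t) - ?n * 4 / (a * \<delta>) \<le> integral {\<delta>..t} ?f" by (simp only: integral_unique[OF hi])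
      moreover have "0 \<le> ?n * 4 / (a * t)" using a t by simp
      ultimately have 2: "- (?n / 16) \<le> integral {\<delta>..t} ?f" unfolding a(3) by simp
      have "integral {0..\<delta>} ?f + integral {\<delta>..t} ?f = integral {0..t} ?f"
        using elim \<delta> by (intro Henstock_Kurzweil_Integration.integral_combine int) auto
      then show ?case using 1 2 by linarith
    qed
  qed simp
  then show ?thesis using a(1) by blast
qed

lemma resolvent_energy_eq:
  "\<epsilon> > 0 \<Longrightarrow> ennreal \<epsilon> * (\<integral>\<^sup>+\<xi>. ennreal ((norm (res (Complex \<epsilon> \<xi>) y))\<^sup>2) \<partial>lebesgue) =
     (\<integral>\<^sup>+\<xi>. ennreal (inner y (res (Complex \<epsilon> \<xi>) y)) \<partial>lebesgue)"
proof -
  assume e: "\<epsilon> > 0"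
  have "(\<lambda>\<xi>. (norm (res (Complex \<epsilon> \<xi>) y))\<^sup>2) \<in> borel_measurable borel"
    by (rule borel_measurable_continuous_onI) (intro continuous_on_power continuous_on_norm res_continuous e)
  then have m: "(\<lambda>\<xi>. ennreal ((norm (res (Complex \<epsilon> \<xi>) y))\<^sup>2)) \<in> borel_measurable lborel" by simp
  have "ennreal \<epsilon> * (\<integral>\<^sup>+\<xi>. ennreal ((norm (res (Complex \<epsilon> \<xi>) y))\<^sup>2) \<partial>lborel) =
      (\<integral>\<^sup>+\<xi>. ennreal \<epsilon> * ennreal ((norm (res (Complex \<epsilon> \<xi>) y))\<^sup>2) \<partial>lborel)"
    by (rule nn_integral_cmult[OF m, symmetric])
  also have "\<dots> = (\<integral>\<^sup>+\<xi>. ennreal (inner y (res (Complex \<epsilon> \<xi>) y)) \<partial>lborel)"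
    using e by (intro nn_integral_cong) (simp add: res_energy ennreal_mult)
  finally show ?thesis unfolding nn_integral_completion .
qed

text \<open>The integrand is nonnegative, so bounded Fejer means already bound the full
  integral.\<close>

lemma resolvent_energy_le:
  assumes e: "\<epsilon> > 0"
  shows "ennreal \<epsilon> * (\<integral>\<^sup>+\<xi>. ennreal ((norm (res (Complex \<epsilon> \<xi>) y))\<^sup>2) \<partial>lebesgue) \<le> ennreal (20 * (norm y)\<^sup>2)"
  unfolding resolvent_energy_eq[OF e]
proof (rule nn_integral_real_bound)
  show "continuous_on UNIV (\<lambda>\<xi>. inner y (res (Complex \<epsilon> \<xi>) y))"
    by (intro continuous_on_inner continuous_on_const res_continuous e)
  show "0 \<le> inner y (res (Complex \<epsilon> \<xi>) y)" for \<xi> using e by (simp add: res_energy)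
  fix n :: nat
  have "integral {0..real n} (even_res y \<epsilon>) \<le> 20 * (norm y)\<^sup>2"
  proof (cases "n = 0")
    case False
    \<comment> \<open>Twice the cutoff makes the triangle at least 1/2 on \<open>{0..n}\<close>;
      hence 20 is twice the 10 of \<open>fejer_average_le\<close>.\<close>
    define a where "a = 2 * real n"
    have a: "a > 0" using False by (simp add: a_def)
    have c: "continuous_on {0..c} (\<lambda>\<xi>. (1 - \<xi> / a) * even_res y \<epsilon> \<xi>)" for c
      using a by (intro continuous_intros even_res_cont e) auto
    have "integral {0..real n} (\<lambda>\<xi>. (1/2) * even_res y \<epsilon> \<xi>) \<le> integral {0..real n} (\<lambda>\<xi>. (1 - \<xi> / a) * even_res y \<epsilon> \<xi>)"
    proof (intro integral_le integrable_continuous_interval c continuous_intros even_res_cont e)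
      fix \<xi> assume "\<xi> \<in> {0..real n}"
      then have "1/2 \<le> 1 - \<xi> / a" using a by (simp add: a_def field_simps)
      then show "(1/2) * even_res y \<epsilon> \<xi> \<le> (1 - \<xi> / a) * even_res y \<epsilon> \<xi>" by (intro mult_right_mono even_res_nonneg e)
    qed
    also have "\<dots> \<le> integral {0..a} (\<lambda>\<xi>. (1 - \<xi> / a) * even_res y \<epsilon> \<xi>)"
    proof (intro integral_subset_le integrable_continuous_interval c)
      show "\<forall>\<xi>\<in>{0..a}. 0 \<le> (1 - \<xi> / a) * even_res y \<epsilon> \<xi>"
        using a by (intro ballI mult_nonneg_nonneg even_res_nonneg e) (simp add: field_simps)
    qed (simp add: a_def)
    also have "\<dots> \<le> 10 * (norm y)\<^sup>2" by (rule fejer_average_le[OF e a])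
    finally show ?thesis by simp
  qed simp
  then show "integral {0..real n} (\<lambda>x. inner y (res (Complex \<epsilon> x) y) + inner y (res (Complex \<epsilon> (- x)) y)) \<le> 20 * (norm y)\<^sup>2"
    by (simp add: even_res_def[abs_def])
qed

text \<open>The triangular weight is at most 1, so the Fejer mean lies below the integral over
  \<open>[-a, a]\<close>, and by nonnegativity below the integral over the line.\<close>

lemma resolvent_energy_ge:
  "eventually (\<lambda>\<epsilon>. ennreal ((norm y)\<^sup>2 / 16) \<le> ennreal \<epsilon> * (\<integral>\<^sup>+\<xi>. ennreal ((norm (res (Complex \<epsilon> \<xi>) y))\<^sup>2) \<partial>lebesgue)) (at_right 0)"
proof (cases "y = 0")
  case False
  from fejer_average_ge[OF this] obtain a where a: "a > 0"
    and low: "\<And>\<epsilon>. 0 < \<epsilon> \<Longrightarrow> \<epsilon> \<le> 1 \<Longrightarrow> (norm y)\<^sup>2 / 16 \<le> integral {0..a} (\<lambda>\<xi>. (1 - \<xi> / a) * even_res y \<epsilon> \<xi>)" by blast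
  have "eventually (\<lambda>\<epsilon>::real. \<epsilon> < 1) (at_right 0)" by (intro eventually_at_rightI[of 0 1]) auto
  with eventually_at_right_less[of 0] show ?thesis
  proof eventually_elim
    case (elim \<epsilon>)
    then have e: "0 < \<epsilon>" "\<epsilon> \<le> 1" by auto
    let ?u = "\<lambda>\<xi>. inner y (res (Complex \<epsilon> \<xi>) y)"
    have unn: "0 \<le> ?u \<xi>" for \<xi> using e by (simp add: res_energy)
    have "(norm y)\<^sup>2 / 16 \<le> integral {0..a} (\<lambda>\<xi>. (1 - \<xi> / a) * even_res y \<epsilon> \<xi>)" by (rule low[OF e])
    also have "\<dots> \<le> integral {0..a} (even_res y \<epsilon>)"
    proof (intro integral_le integrable_continuous_interval continuous_intros even_res_cont e(1))
      fix \<xi> assume "\<xi> \<in> {0..a}"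
      then have "1 - \<xi> / a \<le> 1" using a by simp
      from mult_right_mono[OF this even_res_nonneg[OF e(1)]] show "(1 - \<xi> / a) * even_res y \<epsilon> \<xi> \<le> even_res y \<epsilon> \<xi>" by simp
    qed (use a in simp)
    finally have "ennreal ((norm y)\<^sup>2 / 16) \<le> ennreal (integral {0..a} (\<lambda>\<xi>. ?u \<xi> + ?u (- \<xi>)))"
      by (intro ennreal_leI) (simp add: even_res_def[abs_def])
    also have "\<dots> = (\<integral>\<^sup>+x. ennreal (?u x) * indicator {-a..a} x \<partial>lebesgue)"
      by (rule nn_integral_real_symmetric[symmetric])
         (use a unn in \<open>auto intro!: continuous_on_inner continuous_on_const res_continuous e\<close>)
    also have "\<dots> \<le> (\<integral>\<^sup>+x. ennreal (?u x) \<partial>lebesgue)"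
      by (intro nn_integral_mono) (simp add: indicator_def)
    finally show ?case unfolding resolvent_energy_eq[OF e(1)] .
  qed
qed simp

end

text \<open>The energy bounds 20 and 1/16 for the isometric semigroup turn into
  \<open>20 * K\<^sup>2\<close> and \<open>1 / (16 * K\<^sup>2)\<close>, where \<open>K\<close>
  controls \<open>R\<close> and its inverse.\<close>

lemma cond_i_imp_cond_iii:
  fixes J :: "'h::{real_inner,complete_space} \<Rightarrow> 'h"
  assumes J: "cstruct J" and E: "lin_op J J D E" and i: "cond_i J D E"
  shows "cond_iii J J D E"
proof -
  obtain T R S where T: "generates J D E T" and R: "bounded_clinear_op J J R" and S: "bounded_clinear_op J J S"
    and RS: "R \<circ> S = id" and SR: "S \<circ> R = id" and iso: "\<And>t x. t \<ge> 0 \<Longrightarrow> norm (R (T t (S x))) = norm x"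
    using i unfolding cond_i_def by blast
  obtain K where K: "K > 0" "\<And>x. norm (R x) \<le> K * norm x" "\<And>x. norm (S x) \<le> K * norm x" "\<And>x. norm x \<le> K * norm (R x)"
    using similarity_bounds[OF R S SR] by blast
  interpret R: bounded_linear R using R by (simp add: bounded_clinear_op_def)
  interpret S: bounded_linear S using S by (simp add: bounded_clinear_op_def)
  have RS': "R (S x) = x" and SR': "S (R x) = x" for x using RS SR by (metis comp_apply id_apply)+
  have RJ: "R (J x) = J (R x)" and SJ: "S (J x) = J (S x)" for x using R S by (auto simp: bounded_clinear_op_def)
  define D' A where "D' = {x. S x \<in> D}" and "A = (\<lambda>x. R (E (S x)))"
  interpret isometric_semigroup J D' A "\<lambda>t. R \<circ> T t \<circ> S"
  proof
    show "cstruct J" by fact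
    show "lin_op J J D' A" using E
      unfolding lin_op_def csubspace_def subspace_def D'_def A_def
      by (auto simp: S.add S.scaleR S.zero SJ R.add R.scaleR RJ)
    show "generates J D' A (\<lambda>t. R \<circ> T t \<circ> S)"
      unfolding D'_def A_def by (rule generates_similar[OF T R S RS SR])
    show "norm ((R \<circ> T t \<circ> S) x) = norm x" if "t \<ge> 0" for t x using iso[OF that] by simp
  qed
  have cs: "R (cscale J c x) = cscale J c (R x)" for c x by (simp add: cscale_def R.add R.scaleR RJ)
  have cs': "S (cscale J c x) = cscale J c (S x)" for c x by (simp add: cscale_def S.add S.scaleR SJ)
  have inE: "lam \<in> resolvent_set J D E" if lam: "Re lam > 0" for lam
  proof -
    obtain Q where Q: "bounded_linear Q" "\<And>x. x \<in> D' \<Longrightarrow> Q (cscale J lam x - A x) = x"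
      "\<And>y. Q y \<in> D'" "\<And>y. cscale J lam (Q y) - A (Q y) = y"
      using in_resolvent_set[OF lam] unfolding resolvent_set_def by blast
    have "bounded_linear (\<lambda>x. S (Q (R x)))"
      by (intro bounded_linear_compose[OF S.bounded_linear_axioms] bounded_linear_compose[OF Q(1)] R.bounded_linear_axioms)
    moreover have "S (Q (R (cscale J lam x - E x))) = x" if "x \<in> D" for x
      using Q(2)[of "R x"] that by (simp add: D'_def A_def SR' R.diff cs)
    moreover have "S (Q (R y)) \<in> D" for y using Q(3)[of "R y"] by (simp add: D'_def)
    moreover have "cscale J lam (S (Q (R y))) - E (S (Q (R y))) = y" for y
    proof -
      have "S (cscale J lam (Q (R y)) - A (Q (R y))) = S (R y)" by (simp only: Q(4))
      then show ?thesis by (simp add: S.diff cs' A_def SR')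
    qed
    ultimately show ?thesis unfolding resolvent_set_def by blast
  qed
  \<comment> \<open>\<open>R\<close> intertwines the resolvents of \<open>E\<close> and of the skew
    operator \<open>R E S\<close>, so the energy of \<open>E\<close> with \<open>C = R\<close> is
    that of the isometric semigroup started at \<open>R h\<close>.\<close>
  have Rres: "R (resolvent J D E lam y) = res lam (R y)" if lam: "Re lam > 0" for lam y
  proof (rule res_unique[OF lam, symmetric])
    note l = inE[OF lam]
    show "R (resolvent J D E lam y) \<in> D'" using resolvent_in[OF J E l] by (simp add: D'_def SR')
    have "R (cscale J lam (resolvent J D E lam y) - E (resolvent J D E lam y)) = R y" by (simp only: resolvent_eq[OF J E l])
    then show "cscale J lam (R (resolvent J D E lam y)) - A (R (resolvent J D E lam y)) = R y"
      by (simp add: R.diff cs A_def SR')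
  qed
  have "spectrum J D E \<subseteq> {z. Re z \<le> 0}" using inE by (auto simp: spectrum_def not_less[symmetric])
  moreover have "lin_op J J UNIV R"
    using R by (simp add: lin_op_def csubspace_def R.add R.scaleR bounded_clinear_op_def)
  moreover have "bochner_measurable lebesgue (\<lambda>\<xi>. R (resolvent J D E (Complex \<epsilon> \<xi>) h))" if e: "\<epsilon> > 0" for \<epsilon> h
  proof (rule bochner_measurable_continuous)
    show "continuous_on UNIV (\<lambda>\<xi>. R (resolvent J D E (Complex \<epsilon> \<xi>) h))"
      using res_continuous[OF e, of "R h"] e by (simp add: Rres)
    show "f \<in> borel_measurable lebesgue" if "f \<in> borel_measurable borel" for f :: "real \<Rightarrow> real"
      by (intro measurable_completion) (simp add: that)
  qed
  moreover have "Limsup (at_right 0) (\<lambda>\<epsilon>. ennreal \<epsilon> *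
       (\<integral>\<^sup>+ \<xi>. ennreal ((norm (R (resolvent J D E (Complex \<epsilon> \<xi>) h)))\<^sup>2) \<partial>lebesgue)) \<le> ennreal (20 * K\<^sup>2 * (norm h)\<^sup>2)" for h
  proof (rule Limsup_bounded)
    show "eventually (\<lambda>\<epsilon>. ennreal \<epsilon> * (\<integral>\<^sup>+ \<xi>. ennreal ((norm (R (resolvent J D E (Complex \<epsilon> \<xi>) h)))\<^sup>2) \<partial>lebesgue)
        \<le> ennreal (20 * K\<^sup>2 * (norm h)\<^sup>2)) (at_right 0)"
      using eventually_at_right_less[of 0]
    proof eventually_elim
      case (elim \<epsilon>)
      have "ennreal \<epsilon> * (\<integral>\<^sup>+ \<xi>. ennreal ((norm (R (resolvent J D E (Complex \<epsilon> \<xi>) h)))\<^sup>2) \<partial>lebesgue) \<le> ennreal (20 * (norm (R h))\<^sup>2)"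
        using resolvent_energy_le[OF elim, of "R h"] elim by (simp add: Rres)
      also have "\<dots> \<le> ennreal (20 * (K * norm h)\<^sup>2)" by (intro ennreal_leI mult_left_mono power_mono K) auto
      finally show ?case by (simp add: power_mult_distrib mult.assoc)
    qed
  qed
  moreover have "ennreal (1 / (16 * K\<^sup>2) * (norm h)\<^sup>2) \<le> Liminf (at_right 0) (\<lambda>\<epsilon>. ennreal \<epsilon> *
       (\<integral>\<^sup>+ \<xi>. ennreal ((norm (R (resolvent J D E (Complex \<epsilon> \<xi>) h)))\<^sup>2) \<partial>lebesgue))" for h
  proof (rule Liminf_bounded)
    show "eventually (\<lambda>\<epsilon>. ennreal (1 / (16 * K\<^sup>2) * (norm h)\<^sup>2) \<le> ennreal \<epsilon> *
       (\<integral>\<^sup>+ \<xi>. ennreal ((norm (R (resolvent J D E (Complex \<epsilon> \<xi>) h)))\<^sup>2) \<partial>lebesgue)) (at_right 0)"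
      using eventually_at_right_less[of 0] resolvent_energy_ge[of "R h"]
    proof eventually_elim
      case (elim \<epsilon>)
      have "(norm h)\<^sup>2 \<le> (K * norm (R h))\<^sup>2" by (intro power_mono K) simp
      then have "1 / (16 * K\<^sup>2) * (norm h)\<^sup>2 \<le> (norm (R h))\<^sup>2 / 16"
        using K(1) by (simp add: field_simps power_mult_distrib)
      then have "ennreal (1 / (16 * K\<^sup>2) * (norm h)\<^sup>2) \<le> ennreal ((norm (R h))\<^sup>2 / 16)" by (rule ennreal_leI)
      also note elim(2)
      finally show ?case using elim(1) by (simp add: Rres)
    qed
  qed
  ultimately have "\<exists>\<alpha> \<beta>::real. \<alpha> > 0 \<and> \<beta> > 0 \<and> (\<forall>h. Limsup (at_right 0) (\<lambda>\<epsilon>. ennreal \<epsilon> *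
       (\<integral>\<^sup>+ \<xi>. ennreal ((norm (R (resolvent J D E (Complex \<epsilon> \<xi>) h)))\<^sup>2) \<partial>lebesgue)) \<le> ennreal (\<beta> * (norm h)\<^sup>2) \<and>
      ennreal (\<alpha> * (norm h)\<^sup>2) \<le> Liminf (at_right 0) (\<lambda>\<epsilon>. ennreal \<epsilon> *
       (\<integral>\<^sup>+ \<xi>. ennreal ((norm (R (resolvent J D E (Complex \<epsilon> \<xi>) h)))\<^sup>2) \<partial>lebesgue)))"
    using K(1) by (intro exI[of _ "1 / (16 * K\<^sup>2)"] exI[of _ "20 * K\<^sup>2"] conjI allI) simp_all
  then show ?thesis
    unfolding cond_iii_def
    using J \<open>spectrum J D E \<subseteq> {z. Re z \<le> 0}\<close> \<open>lin_op J J UNIV R\<close>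
      \<open>\<And>\<epsilon> h. \<epsilon> > 0 \<Longrightarrow> bochner_measurable lebesgue (\<lambda>\<xi>. R (resolvent J D E (Complex \<epsilon> \<xi>) h))\<close>
    by (intro conjI exI[of _ UNIV] exI[of _ R]) simp_all
qed

text \<open>The existence of a Hilbert space \<open>K\<close> is a quantification over types, which
  the statement expresses in two halves: from (i) the space can be taken to be \<open>H\<close>
  itself with \<open>C = R\<close>, while the converse implications hold for an arbitrary type
  \<open>'k\<close>.\<close>

theorem theorem8p8:
  fixes J :: "'h::{real_inner,complete_space} \<Rightarrow> 'h"
    and D :: "'h set" and E :: "'h \<Rightarrow> 'h"
  assumes "cstruct J"
    and "lin_op J J D E"
  shows "(cond_i J D E \<longleftrightarrow> cond_ii J J D E) \<and>
         (cond_i J D E \<longleftrightarrow> cond_iii J J D E) \<and>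
         (\<forall>JK::'k::{real_inner,complete_space} \<Rightarrow> 'k. cond_ii J JK D E \<longrightarrow> cond_i J D E) \<and>
         (\<forall>JK::'k::{real_inner,complete_space} \<Rightarrow> 'k. cond_iii J JK D E \<longrightarrow> cond_i J D E)"
proof (intro conjI allI impI iffI)
  show "cond_ii J J D E" if "cond_i J D E" using assms(1) that by (rule cond_i_imp_cond_ii)
  show "cond_iii J J D E" if "cond_i J D E" using assms that by (rule cond_i_imp_cond_iii)
  show "cond_i J D E" if "cond_ii J J D E" using assms(1) that by (rule cond_ii_imp_cond_i)
  show "cond_i J D E" if "cond_iii J J D E" using assms that by (rule cond_iii_imp_cond_i)
  show "cond_i J D E" if "cond_ii J JK D E" for JK :: "'k \<Rightarrow> 'k"
    using assms(1) that by (rule cond_ii_imp_cond_i)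
  show "cond_i J D E" if "cond_iii J JK D E" for JK :: "'k \<Rightarrow> 'k"
    using assms that by (rule cond_iii_imp_cond_i)
qed

end
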